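(* Let $\mathcal{A}'_3=\mathcal{A}_1\times\mathcal{A}_2$. Then \[ \big((\mathcal{A}_1 \bullet \mathcal{A}'_3) \cup (\mathcal{A}_2 \bullet \mathcal{A}_2)\big) \setminus \big((\mathcal{A}_1 \times \mathcal{A}'_3) \cup (\mathcal{A}_2 \times \mathcal{A}_2)\big) = \{ (\mathbb{Z}/4)^5 \}. \]
   Context: All groups are considered up to isomorphism. For nonempty sets $\mathcal{A},\mathcal{B}$ of (isomorphism classes of) finite abelian groups, put $\mathcal{A}\times\mathcal{B}=\{H\times K \mid H\in\mathcal{A},\,K\in\mathcal{B}\}$, and let $\mathcal{A}\bullet\mathcal{B}$ be the set of all finite abelian groups $G$ for which there is an exact sequence $0\to H\to G\to K\to 0$ with $H\in\mathcal{A}$ and $K\in\mathcal{B}$ (all abelian extensions are taken). $\mathcal{A}_n$ denotes the set of isomorphism classes of finite abelian subgroups of the Cremona group $\mathrm{Cr}_n(\mathbb{C})=\mathrm{Bir}(\mathbb{P}^n_{\mathbb{C}})$. It is known that $\mathcal{A}_1$ consists exactly of $\mathbb{Z}/k$ for $k\ge 1$ and $(\mathbb{Z}/2)^2$, and (Blanc) that $\mathcal{A}_2$ consists exactly of: (1) $\mathbb{Z}/k\times\mathbb{Z}/m$ for $k,m\ge 1$; (2) $\mathbb{Z}/2k\times(\mathbb{Z}/2)^2$ for $k\ge 1$; (3) $(\mathbb{Z}/4)^2\times\mathbb{Z}/2$; (4) $(\mathbb{Z}/3)^3$; (5) $(\mathbb{Z}/2)^4$. Here $\mathbb{Z}/2k$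 denotes the cyclic group of order $2k$. *)

theory Defs
  imports Complex_Main "HOL-Algebra.Product_Groups" "HOL-Algebra.Exact_Sequence"
begin

section \<open>The Cremona group\<close>

text \<open>
  Homogeneous polynomials of degree \<open>d\<close> in \<open>x\<^sub>0, \<dots>, x\<^sub>n\<close>, as functions. Since the ground
  field is infinite, a polynomial is determined by its function.
\<close>
definition forms :: "nat \<Rightarrow> nat \<Rightarrow> ((nat \<Rightarrow> complex) \<Rightarrow> complex) set" where
  "forms n d = {p. \<exists>c :: (nat \<Rightarrow> nat) \<Rightarrow> complex.
     p = (\<lambda>x. \<Sum>a \<in> {a \<in> {..n} \<rightarrow>\<^sub>E {..d}. (\<Sum>i\<le>n. a i) = d}. c a * (\<Prod>i\<le>n. x i ^ a i))}"

text \<open>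
  A tuple \<open>F = (F\<^sub>0 : \<dots> : F\<^sub>n)\<close> of forms of one common degree, not all zero, represents a rational
  map from \<open>P\<^sup>n\<close> to itself. Values of \<open>F x\<close> at indices beyond \<open>n\<close> are irrelevant.
\<close>
type_synonym map_rep = "(nat \<Rightarrow> complex) \<Rightarrow> (nat \<Rightarrow> complex)"

definition map_reps :: "nat \<Rightarrow> map_rep set" where
  "map_reps n = {F. (\<exists>d. \<forall>i\<le>n. (\<lambda>x. F x i) \<in> forms n d) \<and> (\<exists>x. \<exists>i\<le>n. F x i \<noteq> 0)}"

text \<open>Two tuples represent the same rational map iff they are proportional.\<close>
definition same_map :: "nat \<Rightarrow> (map_rep \<times> map_rep) set" where
  "same_map n = {(F, G). F \<in> map_reps n \<and> G \<in> map_reps n \<and>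
     (\<forall>x. \<forall>i\<le>n. \<forall>j\<le>n. F x i * G x j = F x j * G x i)}"

definition birational_reps :: "nat \<Rightarrow> map_rep set" where
  "birational_reps n = {F \<in> map_reps n. \<exists>G \<in> map_reps n.
     (F \<circ> G, id) \<in> same_map n \<and> (G \<circ> F, id) \<in> same_map n}"

text \<open>The group \<open>Bir(P\<^sup>n)\<close> over the complex numbers.\<close>
definition cremona_group :: "nat \<Rightarrow> map_rep set monoid" where
  "cremona_group n =
     \<lparr>carrier = birational_reps n // same_map n,
      mult = (\<lambda>P Q. same_map n `` {F \<circ> G |F G. F \<in> P \<and> G \<in> Q}),
      one = same_map n `` {id}\<rparr>"

section \<open>Isomorphism classes of finite abelian groups\<close>

text \<open>
  Every finite group has a copy whose carrier consists of natural numbers, so the isomorphism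
  class of a finite group (with elements of any type) is represented by the set of these copies.
\<close>
type_synonym group_class = "nat monoid set"

definition iso_class :: "'a monoid \<Rightarrow> group_class" where
  "iso_class G = {N. group N \<and> N \<cong> G}"

definition class_times :: "group_class set \<Rightarrow> group_class set \<Rightarrow> group_class set"
    (infixl \<open>\<times>\<^sub>c\<close> 75) where
  "\<A> \<times>\<^sub>c \<B> = {iso_class (H \<times>\<times> K) |H K. H \<in> \<Union>\<A> \<and> K \<in> \<Union>\<B>}"

text \<open>
  The library's \<^const>\<open>short_exact_sequence\<close> lists its groups from right to left: \<open>H\<close> is the
  subgroup and \<open>K\<close> the quotient.
\<close>
definition class_ext :: "group_class set \<Rightarrow> group_class set \<Rightarrow> group_class set"
    (infixl \<open>\<bullet>\<^sub>c\<close> 75) where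
  "\<A> \<bullet>\<^sub>c \<B> = {iso_class G |G H K f g.
     comm_group G \<and> finite (carrier G) \<and> H \<in> \<Union>\<A> \<and> K \<in> \<Union>\<B> \<and> short_exact_sequence K G H f g}"

text \<open>The classes of finite abelian subgroups of the Cremona group of rank \<open>n\<close>.\<close>
definition cremona_abelian :: "nat \<Rightarrow> group_class set" where
  "cremona_abelian n = {iso_class (cremona_group n\<lparr>carrier := S\<rparr>) |S.
     subgroup S (cremona_group n) \<and> finite S \<and> comm_group (cremona_group n\<lparr>carrier := S\<rparr>)}"

section \<open>The classification in ranks one and two\<close>

abbreviation Zmod :: "nat \<Rightarrow> int monoid" where
  "Zmod k \<equiv> integer_mod_group k"

definition Zmod_power :: "nat \<Rightarrow> nat \<Rightarrow> (nat \<Rightarrow> int) monoid" where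
  "Zmod_power k r = product_group {..<r} (\<lambda>_. Zmod k)"

definition rank1_list :: "group_class set" where
  "rank1_list = {iso_class (Zmod k) |k. k \<ge> 1} \<union> {iso_class (Zmod_power 2 2)}"

text \<open>Blanc's list for the Cremona group of the plane.\<close>
definition rank2_list :: "group_class set" where
  "rank2_list =
     {iso_class (Zmod k \<times>\<times> Zmod m) |k m. k \<ge> 1 \<and> m \<ge> 1} \<union>
     {iso_class (Zmod (2 * k) \<times>\<times> Zmod_power 2 2) |k. k \<ge> 1} \<union>
     {iso_class (Zmod_power 4 2 \<times>\<times> Zmod 2), iso_class (Zmod_power 3 3), iso_class (Zmod_power 2 4)}"

end

theory Submission
  imports Defs "HOL-Algebra.Multiplicative_Group" "HOL-Combinatorics.Permutations"
    "HOL-Computational_Algebra.Primes"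
begin

text \<open>
  Write the invariant factors of a finite abelian group \<open>G\<close> as \<open>n\<^sub>0, n\<^sub>1, \<dots>\<close> with \<open>n\<^sub>i\<^sub>+\<^sub>1\<close> dividing \<open>n\<^sub>i\<close>.
  Then \<open>n\<^sub>s\<close> divides \<open>m\<close> iff \<open>mG\<close> is generated by \<open>s\<close> elements. In an extension of \<open>K\<close> by \<open>H\<close>, if \<open>dH\<close> needs
  \<open>i\<close> generators and \<open>eK\<close> needs \<open>j\<close>, then \<open>deG\<close> needs at most \<open>i + j\<close>. So \<open>n\<^sub>i\<^sub>+\<^sub>j\<close> divides \<open>de\<close>, a
  multiplicative form of the easy Horn inequalities. When the 2-ranks of \<open>H\<close> and \<open>K\<close> add up to that of
  \<open>G\<close>, moreover \<open>H \<inter> 2G = 2H\<close>, so \<open>2G\<close> is an extension of \<open>2K\<close> by \<open>2H\<close>, which sharpens the bounds.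
  Together with the order and the exponent of \<open>G\<close> these divisibilities settle all pairs \<open>H, K\<close> from
  the rank two list; only two copies of \<open>(\<int>/4)\<^sup>2 \<times> \<int>/2\<close> yield a group outside \<open>\<A>\<^sub>2 \<times> \<A>\<^sub>2\<close>, namely \<open>(\<int>/4)\<^sup>5\<close>.

  An extension of a product \<open>A \<times> B\<close> by \<open>H\<close> is an extension of \<open>B\<close> by an extension of \<open>A\<close> by \<open>H\<close>, and
  extensions of rank one groups by rank one groups lie in \<open>\<A>\<^sub>2\<close>. This reduces \<open>\<A>\<^sub>1 \<bullet> \<A>\<^sub>3'\<close> to \<open>\<A>\<^sub>2 \<bullet> \<A>\<^sub>2\<close>.
\<close>

section \<open>Torsion and generators\<close>

text \<open>The plain divisibilities alone are too weak. For two copies of Z/16 x (Z/2)^2 they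
  admit, together with order and exponent, the group Z/16 x Z/8 x Z/4 x (Z/2)^3, which is not in A_2
  x A_2. There 2G would need three generators, while an extension of one cyclic group 2K by another,
  2H, needs at most two; this is what the sharper bounds detect. Counting torsion keeps everything
  elementary. A finite abelian group with s generators has at most q^s elements killed by q, which
  turns a number of generators into a divisibility of an invariant factor. Writing X[l] for the
  elements of X killed by l, G[l] has at most |H[l]| |K[l]| elements, and equality is what makes H
  meet lG in lH. The exceptional group arises by gluing: the factors Z/2 of the two copies of
  (Z/4)^2 x Z/2 merge into one Z/4. It escapes A_2 x A_2 because a listed group with more than two
  even factors has a factor equal to 2.\<close>

lemma (in group_hom) card_eq_card_kernel_mult_card_image:
  assumes "finite (carrier G)"
  shows "card (carrier G) = card (kernel G H h) * card (h ` carrier G)"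
proof -
  have fibre: "card {x \<in> carrier G. h x = h a} = card (kernel G H h)" if a: "a \<in> carrier G" for a
  proof (rule bij_betw_same_card[symmetric])
    show "bij_betw (\<lambda>x. x \<otimes> a) (kernel G H h) {x \<in> carrier G. h x = h a}"
      by (rule bij_betw_byWitness[where f' = "\<lambda>x. x \<otimes> inv a"])
        (use a in \<open>auto simp: kernel_def G.m_assoc\<close>)
  qed
  have "card (carrier G) = (\<Sum>y \<in> h ` carrier G. card {x \<in> carrier G. h x = y})"
    using sum.group[OF assms finite_imageI[OF assms] subset_refl, where g = h and h = "\<lambda>_. 1 :: nat"]
    by simp
  also have "\<dots> = (\<Sum>y \<in> h ` carrier G. card (kernel G H h))"
    by (rule sum.cong) (use fibre in auto)
  finally show ?thesis by (simp add: mult.commute)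
qed

definition torsion :: "('a, 'b) monoid_scheme \<Rightarrow> nat \<Rightarrow> 'a set" where
  "torsion G m = {x \<in> carrier G. x [^]\<^bsub>G\<^esub> m = \<one>\<^bsub>G\<^esub>}"

text \<open>
  For \<open>l = 1\<close>: the subgroup \<open>mG\<close> lies in a subgroup generated by \<open>s\<close> elements. For \<open>l > 1\<close> the
  generators may be taken in \<open>lG\<close>, which is what lets them be lifted along a quotient map inside \<open>lG\<close>.
\<close>
definition gen_bound :: "('a, 'b) monoid_scheme \<Rightarrow> nat \<Rightarrow> nat \<Rightarrow> nat \<Rightarrow> bool" where
  "gen_bound G m l s \<longleftrightarrow> (\<exists>S. S \<subseteq> carrier G \<and> finite S \<and> card S \<le> s \<and>
     (\<forall>x \<in> carrier G. \<exists>u \<in> generate G S. x [^]\<^bsub>G\<^esub> m = u [^]\<^bsub>G\<^esub> l))"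

lemma (in comm_group) pow_group_hom: "group_hom G G (\<lambda>x. x [^] (m :: nat))"
  by (unfold_locales) (auto simp: hom_def nat_pow_distrib)

lemma (in comm_group) subgroup_torsion: "subgroup (torsion G m) G"
proof -
  interpret p: group_hom G G "\<lambda>x. x [^] m" by (rule pow_group_hom)
  show ?thesis using p.subgroup_kernel by (simp add: kernel_def torsion_def)
qed

lemma (in comm_group) comm_group_subgroup:
  "subgroup S G \<Longrightarrow> comm_group (G\<lparr>carrier := S\<rparr>)"
  by (rule group.group_comm_groupI)
    (auto simp: subgroup.subgroup_is_group subgroup.mem_carrier m_comm)

lemma (in comm_group) generate_insert:
  assumes "a \<in> carrier G" "S \<subseteq> carrier G" "x \<in> generate G (insert a S)"
  shows "\<exists>k :: int. \<exists>u \<in> generate G S. x = a [^] k \<otimes> u"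
  using assms(3)
proof (induction rule: generate.induct)
  case one
  show ?case
    by (rule exI[of _ 0], rule bexI[of _ "\<one>"]) (auto intro: generate.one)
next
  case (incl h)
  show ?case
  proof (cases "h = a")
    case True
    then show ?thesis using assms
      by (intro exI[of _ 1] bexI[of _ "\<one>"]) (auto intro: generate.one)
  next
    case False
    then show ?thesis using assms incl
      by (intro exI[of _ 0] bexI[of _ h]) (auto intro: generate.incl)
  qed
next
  case (inv h)
  show ?case
  proof (cases "h = a")
    case True
    then show ?thesis using assms
      by (intro exI[of _ "-1"] bexI[of _ "\<one>"]) (auto intro: generate.one simp: int_pow_neg)
  next
    case False
    then show ?thesis using assms inv
      by (intro exI[of _ 0] bexI[of _ "inv h"]) (auto intro: generate.inv)
  qed
next
  case (eng h1 h2)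
  then obtain k1 u1 k2 u2 where u: "u1 \<in> generate G S" "u2 \<in> generate G S"
    and h: "h1 = a [^] (k1 :: int) \<otimes> u1" "h2 = a [^] (k2 :: int) \<otimes> u2" by blast
  have "u1 \<in> carrier G" "u2 \<in> carrier G" using u generate_in_carrier[OF assms(2)] by auto
  then have "h1 \<otimes> h2 = a [^] (k1 + k2) \<otimes> (u1 \<otimes> u2)"
    using h assms(1) by (simp add: int_pow_mult m_ac)
  then show ?case using u by (blast intro: generate.eng)
qed

text \<open>Reducing the exponents of the generators modulo \<open>q\<close> leaves at most
  \<open>q ^ card S\<close> classes of the generated subgroup modulo its own \<open>q\<close>-th
  powers. \<open>R\<close> is a set of representatives of these classes.\<close>

lemma (in comm_group) generate_mod_powers:
  assumes "finite S" "S \<subseteq> carrier G" "q > 0"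
  shows "\<exists>R. finite R \<and> R \<subseteq> generate G S \<and> card R \<le> q ^ card S \<and>
    (\<forall>x \<in> generate G S. \<exists>r \<in> R. \<exists>y \<in> generate G S. x = r \<otimes> y [^] (q :: nat))"
  using assms(1,2)
proof (induction S rule: finite_induct)
  case empty
  show ?case using assms by (intro exI[of _ "{\<one>}"]) (auto simp: generate_empty)
next
  case (insert a S)
  then obtain R where R: "finite R" "R \<subseteq> generate G S" "card R \<le> q ^ card S"
    "\<And>x. x \<in> generate G S \<Longrightarrow> \<exists>r \<in> R. \<exists>y \<in> generate G S. x = r \<otimes> y [^] q" by auto
  let ?A = "generate G (insert a S)"
  have a: "a \<in> carrier G" and S: "S \<subseteq> carrier G" using insert by auto
  have sub: "subgroup ?A G" using insert by (intro generate_is_subgroup) auto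
  have mono: "generate G S \<subseteq> ?A" by (rule mono_generate) auto
  have aA: "a \<in> ?A" by (rule generate.incl) simp
  have powA: "a [^] k \<in> ?A" for k :: int by (rule subgroup_int_pow_closed[OF sub aA])
  let ?R = "(\<lambda>(i, r). a [^] int i \<otimes> r) ` ({..<q} \<times> R)"
  have "card ?R \<le> card ({..<q} \<times> R)" using R(1) by (intro card_image_le) auto
  also have "\<dots> \<le> q * q ^ card S" using R(3) by (simp add: card_cartesian_product)
  also have "\<dots> = q ^ card (insert a S)" using insert by simp
  finally have 1: "card ?R \<le> q ^ card (insert a S)" .
  have 2: "?R \<subseteq> ?A" using R(2) mono powA by (auto intro!: generate.eng)
  have "\<exists>r \<in> ?R. \<exists>y \<in> ?A. x = r \<otimes> y [^] q" if xA: "x \<in> ?A" for x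
  proof -
    obtain k :: int and u where u: "u \<in> generate G S" "x = a [^] k \<otimes> u"
      using generate_insert[OF a S xA] by blast
    obtain r y where ry: "r \<in> R" "y \<in> generate G S" "u = r \<otimes> y [^] q" using R(4)[OF u(1)] by blast
    have c: "r \<in> carrier G" "y \<in> carrier G" using ry R(2) generate_in_carrier[OF S] by auto
    define i where "i = nat (k mod int q)"
    have i: "i < q" "int i = k mod int q" using assms(3) by (auto simp: i_def nat_less_iff)
    have "k = int i + (k div int q) * int q" using i by simp
    then have "a [^] k = a [^] int i \<otimes> a [^] ((k div int q) * int q)"
      using a int_pow_mult by metis
    also have "a [^] ((k div int q) * int q) = (a [^] (k div int q)) [^] q"
      using a by (metis int_pow_pow int_pow_int)
    finally have "x = (a [^] int i \<otimes> r) \<otimes> (a [^] (k div int q) \<otimes> y) [^] q"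
      using u ry c a by (simp add: nat_pow_distrib m_ac)
    moreover have "a [^] int i \<otimes> r \<in> ?R" using i ry by (auto intro!: image_eqI[of _ _ "(i, r)"])
    moreover have "a [^] (k div int q) \<otimes> y \<in> ?A" using powA mono ry by (auto intro: generate.eng)
    ultimately show ?thesis by blast
  qed
  with 1 2 R(1) show ?case by (intro exI[of _ ?R]) auto
qed

text \<open>For a finite abelian group the kernel and the cokernel of the \<open>q\<close>-th power
  map have the same order, and the cokernel has at most \<open>q ^ card S\<close> elements by
  reduction of exponents.\<close>

lemma (in comm_group) card_torsion_generate_le:
  assumes fin: "finite (carrier G)" and S: "S \<subseteq> carrier G" and q: "q > 0"
  shows "card (generate G S \<inter> torsion G q) \<le> q ^ card S"
proof -
  let ?A = "generate G S"
  have sub: "subgroup ?A G" using S by (rule generate_is_subgroup)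
  have AG: "?A \<subseteq> carrier G" using sub by (rule subgroup.subset)
  have finA: "finite ?A" using fin AG finite_subset by blast
  interpret A: comm_group "G\<lparr>carrier := ?A\<rparr>" by (rule comm_group_subgroup[OF sub])
  have pw: "x [^]\<^bsub>G\<lparr>carrier := ?A\<rparr>\<^esub> q = x [^] q" for x by (simp add: nat_pow_def)
  interpret p: group_hom "G\<lparr>carrier := ?A\<rparr>" "G\<lparr>carrier := ?A\<rparr>" "\<lambda>x. x [^] q"
    using A.pow_group_hom[of q] by (simp add: pw)
  have ker: "kernel (G\<lparr>carrier := ?A\<rparr>) (G\<lparr>carrier := ?A\<rparr>) (\<lambda>x. x [^] q) = ?A \<inter> torsion G q"
    using AG by (auto simp: kernel_def torsion_def)
  let ?P = "(\<lambda>x. x [^] q) ` ?A"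
  have eq: "card ?A = card (?A \<inter> torsion G q) * card ?P"
    using p.card_eq_card_kernel_mult_card_image finA ker by simp
  obtain R where R: "finite R" "card R \<le> q ^ card S"
    "\<And>x. x \<in> ?A \<Longrightarrow> \<exists>r \<in> R. \<exists>y \<in> ?A. x = r \<otimes> y [^] q"
    using generate_mod_powers[OF finite_subset[OF S fin] S q] by blast
  have "?A \<subseteq> (\<lambda>(r, y). r \<otimes> y) ` (R \<times> ?P)"
    using R(3) by (fastforce simp: image_iff)
  then have "card ?A \<le> card (R \<times> ?P)"
    by (rule surj_card_le[rotated]) (use R(1) finA in simp)
  also have "\<dots> \<le> q ^ card S * card ?P" using R(2) by (simp add: card_cartesian_product)
  finally have "card (?A \<inter> torsion G q) * card ?P \<le> q ^ card S * card ?P" using eq by simp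
  moreover have "card ?P > 0" using finA generate.one by (auto simp: card_gt_0_iff)
  ultimately show ?thesis by simp
qed

text \<open>The \<open>m\<close>-th power map sends the \<open>m * q\<close>-torsion, with kernel
  the \<open>m\<close>-torsion, into the \<open>q\<close>-torsion of a subgroup with
  \<open>s\<close> generators.\<close>

lemma (in comm_group) card_torsion_le:
  assumes fin: "finite (carrier G)" and gen: "gen_bound G m 1 s" and q: "q > 0"
  shows "card (torsion G (m * q)) \<le> card (torsion G m) * q ^ s"
proof -
  obtain S where S: "S \<subseteq> carrier G" "finite S" "card S \<le> s"
    "\<And>x. x \<in> carrier G \<Longrightarrow> \<exists>u \<in> generate G S. x [^] m = u [^] (1::nat)"
    using gen unfolding gen_bound_def by blast
  let ?T = "torsion G (m * q)"
  have sub: "subgroup ?T G" by (rule subgroup_torsion)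
  interpret T: comm_group "G\<lparr>carrier := ?T\<rparr>" by (rule comm_group_subgroup[OF sub])
  interpret p: group_hom "G\<lparr>carrier := ?T\<rparr>" G "\<lambda>x. x [^] m"
    by unfold_locales (auto simp: hom_def nat_pow_distrib torsion_def)
  have "x [^] (m * q) = \<one>" if "x \<in> carrier G" "x [^] m = \<one>" for x
    using that by (metis nat_pow_one nat_pow_pow)
  then have ker: "kernel (G\<lparr>carrier := ?T\<rparr>) G (\<lambda>x. x [^] m) = torsion G m"
    by (auto simp: kernel_def torsion_def)
  have im: "(\<lambda>x. x [^] m) ` ?T \<subseteq> generate G S \<inter> torsion G q"
  proof
    fix y assume "y \<in> (\<lambda>x. x [^] m) ` ?T"
    then obtain x where x: "x \<in> carrier G" "x [^] (m * q) = \<one>" "y = x [^] m" by (auto simp: torsion_def)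
    obtain u where "u \<in> generate G S" "x [^] m = u [^] (1::nat)" using S(4) x by blast
    moreover from this have "u \<in> carrier G" using generate_in_carrier S(1) by blast
    ultimately show "y \<in> generate G S \<inter> torsion G q" using x by (auto simp: torsion_def nat_pow_pow)
  qed
  have finT: "finite ?T" using fin by (simp add: torsion_def)
  have "card ?T = card (torsion G m) * card ((\<lambda>x. x [^] m) ` ?T)"
    using p.card_eq_card_kernel_mult_card_image finT ker by simp
  also have "card ((\<lambda>x. x [^] m) ` ?T) \<le> card (generate G S \<inter> torsion G q)"
    using im fin by (intro card_mono) (auto simp: torsion_def)
  also have "\<dots> \<le> q ^ card S" by (rule card_torsion_generate_le[OF fin S(1) q])
  also have "\<dots> \<le> q ^ s" using S(3) q by (intro power_increasing) auto
  finally show ?thesis by simp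
qed

lemma (in group_hom) gen_bound_image:
  assumes "gen_bound G m l s" "h ` carrier G = carrier H"
  shows "gen_bound H m l s"
proof -
  obtain S where S: "S \<subseteq> carrier G" "finite S" "card S \<le> s"
    "\<And>x. x \<in> carrier G \<Longrightarrow> \<exists>u \<in> generate G S. x [^] m = u [^] l"
    using assms(1) unfolding gen_bound_def by blast
  have "\<exists>u \<in> generate H (h ` S). y [^]\<^bsub>H\<^esub> m = u [^]\<^bsub>H\<^esub> l" if y: "y \<in> carrier H" for y
  proof -
    obtain x where x: "x \<in> carrier G" "y = h x" using y assms(2) by blast
    obtain u where u: "u \<in> generate G S" "x [^] m = u [^] l" using S(4) x by blast
    have "u \<in> carrier G" using u G.generate_in_carrier S(1) by blast
    then have "y [^]\<^bsub>H\<^esub> m = h u [^]\<^bsub>H\<^esub> l" using x u by (metis hom_nat_pow)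
    then show ?thesis using u generate_img[OF S(1)] by blast
  qed
  moreover have "card (h ` S) \<le> s" using S card_image_le le_trans by blast
  ultimately show ?thesis unfolding gen_bound_def using S by (intro exI[of _ "h ` S"]) auto
qed

text \<open>Generators for \<open>H\<close> are pushed forward along \<open>f\<close>, those for
  \<open>K\<close> are lifted along \<open>g\<close>. The hypothesis \<open>pure\<close> says,
  additively, that H meets lG only in lH. For l = 1 it is mere exactness; for larger l it is what
  lets the bound on ldH absorb the error made by lifting.\<close>

lemma gen_bound_extension:
  assumes "comm_group G" and f: "group_hom H G f" and g: "group_hom G K g"
    and ker: "kernel G K g = f ` carrier H" and surj: "g ` carrier G = carrier K"
    and H: "gen_bound H (l * d) 1 i" and K: "gen_bound K (l * e) l j"
    and pure: "\<And>x. x \<in> carrier G \<Longrightarrow> g (x [^]\<^bsub>G\<^esub> l) = \<one>\<^bsub>K\<^esub> \<Longrightarrow>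
                 \<exists>h \<in> carrier H. x [^]\<^bsub>G\<^esub> l = f (h [^]\<^bsub>H\<^esub> l)"
  shows "gen_bound G (l * d * e) 1 (i + j)"
proof -
  interpret G: comm_group G by fact
  interpret f: group_hom H G f by fact
  interpret g: group_hom G K g by fact
  obtain S where S: "S \<subseteq> carrier H" "finite S" "card S \<le> i"
    "\<And>x. x \<in> carrier H \<Longrightarrow> \<exists>u \<in> generate H S. x [^]\<^bsub>H\<^esub> (l * d) = u [^]\<^bsub>H\<^esub> (1::nat)"
    using H unfolding gen_bound_def by blast
  obtain T where T: "T \<subseteq> carrier K" "finite T" "card T \<le> j"
    "\<And>x. x \<in> carrier K \<Longrightarrow> \<exists>u \<in> generate K T. x [^]\<^bsub>K\<^esub> (l * e) = u [^]\<^bsub>K\<^esub> l"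
    using K unfolding gen_bound_def by blast
  obtain T' where T': "T' \<subseteq> carrier G" "g ` T' = T" "finite T'" "card T' \<le> j"
  proof -
    obtain T' where "T' \<subseteq> carrier G" "inj_on g T'" "T = g ` T'"
      using T(1) unfolding surj[symmetric] subset_image_inj by blast
    then show thesis using that[of T'] T(2,3) by (simp add: finite_image_iff card_image)
  qed
  let ?U = "f ` S \<union> T'"
  have U: "?U \<subseteq> carrier G" using S(1) T'(1) by auto
  have sub: "subgroup (generate G ?U) G" using U by (rule G.generate_is_subgroup)
  have "\<exists>v \<in> generate G ?U. x [^]\<^bsub>G\<^esub> (l * d * e) = v [^]\<^bsub>G\<^esub> (1::nat)" if x: "x \<in> carrier G" for x
  proof -
    obtain w where w: "w \<in> generate K T" "g x [^]\<^bsub>K\<^esub> (l * e) = w [^]\<^bsub>K\<^esub> l" using T(4)[of "g x"] x by auto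
    obtain u where u: "u \<in> generate G T'" "w = g u" using w(1) g.generate_img[OF T'(1)] T'(2) by blast
    have uG: "u \<in> carrier G" using u(1) G.generate_in_carrier T'(1) by blast
    \<comment> \<open>The error of the lift, \<open>x [^] (l * e)\<close> divided by
      \<open>u [^] l\<close>, is itself the \<open>l\<close>-th power of \<open>?z\<close>, because
      the bound for \<open>K\<close> expresses its \<open>l * e\<close>-th powers as
      \<open>l\<close>-th powers of words in the generators. Only for such powers does
      \<open>pure\<close> apply.\<close>
    let ?z = "x [^]\<^bsub>G\<^esub> e \<otimes>\<^bsub>G\<^esub> inv\<^bsub>G\<^esub> u"
    have z: "?z \<in> carrier G" using x uG by simp
    have xz: "x [^]\<^bsub>G\<^esub> (l * e) = ?z [^]\<^bsub>G\<^esub> l \<otimes>\<^bsub>G\<^esub> u [^]\<^bsub>G\<^esub> l"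
      using x uG by (simp add: G.nat_pow_distrib[symmetric] G.m_assoc G.nat_pow_pow mult.commute)
    have "g (?z [^]\<^bsub>G\<^esub> l) \<otimes>\<^bsub>K\<^esub> g (u [^]\<^bsub>G\<^esub> l) = g (x [^]\<^bsub>G\<^esub> (l * e))"
      using xz z uG by (metis G.nat_pow_closed g.hom_mult)
    also have "\<dots> = g (u [^]\<^bsub>G\<^esub> l)" using w u x uG by (simp add: g.hom_nat_pow)
    finally have "g (?z [^]\<^bsub>G\<^esub> l) = \<one>\<^bsub>K\<^esub>"
      using z uG by (metis G.nat_pow_closed g.H.r_cancel_one g.hom_closed)
    then obtain h where h: "h \<in> carrier H" "?z [^]\<^bsub>G\<^esub> l = f (h [^]\<^bsub>H\<^esub> l)" using pure[OF z] by blast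
    obtain s where s: "s \<in> generate H S" "h [^]\<^bsub>H\<^esub> (l * d) = s [^]\<^bsub>H\<^esub> (1::nat)" using S(4)[OF h(1)] by blast
    have sH: "s \<in> carrier H" using s(1) f.G.generate_in_carrier S(1) by blast
    have "x [^]\<^bsub>G\<^esub> (l * d * e) = (x [^]\<^bsub>G\<^esub> (l * e)) [^]\<^bsub>G\<^esub> d"
      using x by (simp add: G.nat_pow_pow mult.assoc mult.commute[of d])
    also have "\<dots> = f (h [^]\<^bsub>H\<^esub> l) [^]\<^bsub>G\<^esub> d \<otimes>\<^bsub>G\<^esub> u [^]\<^bsub>G\<^esub> (l * d)"
      unfolding xz h(2) using h(1) uG by (simp add: G.nat_pow_distrib G.nat_pow_pow)
    also have "f (h [^]\<^bsub>H\<^esub> l) [^]\<^bsub>G\<^esub> d = f s"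
      using h(1) s sH by (simp add: f.hom_nat_pow[symmetric] f.G.nat_pow_pow)
    finally have "x [^]\<^bsub>G\<^esub> (l * d * e) = f s \<otimes>\<^bsub>G\<^esub> u [^]\<^bsub>G\<^esub> (l * d)" .
    moreover have "f s \<in> generate G ?U"
      using s(1) f.generate_img[OF S(1)] G.mono_generate[of "f ` S" ?U] by blast
    moreover have "u [^]\<^bsub>G\<^esub> (l * d) \<in> generate G ?U"
      using u(1) G.mono_generate[of T' ?U] G.subgroup_int_pow_closed[OF sub, of u "int (l * d)"]
      unfolding int_pow_int by blast
    ultimately have "x [^]\<^bsub>G\<^esub> (l * d * e) \<in> generate G ?U" by (simp add: generate.eng)
    moreover from this have "(x [^]\<^bsub>G\<^esub> (l * d * e)) [^]\<^bsub>G\<^esub> (1::nat) = x [^]\<^bsub>G\<^esub> (l * d * e)"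
      using x by simp
    ultimately show ?thesis by metis
  qed
  moreover have "card ?U \<le> i + j"
    using card_Un_le[of "f ` S" T'] card_image_le[OF S(2), of f] S(3) T'(4) by linarith
  ultimately show ?thesis unfolding gen_bound_def using S(2) T'(3) U by (intro exI[of _ ?U]) auto
qed

section \<open>Products of cyclic groups\<close>

definition cyclic_product :: "nat list \<Rightarrow> (nat \<Rightarrow> int) monoid" where
  "cyclic_product ns = product_group {..<length ns} (\<lambda>i. Zmod (ns ! i))"

lemma comm_group_product_group:
  assumes "\<And>i. i \<in> I \<Longrightarrow> comm_group (G i)"
  shows "comm_group (product_group I G)"
proof (rule group.group_comm_groupI)
  show "group (product_group I G)" by (rule product_group) (use assms comm_group_def in auto)
qed (use assms in \<open>auto simp: PiE_iff intro!: restrict_ext comm_groupE(4)\<close>)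

lemma comm_group_cyclic_product [simp]: "comm_group (cyclic_product ns)"
  unfolding cyclic_product_def by (rule comm_group_product_group) simp

lemma group_cyclic_product [simp]: "group (cyclic_product ns)"
  using comm_group_cyclic_product comm_group_def by blast

lemma carrier_cyclic_product:
  assumes "0 \<notin> set ns"
  shows "carrier (cyclic_product ns) = (\<Pi>\<^sub>E i \<in> {..<length ns}. {0..<int (ns ! i)})"
proof -
  have "ns ! i \<noteq> 0" if "i < length ns" for i using assms nth_mem[OF that] by metis
  then show ?thesis
    unfolding cyclic_product_def carrier_product_group by (intro PiE_cong) (simp add: carrier_integer_mod_group)
qed

lemma one_cyclic_product: "\<one>\<^bsub>cyclic_product ns\<^esub> = (\<lambda>i \<in> {..<length ns}. 0)"
  by (simp add: cyclic_product_def)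

lemma mult_cyclic_product:
  "x \<otimes>\<^bsub>cyclic_product ns\<^esub> y = (\<lambda>i \<in> {..<length ns}. (x i + y i) mod int (ns ! i))"
  by (simp add: cyclic_product_def)

lemma pow_cyclic_product:
  assumes "x \<in> carrier (cyclic_product ns)"
  shows "x [^]\<^bsub>cyclic_product ns\<^esub> (m :: nat) = (\<lambda>i \<in> {..<length ns}. (int m * x i) mod int (ns ! i))"
proof (induction m)
  case 0
  then show ?case by (simp add: one_cyclic_product)
next
  case (Suc m)
  then show ?case
    by (auto simp: mult_cyclic_product mod_add_right_eq distrib_right add.commute fun_eq_iff)
qed

lemma finite_cyclic_product: "0 \<notin> set ns \<Longrightarrow> finite (carrier (cyclic_product ns))"
  by (simp add: carrier_cyclic_product finite_PiE)

text \<open>With g = gcd m n, the condition n dvd m * a amounts to n div g dvd a, and exactly g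
  multiples of n div g lie in the range from 0 to n - 1.\<close>

lemma card_mod_torsion:
  assumes "n > 0"
  shows "card {a \<in> {0..<int n}. int n dvd int m * a} = gcd m n"
proof -
  define g where "g = gcd m n"
  have g: "g > 0" "g dvd n" using assms by (auto simp: g_def)
  have eq: "int n dvd int m * a \<longleftrightarrow> int (n div g) dvd a" for a
  proof -
    have "int n dvd int m * a \<longleftrightarrow> int (n div g) dvd int (m div g) * a"
    proof -
      have "int n = int (n div g) * int g" "int m = int (m div g) * int g"
        by (simp_all add: g_def flip: of_nat_mult)
      then have "int n dvd int m * a \<longleftrightarrow> int (n div g) * int g dvd (int (m div g) * a) * int g"
        by (simp add: mult_ac)
      then show ?thesis using g by simp
    qed
    also have "\<dots> \<longleftrightarrow> int (n div g) dvd a"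
      using div_gcd_coprime[of m n] assms
      by (simp add: g_def coprime_commute coprime_dvd_mult_right_iff)
    finally show ?thesis .
  qed
  have "{a \<in> {0..<int n}. int n dvd int m * a} = (\<lambda>k. int (n div g) * int k) ` {..<g}"
  proof (intro equalityI subsetI)
    fix a assume "a \<in> {a \<in> {0..<int n}. int n dvd int m * a}"
    then have a: "0 \<le> a" "a < int n" "int (n div g) dvd a" by (auto simp: eq)
    then obtain b where b: "a = int (n div g) * b" by auto
    have pos: "n div g > 0" using g assms by (simp add: dvd_imp_le div_greater_zero_iff)
    have "b \<ge> 0" using a b pos by (simp add: zero_le_mult_iff)
    moreover have "int n = int (n div g) * int g" using g by (simp flip: of_nat_mult)
    then have "b < int g" using a b pos by (metis mult_less_cancel_left_pos of_nat_0_less_iff)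
    ultimately show "a \<in> (\<lambda>k. int (n div g) * int k) ` {..<g}"
      using b by (intro image_eqI[of _ _ "nat b"]) auto
  next
    fix a assume "a \<in> (\<lambda>k. int (n div g) * int k) ` {..<g}"
    then obtain k where k: "a = int (n div g) * int k" "k < g" by auto
    have pos: "n div g > 0" using g assms by (simp add: dvd_imp_le div_greater_zero_iff)
    have "(n div g) * k < (n div g) * g" using k pos by simp
    then have "int ((n div g) * k) < int n" using g by (simp flip: of_nat_mult)
    then show "a \<in> {a \<in> {0..<int n}. int n dvd int m * a}" unfolding mem_Collect_eq eq using k by simp
  qed
  moreover have "inj_on (\<lambda>k. int (n div g) * int k) {..<g}"
    using g assms by (auto simp: inj_on_def dvd_div_eq_0_iff)
  ultimately show ?thesis by (simp add: card_image g_def)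
qed

lemma torsion_cyclic_product:
  assumes "0 \<notin> set ns"
  shows "torsion (cyclic_product ns) m =
    (\<Pi>\<^sub>E i \<in> {..<length ns}. {a \<in> {0..<int (ns ! i)}. int (ns ! i) dvd int m * a})"
proof -
  have "x [^]\<^bsub>cyclic_product ns\<^esub> m = \<one>\<^bsub>cyclic_product ns\<^esub> \<longleftrightarrow>
      (\<forall>i < length ns. int (ns ! i) dvd int m * x i)" if "x \<in> carrier (cyclic_product ns)" for x
    unfolding pow_cyclic_product[OF that] one_cyclic_product dvd_eq_mod_eq_0
    by (simp add: fun_eq_iff)
  then have "torsion (cyclic_product ns) m =
      {x \<in> carrier (cyclic_product ns). \<forall>i < length ns. int (ns ! i) dvd int m * x i}"
    unfolding torsion_def by blast
  then show ?thesis unfolding carrier_cyclic_product[OF assms] by (auto simp: PiE_def Pi_def)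
qed

lemma card_torsion_cyclic_product:
  assumes "0 \<notin> set ns"
  shows "card (torsion (cyclic_product ns) m) = (\<Prod>n \<leftarrow> ns. gcd m n)"
proof -
  have pos: "ns ! i > 0" if "i < length ns" for i using assms nth_mem[OF that] by (auto intro: ccontr)
  have "card (torsion (cyclic_product ns) m) = (\<Prod>i < length ns. gcd m (ns ! i))"
    unfolding torsion_cyclic_product[OF assms] by (simp add: card_PiE card_mod_torsion pos del: mem_Collect_eq atLeastLessThan_iff)
  then show ?thesis
    by (simp add: prod.list_conv_set_nth atLeast0LessThan)
qed

lemma card_cyclic_product:
  assumes "0 \<notin> set ns"
  shows "card (carrier (cyclic_product ns)) = prod_list ns"
  by (simp add: carrier_cyclic_product[OF assms] card_PiE prod.list_conv_set_nth atLeast0LessThan)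

text \<open>The residue \<open>1 mod int (ns ! i)\<close> instead of 1 keeps the vector in the
  carrier when \<open>ns ! i = 1\<close>.\<close>

definition unit_vector :: "nat list \<Rightarrow> nat \<Rightarrow> nat \<Rightarrow> int" where
  "unit_vector ns j = (\<lambda>i \<in> {..<length ns}. if i = j then 1 mod int (ns ! i) else 0)"

lemma unit_vector_closed:
  assumes "0 \<notin> set ns"
  shows "unit_vector ns j \<in> carrier (cyclic_product ns)"
proof -
  have "ns ! i > 0" if "i < length ns" for i using assms nth_mem[OF that] by (auto intro: ccontr)
  then show ?thesis unfolding carrier_cyclic_product[OF assms] unit_vector_def by auto
qed

lemma pow_eq_one_cyclic_product_iff:
  assumes "0 \<notin> set ns"
  shows "(\<forall>x \<in> carrier (cyclic_product ns). x [^]\<^bsub>cyclic_product ns\<^esub> m = \<one>\<^bsub>cyclic_product ns\<^esub>) \<longleftrightarrow>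
    (\<forall>n \<in> set ns. n dvd m)"
proof safe
  fix n assume "\<forall>x \<in> carrier (cyclic_product ns). x [^]\<^bsub>cyclic_product ns\<^esub> m = \<one>\<^bsub>cyclic_product ns\<^esub>"
    and "n \<in> set ns"
  then obtain j where j: "j < length ns" "n = ns ! j" by (auto simp: in_set_conv_nth)
  have "unit_vector ns j \<in> torsion (cyclic_product ns) m"
    using unit_vector_closed[OF assms] \<open>\<forall>x \<in> _. _\<close> by (simp add: torsion_def)
  then have "int n dvd int m * (1 mod int n)"
    using j unfolding torsion_cyclic_product[OF assms] unit_vector_def by (drule_tac PiE_mem[of _ _ _ j]) auto
  \<comment> \<open>For \<open>n = 1\<close> the entry \<open>1 mod int n\<close> is 0 and says
    nothing, but then the claim is trivial.\<close>
  then have "int n dvd int m" by (cases "n = 1") (auto simp: mod_eq_self_iff_div_eq_0 dvd_eq_mod_eq_0 mod_simps)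
  then show "n dvd m" by simp
next
  fix x assume *: "\<forall>n \<in> set ns. n dvd m" and x: "x \<in> carrier (cyclic_product ns)"
  have "x \<in> torsion (cyclic_product ns) m"
    using x unfolding torsion_cyclic_product[OF assms]
    unfolding carrier_cyclic_product[OF assms] using * by (auto simp: PiE_def Pi_def)
  then show "x [^]\<^bsub>cyclic_product ns\<^esub> m = \<one>\<^bsub>cyclic_product ns\<^esub>" by (simp add: torsion_def)
qed

lemma nth_pos: "0 \<notin> set ns \<Longrightarrow> i < length ns \<Longrightarrow> (ns ! i :: nat) > 0"
  by (metis neq0_conv nth_mem)

lemma cyclic_product_component:
  assumes "0 \<notin> set ns" "x \<in> carrier (cyclic_product ns)" "i < length ns"
  shows "x i \<in> {0..<int (ns ! i)}"
  using assms(2) unfolding carrier_cyclic_product[OF assms(1)] by (rule PiE_mem) (use assms(3) in simp)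

lemma (in group) generate_nat_pow_closed:
  "S \<subseteq> carrier G \<Longrightarrow> u \<in> generate G S \<Longrightarrow> u [^] (k :: nat) \<in> generate G S"
  using subgroup_int_pow_closed[OF generate_is_subgroup, of S u "int k"] unfolding int_pow_int .

lemma vector_in_generate_unit_vectors:
  assumes ns: "0 \<notin> set ns" and J: "finite J" "J \<subseteq> {..<length ns}"
  shows "(\<lambda>i \<in> {..<length ns}. if i \<in> J then int (c i) mod int (ns ! i) else 0)
    \<in> generate (cyclic_product ns) (unit_vector ns ` J)"
  using J
proof (induction J rule: finite_induct)
  case empty
  have "(\<lambda>i \<in> {..<length ns}. if i \<in> {} then int (c i) mod int (ns ! i) else 0) = \<one>\<^bsub>cyclic_product ns\<^esub>"
    by (simp add: one_cyclic_product)
  then show ?case by (simp only: generate.one)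
next
  case (insert j J)
  interpret G: comm_group "cyclic_product ns" by simp
  let ?v = "\<lambda>J. \<lambda>i \<in> {..<length ns}. if i \<in> J then int (c i) mod int (ns ! i) else 0"
  let ?U = "unit_vector ns ` insert j J"
  have U: "?U \<subseteq> carrier (cyclic_product ns)" using unit_vector_closed[OF ns] by blast
  have p: "unit_vector ns j [^]\<^bsub>cyclic_product ns\<^esub> c j \<in> generate (cyclic_product ns) ?U"
    by (rule G.generate_nat_pow_closed[OF U]) (auto intro: generate.incl)
  have "?v J \<in> generate (cyclic_product ns) (unit_vector ns ` J)"
    by (rule insert.IH) (use insert.prems in simp)
  then have "?v J \<in> generate (cyclic_product ns) ?U" using G.mono_generate[of "unit_vector ns ` J" ?U] by blast
  moreover have "?v (insert j J) = unit_vector ns j [^]\<^bsub>cyclic_product ns\<^esub> c j \<otimes>\<^bsub>cyclic_product ns\<^esub> ?v J"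
    using insert.hyps unfolding pow_cyclic_product[OF unit_vector_closed[OF ns]] mult_cyclic_product
    by (auto simp: fun_eq_iff unit_vector_def mod_mult_right_eq)
  ultimately show ?case using p by (simp only: generate.eng)
qed

text \<open>Coordinates whose order divides \<open>m\<close> vanish in every \<open>m\<close>-th
  power, so the unit vectors at the other positions suffice. As \<open>l\<close> divides
  \<open>m\<close>, the factor \<open>m div l\<close> can be put into the exponents of the unit
  vectors, which leaves an \<open>l\<close>-th power.\<close>

lemma gen_bound_cyclic_product:
  assumes ns: "0 \<notin> set ns" and l: "l dvd m"
  shows "gen_bound (cyclic_product ns) m l (length (filter (\<lambda>n. \<not> n dvd m) ns))"
proof -
  interpret G: comm_group "cyclic_product ns" by simp
  define J where "J = {i. i < length ns \<and> \<not> ns ! i dvd m}"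
  have J: "finite J" "J \<subseteq> {..<length ns}" by (auto simp: J_def)
  let ?U = "unit_vector ns ` J"
  have U: "?U \<subseteq> carrier (cyclic_product ns)" using unit_vector_closed[OF ns] by blast
  have "card ?U \<le> length (filter (\<lambda>n. \<not> n dvd m) ns)"
    using card_image_le[OF J(1), of "unit_vector ns"] by (simp add: length_filter_conv_card J_def)
  moreover have "\<exists>u \<in> generate (cyclic_product ns) ?U.
      x [^]\<^bsub>cyclic_product ns\<^esub> m = u [^]\<^bsub>cyclic_product ns\<^esub> l"
    if x: "x \<in> carrier (cyclic_product ns)" for x
  proof -
    define c where "c i = nat (x i) * (m div l)" for i
    define u where "u = (\<lambda>i \<in> {..<length ns}. if i \<in> J then int (c i) mod int (ns ! i) else 0)"
    have u: "u \<in> generate (cyclic_product ns) ?U"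
      unfolding u_def by (rule vector_in_generate_unit_vectors[OF ns J])
    have uG: "u \<in> carrier (cyclic_product ns)" using u U G.generate_in_carrier by blast
    have "int l * int (c i) = int m * x i" if "i < length ns" for i
    proof -
      have "x i \<ge> 0" using cyclic_product_component[OF ns x that] by simp
      then have "int l * int (c i) = int (l * (m div l)) * x i" by (simp add: c_def mult.left_commute mult.commute)
      then show ?thesis using l by simp
    qed
    then have "u [^]\<^bsub>cyclic_product ns\<^esub> l = x [^]\<^bsub>cyclic_product ns\<^esub> m"
      unfolding pow_cyclic_product[OF uG] pow_cyclic_product[OF x] unfolding u_def
      by (auto simp: fun_eq_iff J_def mod_mult_right_eq)
    then show ?thesis using u by metis
  qed
  ultimately show ?thesis unfolding gen_bound_def using J U by (intro exI[of _ ?U]) auto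
qed

abbreviation divisor_chain :: "nat list \<Rightarrow> bool" where
  "divisor_chain \<equiv> sorted_wrt (\<lambda>a b. b dvd a)"

text \<open>Let q be the part of \<open>ns ! s\<close> missing from \<open>m\<close>, namely
  \<open>ns ! s div gcd (ns ! s) m\<close>. In passing from \<open>m\<close>-torsion to
  \<open>m * q\<close>-torsion each of the s + 1 factors up to position s contributes at least a
  factor q, while the generators allow only q^s in total. Hence q = 1.\<close>

lemma nth_dvd_of_gen_bound:
  assumes ns: "0 \<notin> set ns" and chain: "divisor_chain ns"
    and gen: "gen_bound (cyclic_product ns) m 1 s" and s: "s < length ns"
  shows "ns ! s dvd m"
proof (cases "m = 0")
  case False
  interpret G: comm_group "cyclic_product ns" by simp
  have pos: "ns ! i > 0" if "i < length ns" for i using nth_pos[OF ns that] .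
  define q where "q = ns ! s div gcd (ns ! s) m"
  have qs: "q * gcd (ns ! s) m = ns ! s" by (simp add: q_def)
  have q: "q > 0" using pos[OF s] qs by (metis mult_is_0 neq0_conv)
  have *: "(\<Prod>i < length ns. gcd (m * q) (ns ! i)) \<le> (\<Prod>i < length ns. gcd m (ns ! i)) * q ^ s"
    using G.card_torsion_le[OF finite_cyclic_product[OF ns] gen q]
    by (simp add: card_torsion_cyclic_product[OF ns] prod.list_conv_set_nth atLeast0LessThan)
  have dvd: "gcd m (ns ! i) dvd gcd (m * q) (ns ! i)" for i by (simp add: gcd_dvdI1 gcd_dvdI2)
  have big: "q * gcd m (ns ! i) dvd gcd (m * q) (ns ! i)" if "i \<le> s" for i
  proof -
    have dv: "ns ! s dvd ns ! i"
      using chain s that by (cases "i = s") (auto simp: sorted_wrt_iff_nth_less)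
    \<comment> \<open>This is \<open>q * gcd m (ns ! i) dvd ns ! i\<close> multiplied by
      \<open>gcd (ns ! s) m\<close>, which clears the division in \<open>q\<close>.\<close>
    have "ns ! s * gcd m (ns ! i) dvd ns ! i * gcd (ns ! s) m"
    proof -
      have "ns ! s * gcd m (ns ! i) dvd ns ! i * ns ! s" by (simp add: mult.commute)
      moreover have "ns ! s * gcd m (ns ! i) dvd ns ! i * m" using dv by (intro mult_dvd_mono) auto
      ultimately show ?thesis by (simp add: gcd_mult_distrib_nat)
    qed
    then have "q * gcd m (ns ! i) * gcd (ns ! s) m dvd ns ! i * gcd (ns ! s) m"
      using qs by (metis mult.assoc mult.commute)
    then have "q * gcd m (ns ! i) dvd ns ! i" using False by simp
    moreover have "q * gcd m (ns ! i) dvd m * q" by (simp add: mult.commute)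
    ultimately show ?thesis by simp
  qed
  have gpos: "gcd (m * q) (ns ! i) > 0" if "i < length ns" for i using pos[OF that] by simp
  have "(\<Prod>i < length ns. gcd m (ns ! i)) * q ^ Suc s
      = (\<Prod>i < length ns. (if i \<le> s then q else 1) * gcd m (ns ! i))"
  proof -
    have "{..<length ns} \<inter> {i. i \<le> s} = {..s}" using s by auto
    then have "(\<Prod>i < length ns. (if i \<le> s then q else 1)) = q ^ Suc s"
      using prod.inter_restrict[of "{..<length ns}" "\<lambda>_. q" "{..s}"]
      by (simp add: prod.If_cases)
    then show ?thesis by (simp add: prod.distrib)
  qed
  also have "\<dots> \<le> (\<Prod>i < length ns. gcd (m * q) (ns ! i))"
    by (rule prod_mono) (use dvd big gpos dvd_imp_le in auto)
  finally have "(\<Prod>i < length ns. gcd m (ns ! i)) * q ^ Suc s \<le> (\<Prod>i < length ns. gcd m (ns ! i)) * q ^ s"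
    using * by linarith
  moreover have "(\<Prod>i < length ns. gcd m (ns ! i)) > 0" using pos by (simp add: prod_pos)
  ultimately have "q ^ Suc s \<le> q ^ s" by simp
  then have "q = 1" using q by simp
  then have "ns ! s = gcd (ns ! s) m" using qs by simp
  then show ?thesis by (metis gcd_dvd2)
qed simp

section \<open>Concatenating, permuting and padding lists of cyclic orders\<close>

lemma cyclic_product_append_iso:
  assumes ms: "0 \<notin> set ms" and ns: "0 \<notin> set ns"
  shows "cyclic_product ms \<times>\<times> cyclic_product ns \<cong> cyclic_product (ms @ ns)"
proof (rule is_isoI, rule isoI)
  let ?a = "length ms" and ?b = "length ns"
  let ?h = "\<lambda>(x, y). \<lambda>i \<in> {..<length (ms @ ns)}. if i < ?a then x i else y (i - ?a) :: int"
  let ?k = "\<lambda>z. (restrict z {..<?a}, \<lambda>i \<in> {..<?b}. z (i + ?a))"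
  have mn: "0 \<notin> set (ms @ ns)" using ms ns by simp
  show "?h \<in> hom (cyclic_product ms \<times>\<times> cyclic_product ns) (cyclic_product (ms @ ns))"
    by (rule homI)
      (auto simp: carrier_cyclic_product[OF ms] carrier_cyclic_product[OF ns] carrier_cyclic_product[OF mn]
        mult_cyclic_product nth_append fun_eq_iff PiE_def Pi_def)
  have z: "z i \<in> {0..<int ((ms @ ns) ! i)}" if "z \<in> carrier (cyclic_product (ms @ ns))" "i < ?a + ?b" for z i
    using cyclic_product_component[OF mn that(1), of i] that(2) by simp
  show "bij_betw ?h (carrier (cyclic_product ms \<times>\<times> cyclic_product ns)) (carrier (cyclic_product (ms @ ns)))"
  proof (rule bij_betw_byWitness[where f' = ?k])
    show "?k ` carrier (cyclic_product (ms @ ns)) \<subseteq> carrier (cyclic_product ms \<times>\<times> cyclic_product ns)"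
    proof
      fix w assume "w \<in> ?k ` carrier (cyclic_product (ms @ ns))"
      then obtain x where x: "x \<in> carrier (cyclic_product (ms @ ns))" "w = ?k x" by blast
      have "x i \<in> {0..<int (ms ! i)}" if "i < ?a" for i using z[OF x(1), of i] that by (simp add: nth_append)
      moreover have "x (i + ?a) \<in> {0..<int (ns ! i)}" if "i < ?b" for i
        using z[OF x(1), of "i + ?a"] that by (simp add: nth_append)
      ultimately show "w \<in> carrier (cyclic_product ms \<times>\<times> cyclic_product ns)"
        unfolding x(2) by (simp add: carrier_cyclic_product[OF ms] carrier_cyclic_product[OF ns])
    qed
  qed (auto simp: carrier_cyclic_product[OF ms] carrier_cyclic_product[OF ns] carrier_cyclic_product[OF mn]
        nth_append fun_eq_iff PiE_def Pi_def extensional_def)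
qed

lemma cyclic_product_singleton_iso:
  assumes "n > 0"
  shows "Zmod n \<cong> cyclic_product [n]"
proof (rule is_isoI, rule isoI)
  have n: "0 \<notin> set [n]" using assms by simp
  let ?h = "\<lambda>x. \<lambda>i \<in> {..<1 :: nat}. x :: int"
  show "?h \<in> hom (Zmod n) (cyclic_product [n])"
    by (rule homI) (use assms in \<open>auto simp: carrier_cyclic_product[OF n] mult_cyclic_product carrier_integer_mod_group\<close>)
  show "bij_betw ?h (carrier (Zmod n)) (carrier (cyclic_product [n]))"
    by (rule bij_betw_byWitness[where f' = "\<lambda>z. z 0"])
      (use assms in \<open>auto simp: carrier_cyclic_product[OF n] carrier_integer_mod_group fun_eq_iff PiE_def Pi_def extensional_def\<close>)
qed

lemma cyclic_product_replicate: "cyclic_product (replicate r k) = Zmod_power k r"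
  by (auto simp: cyclic_product_def Zmod_power_def product_group_def fun_eq_iff intro!: PiE_cong)

lemma cyclic_product_mset_iso:
  assumes eq: "mset ms = mset ns" and ns: "0 \<notin> set ns"
  shows "cyclic_product ns \<cong> cyclic_product ms"
proof -
  obtain p where p: "p permutes {..<length ns}" "permute_list p ns = ms"
    using mset_eq_permutation[OF eq] by blast
  have len: "length ms = length ns" using p(2) by auto
  have nth: "ms ! i = ns ! p i" if "i < length ns" for i using p that permute_list_nth by blast
  have ms: "0 \<notin> set ms" using eq ns by (metis set_mset_mset)
  have pin: "p i < length ns \<longleftrightarrow> i < length ns" for i using permutes_in_image[OF p(1), of i] by simp
  have inv_in: "Hilbert_Choice.inv p i < length ns \<longleftrightarrow> i < length ns" for i
    using permutes_in_image[OF permutes_inv[OF p(1)], of i] by simp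
  note inv = permutes_inverses[OF p(1)]
  let ?h = "\<lambda>x. \<lambda>i \<in> {..<length ns}. x (p i) :: int"
  let ?k = "\<lambda>x. \<lambda>i \<in> {..<length ns}. x (Hilbert_Choice.inv p i) :: int"
  have "?h \<in> hom (cyclic_product ns) (cyclic_product ms)"
    by (rule homI) (auto simp: carrier_cyclic_product[OF ms] carrier_cyclic_product[OF ns] len
        mult_cyclic_product nth fun_eq_iff PiE_def Pi_def pin)
  moreover have "bij_betw ?h (carrier (cyclic_product ns)) (carrier (cyclic_product ms))"
  proof (rule bij_betw_byWitness[where f' = ?k])
    show "?k ` carrier (cyclic_product ms) \<subseteq> carrier (cyclic_product ns)"
    proof -
      have "0 \<le> x (Hilbert_Choice.inv p i) \<and> x (Hilbert_Choice.inv p i) < int (ns ! i)"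
        if "x \<in> carrier (cyclic_product ms)" "i < length ns" for x i
      proof -
        have "Hilbert_Choice.inv p i < length ms" using inv_in that(2) len by simp
        then have "x (Hilbert_Choice.inv p i) \<in> {0..<int (ms ! Hilbert_Choice.inv p i)}"
          using cyclic_product_component[OF ms that(1)] by blast
        then show ?thesis using nth[of "Hilbert_Choice.inv p i"] inv_in that(2) inv by simp
      qed
      then show ?thesis by (auto simp: carrier_cyclic_product[OF ns] split: if_splits)
    qed
  qed (auto simp: carrier_cyclic_product[OF ms] carrier_cyclic_product[OF ns] len nth fun_eq_iff
      PiE_def Pi_def extensional_def pin inv_in inv)
  ultimately show ?thesis by (intro is_isoI isoI)
qed

lemma is_iso_trans: "G \<cong> H \<Longrightarrow> H \<cong> K \<Longrightarrow> G \<cong> K"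
  unfolding is_iso_def using iso_set_trans by blast

lemma cyclic_product_append_ones_iso:
  assumes ns: "0 \<notin> set ns"
  shows "cyclic_product (ns @ replicate k 1) \<cong> cyclic_product ns"
proof (rule is_isoI, rule isoI)
  have n1: "0 \<notin> set (ns @ replicate k 1)" using ns by auto
  let ?h = "\<lambda>x. restrict x {..<length ns} :: nat \<Rightarrow> int"
  let ?k = "\<lambda>x. \<lambda>i \<in> {..<length ns + k}. if i < length ns then x i else (0 :: int)"
  have z: "x i = 0" if "x \<in> carrier (cyclic_product (ns @ replicate k 1))"
    "i < length ns + k" "\<not> i < length ns" for x i
  proof -
    have "x i \<in> {0..<int ((ns @ replicate k 1) ! i)}"
      using cyclic_product_component[OF n1 that(1), of i] that(2) by simp
    then show ?thesis using that by (simp add: nth_append)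
  qed
  have z': "x i \<in> {0..<int (ns ! i)}" if "x \<in> carrier (cyclic_product (ns @ replicate k 1))"
    "i < length ns" for x i
  proof -
    have "x i \<in> {0..<int ((ns @ replicate k 1) ! i)}"
      using cyclic_product_component[OF n1 that(1), of i] that(2) by simp
    then show ?thesis using that by (simp add: nth_append)
  qed
  have im: "?h x \<in> carrier (cyclic_product ns)" if "x \<in> carrier (cyclic_product (ns @ replicate k 1))" for x
    using z'[OF that] unfolding carrier_cyclic_product[OF ns] by simp
  show "?h \<in> hom (cyclic_product (ns @ replicate k 1)) (cyclic_product ns)"
    by (rule homI) (use im in \<open>auto simp: mult_cyclic_product nth_append fun_eq_iff\<close>)
  show "bij_betw ?h (carrier (cyclic_product (ns @ replicate k 1))) (carrier (cyclic_product ns))"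
  proof (rule bij_betw_byWitness[where f' = ?k])
    show "\<forall>x \<in> carrier (cyclic_product (ns @ replicate k 1)). ?k (?h x) = x"
      using z by (auto simp: carrier_cyclic_product[OF n1] fun_eq_iff PiE_def extensional_def
          simp del: One_nat_def)
    show "?h ` carrier (cyclic_product (ns @ replicate k 1)) \<subseteq> carrier (cyclic_product ns)"
      using im by blast
  qed (auto simp: carrier_cyclic_product[OF ns] carrier_cyclic_product[OF n1] nth_append fun_eq_iff
      PiE_def Pi_def extensional_def simp del: One_nat_def)
qed

lemma cyclic_product_filter_iso:
  assumes ns: "0 \<notin> set ns"
  shows "cyclic_product ns \<cong> cyclic_product (filter (\<lambda>n. n \<noteq> 1) ns)"
proof -
  let ?f = "filter (\<lambda>n. n \<noteq> 1) ns"
  have "filter (\<lambda>n. \<not> n \<noteq> 1) ns = replicate (length (filter (\<lambda>n. \<not> n \<noteq> 1) ns)) 1"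
    by (rule replicate_length_same[symmetric]) auto
  moreover have "mset ns = mset (?f @ filter (\<lambda>n. \<not> n \<noteq> 1) ns)"
    unfolding mset_append mset_filter by (rule multiset_partition)
  ultimately have eq: "mset (?f @ replicate (length (filter (\<lambda>n. \<not> n \<noteq> 1) ns)) 1) = mset ns" by simp
  have f: "0 \<notin> set ?f" using ns by simp
  show ?thesis
    using is_iso_trans[OF cyclic_product_mset_iso[OF eq ns] cyclic_product_append_ones_iso[OF f]] .
qed

section \<open>Invariant factors\<close>

lemma (in comm_group) ord_mult_coprime:
  assumes "x \<in> carrier G" "y \<in> carrier G" "coprime (ord x) (ord y)"
  shows "ord (x \<otimes> y) = ord x * ord y"
proof (rule dvd_antisym)
  show "ord (x \<otimes> y) dvd ord x * ord y" using assms by (simp add: abelian_ord_mul_divides)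
next
  let ?t = "ord (x \<otimes> y)"
  have eq: "x [^] ?t \<otimes> y [^] ?t = \<one>"
    unfolding nat_pow_distrib[OF assms(1,2), symmetric] using assms by (intro pow_ord_eq_1) simp
  have "(x [^] ?t \<otimes> y [^] ?t) [^] ord x = (x [^] ord x) [^] ?t \<otimes> y [^] (?t * ord x)"
    using assms by (simp only: nat_pow_distrib nat_pow_closed nat_pow_pow mult.commute)
  then have "y [^] (?t * ord x) = \<one>" using eq assms by simp
  then have "ord y dvd ?t" using assms
    by (metis pow_eq_id coprime_commute coprime_dvd_mult_left_iff)
  moreover
  have "(x [^] ?t \<otimes> y [^] ?t) [^] ord y = x [^] (?t * ord y) \<otimes> (y [^] ord y) [^] ?t"
    using assms by (simp only: nat_pow_distrib nat_pow_closed nat_pow_pow mult.commute)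
  then have "x [^] (?t * ord y) = \<one>" using eq assms by simp
  then have "ord x dvd ?t" using assms
    by (metis pow_eq_id coprime_dvd_mult_left_iff)
  ultimately show "ord x * ord y dvd ?t" using assms(3) by (simp add: divides_mult)
qed

text \<open>An element \<open>x\<close> of maximal order does it. If some prime p occurred in
  \<open>ord y\<close> to a higher power than in \<open>ord x\<close>, then \<open>x'\<close>, which
  is x without its p-part, times \<open>y'\<close>, the p-part of y, would have larger order, since
  the orders of \<open>x'\<close> and \<open>y'\<close> are coprime.\<close>

lemma (in comm_group) exists_ord_eq_exponent:
  assumes fin: "finite (carrier G)"
  shows "\<exists>x \<in> carrier G. \<forall>y \<in> carrier G. ord y dvd ord x"
proof -
  have "Max (ord ` carrier G) \<in> ord ` carrier G" using fin by (intro Max_in) auto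
  then obtain x where x: "x \<in> carrier G" "ord x = Max (ord ` carrier G)" by auto
  have max: "ord y \<le> ord x" if "y \<in> carrier G" for y using x fin that by simp
  have "ord y dvd ord x" if y: "y \<in> carrier G" for y
  proof (rule ccontr)
    assume "\<not> ord y dvd ord x"
    have pos: "ord z > 0" if "z \<in> carrier G" for z using ord_ge_1[OF fin that] by simp
    obtain p where p: "prime p" "\<not> multiplicity p (ord y) \<le> multiplicity p (ord x)"
      using \<open>\<not> ord y dvd ord x\<close> pos[OF y] multiplicity_le_imp_dvd[of "ord y" "ord x"] by blast
    define i k where "i = multiplicity p (ord x)" and "k = multiplicity p (ord y)"
    define x' y' where "x' = x [^] (p ^ i)" and "y' = y [^] (ord y div p ^ k)"
    have px: "p ^ i dvd ord x" and py: "p ^ k dvd ord y" by (simp_all add: i_def k_def multiplicity_dvd)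
    have p0: "p > 0" using p prime_gt_0_nat by blast
    have x'o: "ord x' = ord x div p ^ i" unfolding x'_def using x px p0 by (simp add: ord_pow)
    have "ord y div p ^ k dvd ord y" using py by (metis dvd_mult_div_cancel dvd_triv_right)
    moreover have "ord y div p ^ k \<noteq> 0" using py pos[OF y] by (metis dvd_mult_div_cancel mult_0_right neq0_conv)
    ultimately have y'o: "ord y' = p ^ k" unfolding y'_def using y py pos[OF y]
      by (simp add: ord_pow div_div_eq_right)
    have "\<not> p dvd ord x div p ^ i"
      unfolding i_def using pos[OF x(1)] p(1) by (intro multiplicity_decompose) auto
    then have "coprime (ord x') (ord y')"
      unfolding x'o y'o using p(1) by (metis coprime_commute coprime_power_left_iff prime_imp_coprime)
    then have "ord (x' \<otimes> y') = ord x div p ^ i * p ^ k"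
      using x(1) y x'o y'o by (simp add: ord_mult_coprime x'_def y'_def)
    moreover have "ord x div p ^ i * p ^ i < ord x div p ^ i * p ^ k"
    proof -
      have "i < k" using p(2) by (simp add: i_def k_def)
      then have "p ^ i < p ^ k" using prime_gt_1_nat[OF p(1)] by (rule power_strict_increasing)
      moreover have "ord x div p ^ i > 0"
        using px pos[OF x(1)] by (metis dvd_mult_div_cancel mult_0_right neq0_conv)
      ultimately show ?thesis by simp
    qed
    ultimately have "ord x < ord (x' \<otimes> y')" using px by simp
    moreover have "x' \<otimes> y' \<in> carrier G" using x y by (simp add: x'_def y'_def)
    ultimately show False using max by fastforce
  qed
  then show ?thesis using x(1) by blast
qed

lemma (in comm_group) subgroup_powers_mult:
  assumes M: "subgroup M G" and a: "a \<in> carrier G"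
  shows "subgroup {a [^] k \<otimes> m |(k :: int) m. m \<in> M} G"
proof (rule subgroupI)
  have c: "m \<in> carrier G" if "m \<in> M" for m using subgroup.mem_carrier[OF M that] .
  show "{a [^] k \<otimes> m |(k :: int) m. m \<in> M} \<subseteq> carrier G" using a c by auto
  show "{a [^] k \<otimes> m |(k :: int) m. m \<in> M} \<noteq> {}" using subgroup.one_closed[OF M] by auto
next
  have c: "m \<in> carrier G" if "m \<in> M" for m using subgroup.mem_carrier[OF M that] .
  fix y assume "y \<in> {a [^] k \<otimes> m |(k :: int) m. m \<in> M}"
  then obtain k :: int and m where y: "y = a [^] k \<otimes> m" "m \<in> M" by blast
  then have "inv y = a [^] (- k) \<otimes> inv m" using a c by (simp add: inv_mult int_pow_neg)
  then show "inv y \<in> {a [^] k \<otimes> m |(k :: int) m. m \<in> M}" using subgroup.m_inv_closed[OF M y(2)] by blast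
  fix z assume "z \<in> {a [^] k \<otimes> m |(k :: int) m. m \<in> M}"
  then obtain l :: int and n where z: "z = a [^] l \<otimes> n" "n \<in> M" by blast
  have "y \<otimes> z = a [^] (k + l) \<otimes> (m \<otimes> n)" using y z a c by (simp add: int_pow_mult m_ac)
  then show "y \<otimes> z \<in> {a [^] k \<otimes> m |(k :: int) m. m \<in> M}" using subgroup.m_closed[OF M y(2) z(2)] by blast
qed

text \<open>The exponents \<open>j\<close> with \<open>y [^] j\<close> in \<open>Q\<close> form an
  ideal of the integers, nonzero because of \<open>n\<close>; \<open>d\<close> is its positive
  generator.\<close>

lemma (in group) subgroup_pow_exponents:
  assumes Q: "subgroup Q G" and y: "y \<in> carrier G" and n: "y [^] n \<in> Q" "n > (0 :: nat)"
  shows "\<exists>d :: nat. d > 0 \<and> y [^] d \<in> Q \<and> (\<forall>j :: int. y [^] j \<in> Q \<longrightarrow> int d dvd j)"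
proof -
  define d :: nat where "d = (LEAST d. d > 0 \<and> y [^] d \<in> Q)"
  have d: "d > 0" "y [^] d \<in> Q" using LeastI[of "\<lambda>d. d > 0 \<and> y [^] d \<in> Q" n] n by (auto simp: d_def)
  have least: "d \<le> e" if "e > 0" "y [^] e \<in> Q" for e :: nat
    unfolding d_def using that by (intro Least_le) simp
  have "int d dvd j" if j: "y [^] j \<in> Q" for j :: int
  proof -
    have "y [^] (int d * (j div int d)) = (y [^] d) [^] (j div int d)"
      using y by (metis int_pow_pow int_pow_int)
    then have "y [^] (int d * (j div int d)) \<in> Q" using subgroup_int_pow_closed[OF Q d(2)] by simp
    then have "y [^] j \<otimes> inv (y [^] (int d * (j div int d))) \<in> Q"
      using j Q by (simp add: subgroup.m_closed subgroup.m_inv_closed)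
    moreover have "j - int d * (j div int d) = int (nat (j mod int d))" using d(1) by (simp add: minus_mult_div_eq_mod)
    ultimately have "y [^] nat (j mod int d) \<in> Q"
      using y by (metis int_pow_diff int_pow_int)
    moreover have "nat (j mod int d) < d" using d(1) by (simp add: nat_less_iff)
    ultimately have "nat (j mod int d) = 0" using least[of "nat (j mod int d)"] by linarith
    moreover have "j mod int d \<ge> 0" using d(1) by simp
    ultimately show ?thesis by (simp add: dvd_eq_mod_eq_0)
  qed
  then show ?thesis using d by blast
qed

text \<open>A subgroup \<open>M\<close> of largest order among those meeting the powers of
  \<open>x\<close> trivially is a complement. Otherwise some \<open>y\<close> lies outside the
  product \<open>?Q\<close> of \<open>M\<close> with the powers of \<open>x\<close>. Since
  \<open>ord x\<close> is the exponent, \<open>y\<close> can be corrected by a power of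
  \<open>x\<close> to an element \<open>y'\<close> whose \<open>d\<close>-th power lies in
  \<open>M\<close>, and adjoining \<open>y'\<close> to \<open>M\<close> contradicts
  maximality.\<close>

lemma (in comm_group) exists_cyclic_complement:
  assumes fin: "finite (carrier G)" and x: "x \<in> carrier G" and exp: "\<And>y. y \<in> carrier G \<Longrightarrow> ord y dvd ord x"
  shows "\<exists>M. subgroup M G \<and> (\<forall>k :: int. x [^] k \<in> M \<longrightarrow> x [^] k = \<one>) \<and>
    (\<forall>y \<in> carrier G. \<exists>k :: int. \<exists>m \<in> M. y = x [^] k \<otimes> m)"
proof -
  let ?P = "\<lambda>M. subgroup M G \<and> (\<forall>k :: int. x [^] k \<in> M \<longrightarrow> x [^] k = \<one>)"
  have "?P {\<one>}" using triv_subgroup by auto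
  moreover have "card M < Suc (card (carrier G))" if "?P M" for M
    using card_mono[OF fin subgroup.subset] that by (simp add: less_Suc_eq_le)
  ultimately obtain M where M: "subgroup M G" "\<And>k :: int. x [^] k \<in> M \<Longrightarrow> x [^] k = \<one>"
    and max: "\<And>M'. ?P M' \<Longrightarrow> card M' \<le> card M"
    using ex_has_greatest_nat[of ?P "{\<one>}" card "Suc (card (carrier G))"] by auto
  let ?Q = "{x [^] k \<otimes> m |(k :: int) m. m \<in> M}"
  have Q: "subgroup ?Q G" by (rule subgroup_powers_mult[OF M(1) x])
  note Mc = subgroup.mem_carrier[OF M(1)]
  have one: "\<one> \<in> M" by (rule subgroup.one_closed[OF M(1)])
  have xQ: "x [^] k \<in> ?Q" for k :: int using one x by force
  have MQ: "m \<in> ?Q" if "m \<in> M" for m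
    using that Mc by (intro CollectI exI[of _ "0 :: int"] exI[of _ m]) simp
  have "y \<in> ?Q" if y: "y \<in> carrier G" for y
  proof (rule ccontr)
    assume nQ: "y \<notin> ?Q"
    define n where "n = ord x"
    have n0: "n > 0" using ord_ge_1[OF fin x] by (simp add: n_def)
    have yn: "y [^] n = \<one>" using exp[OF y] y by (simp add: pow_eq_id n_def)
    obtain d :: nat where d: "d > 0" "y [^] d \<in> ?Q" "\<And>j :: int. y [^] j \<in> ?Q \<Longrightarrow> int d dvd j"
      using subgroup_pow_exponents[OF Q y _ n0] subgroup.one_closed[OF Q] yn by auto
    have "int d dvd int n" using d(3)[of "int n"] yn subgroup.one_closed[OF Q] by (simp add: int_pow_int)
    then obtain e where e: "n = d * e" by auto
    obtain k :: int and m where km: "y [^] d = x [^] k \<otimes> m" "m \<in> M" using d(2) by blast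
    \<comment> \<open>The \<open>e\<close>-th power of \<open>y [^] d\<close> is trivial, so
      \<open>x [^] (k * int e)\<close> lies in \<open>M\<close> and must be trivial too. As
      \<open>ord x = d * e\<close>, this forces \<open>d\<close> to divide \<open>k\<close>, which
      is what makes the correction of \<open>y\<close> possible.\<close>
    have "\<one> = (x [^] k \<otimes> m) [^] e" using yn km y e by (metis nat_pow_pow)
    also have "\<dots> = x [^] (k * int e) \<otimes> m [^] e"
      using x Mc[OF km(2)] by (metis int_pow_closed int_pow_int int_pow_pow nat_pow_distrib)
    finally have "x [^] (k * int e) = inv (m [^] e)" using x Mc[OF km(2)]
      by (metis inv_equality int_pow_closed nat_pow_closed)
    moreover have "inv (m [^] e) \<in> M"
      using subgroup_int_pow_closed[OF M(1) km(2), of "int e"] M(1) by (simp add: int_pow_int subgroup.m_inv_closed)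
    ultimately have "x [^] (k * int e) = \<one>" using M(2) by metis
    then have "int d * int e dvd k * int e" using x e by (simp add: int_pow_eq_id n_def)
    then obtain k' where k': "k = int d * k'" using n0 e by auto
    define y' where "y' = y \<otimes> x [^] (- k')"
    have y': "y' \<in> carrier G" using x y by (simp add: y'_def)
    have yy': "y = y' \<otimes> x [^] k'" using x y by (simp add: y'_def m_assoc flip: int_pow_mult)
    have "y' [^] d = y [^] d \<otimes> x [^] (- k)"
    proof -
      have "(x [^] (- k')) [^] d = x [^] (- k' * int d)" using x by (metis int_pow_int int_pow_pow)
      then show ?thesis using x y by (simp add: y'_def nat_pow_distrib k' mult.commute)
    qed
    also have "\<dots> = m" using x Mc[OF km(2)] km(1) by (simp add: m_ac flip: int_pow_mult)
    finally have y'd: "y' [^] d = m" .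
    let ?M = "{y' [^] k \<otimes> m |(k :: int) m. m \<in> M}"
    have sM: "subgroup ?M G" by (rule subgroup_powers_mult[OF M(1) y'])
    have MM: "m \<in> ?M" if "m \<in> M" for m
      using that Mc by (intro CollectI exI[of _ "0 :: int"] exI[of _ m]) simp
    have y'M: "y' \<in> ?M" using one y' by (intro CollectI exI[of _ "1 :: int"] exI[of _ \<one>]) simp
    have "y' \<notin> M"
    proof
      assume "y' \<in> M"
      then have "y \<in> ?Q" using yy' x y' by (intro CollectI exI[of _ k'] exI[of _ y']) (simp add: m_comm)
      then show False using nQ by contradiction
    qed
    then have "M \<subset> ?M" using MM y'M by blast
    then have "card M < card ?M" using fin subgroup.subset[OF sM] by (meson psubset_card_mono finite_subset)
    \<comment> \<open>If \<open>x [^] l\<close> involves \<open>y' [^] j\<close>, then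
      \<open>y [^] j\<close> lies in \<open>?Q\<close>, so \<open>d\<close> divides
      \<open>j\<close>. Hence \<open>y' [^] j\<close> is a power of \<open>m\<close> and the whole
      element already lies in \<open>M\<close>.\<close>
    moreover have "x [^] l = \<one>" if l: "x [^] l \<in> ?M" for l :: int
    proof -
      obtain j :: int and m' where j: "x [^] l = y' [^] j \<otimes> m'" "m' \<in> M" using l by blast
      have "y' [^] j = x [^] l \<otimes> inv m'" using j y' Mc[OF j(2)] x by (simp add: m_assoc)
      moreover have "inv m' \<in> M" using M(1) j(2) by (simp add: subgroup.m_inv_closed)
      moreover have "y [^] j = y' [^] j \<otimes> x [^] (k' * j)"
        using yy' x y' by (simp add: int_pow_distrib int_pow_pow)
      ultimately have "y [^] j \<in> ?Q"
        using xQ MQ Q by (metis (no_types, lifting) subgroup.m_closed)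
      then obtain j' where "j = int d * j'" using d(3) by (meson dvdE)
      then have "y' [^] j = m [^] j'" using y'd y' by (metis int_pow_int int_pow_pow)
      then have "y' [^] j \<in> M" using subgroup_int_pow_closed[OF M(1) km(2)] by simp
      then have "x [^] l \<in> M" unfolding j(1) using subgroup.m_closed[OF M(1)] j(2) by blast
      then show ?thesis by (rule M(2))
    qed
    ultimately show False using max[of ?M] sM by force
  qed
  then show ?thesis using M by (intro exI[of _ M]) blast
qed

lemma (in comm_group) cyclic_complement_iso:
  assumes x: "x \<in> carrier G" "ord x > 0" and M: "subgroup M G"
    and int: "\<And>k :: int. x [^] k \<in> M \<Longrightarrow> x [^] k = \<one>"
    and gen: "\<And>y. y \<in> carrier G \<Longrightarrow> \<exists>k :: int. \<exists>m \<in> M. y = x [^] k \<otimes> m"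
  shows "Zmod (ord x) \<times>\<times> G\<lparr>carrier := M\<rparr> \<cong> G"
proof (rule is_isoI, rule isoI)
  let ?n = "ord x" and ?h = "\<lambda>(k :: int, m). x [^] k \<otimes> m"
  note Mc = subgroup.mem_carrier[OF M]
  have md: "x [^] (k mod int ?n) = x [^] k" for k using x(1) by (simp add: int_pow_eq mod_eq_dvd_iff[symmetric])
  have C: "carrier (Zmod ?n \<times>\<times> G\<lparr>carrier := M\<rparr>) = {0..<int ?n} \<times> M"
    using x(2) by (simp add: carrier_integer_mod_group)
  show "?h \<in> hom (Zmod ?n \<times>\<times> G\<lparr>carrier := M\<rparr>) G"
    by (rule homI) (use x Mc in \<open>auto simp: C md int_pow_mult m_ac\<close>)
  show "bij_betw ?h (carrier (Zmod ?n \<times>\<times> G\<lparr>carrier := M\<rparr>)) (carrier G)"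
  proof (rule bij_betw_imageI)
    show "inj_on ?h (carrier (Zmod ?n \<times>\<times> G\<lparr>carrier := M\<rparr>))"
      unfolding C
    proof (rule inj_onI, clarify)
      fix a b m m' assume ab: "a \<in> {0..<int ?n}" "b \<in> {0..<int ?n}" and m: "m \<in> M" "m' \<in> M"
        and eq: "x [^] a \<otimes> m = x [^] b \<otimes> m'"
      have "x [^] (a - b) = x [^] a \<otimes> m \<otimes> inv m \<otimes> inv (x [^] b)"
        using x Mc[OF m(1)] by (simp add: int_pow_diff m_assoc)
      also have "\<dots> = m' \<otimes> inv m" unfolding eq using x Mc[OF m(1)] Mc[OF m(2)] by (simp add: m_ac)
      finally have "x [^] (a - b) = m' \<otimes> inv m" .
      moreover have "m' \<otimes> inv m \<in> M" using M m by (simp add: subgroup.m_closed subgroup.m_inv_closed)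
      ultimately have "x [^] (a - b) = \<one>" using int by metis
      then have "int ?n dvd a - b" using x(1) by (simp add: int_pow_eq_id)
      then have "a = b" using ab by (metis atLeastLessThan_iff mod_eq_dvd_iff mod_pos_pos_trivial)
      then show "a = b \<and> m = m'" using eq x Mc[OF m(1)] Mc[OF m(2)] by simp
    qed
    show "?h ` carrier (Zmod ?n \<times>\<times> G\<lparr>carrier := M\<rparr>) = carrier G"
      unfolding C
    proof (intro equalityI subsetI)
      fix y assume "y \<in> carrier G"
      then obtain k :: int and m where "m \<in> M" "y = x [^] k \<otimes> m" using gen by blast
      then show "y \<in> ?h ` ({0..<int ?n} \<times> M)"
        using x(2) md[of k] by (intro image_eqI[of _ _ "(k mod int ?n, m)"]) auto
    qed (use x Mc in auto)
  qed
qed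

text \<open>The order of the cyclic factor is the exponent of the group. The last clause records
  this, since it is the source of the divisor chain: the orders of all cyclic factors of
  \<open>M\<close> divide \<open>n\<close>. That \<open>M\<close> is proper feeds the induction on
  the order.\<close>

lemma (in comm_group) exists_cyclic_factor:
  assumes fin: "finite (carrier G)" and nontriv: "carrier G \<noteq> {\<one>}"
  shows "\<exists>n M. n > 1 \<and> subgroup M G \<and> M \<subset> carrier G \<and> Zmod n \<times>\<times> G\<lparr>carrier := M\<rparr> \<cong> G \<and>
    (\<forall>y \<in> carrier G. y [^] n = \<one>)"
proof -
  obtain x where x: "x \<in> carrier G" "\<And>y. y \<in> carrier G \<Longrightarrow> ord y dvd ord x"
    using exists_ord_eq_exponent[OF fin] by blast
  have n0: "ord x > 0" using ord_ge_1[OF fin x(1)] by simp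
  have n1: "ord x \<noteq> 1"
  proof
    assume "ord x = 1"
    then have "y = \<one>" if "y \<in> carrier G" for y using x(2)[OF that] ord_eq_1[OF that] by simp
    then show False using nontriv by blast
  qed
  obtain M where M: "subgroup M G" "\<And>k :: int. x [^] k \<in> M \<Longrightarrow> x [^] k = \<one>"
    "\<And>y. y \<in> carrier G \<Longrightarrow> \<exists>k :: int. \<exists>m \<in> M. y = x [^] k \<otimes> m"
    using exists_cyclic_complement[OF fin x] by blast
  have "Zmod (ord x) \<times>\<times> G\<lparr>carrier := M\<rparr> \<cong> G" by (rule cyclic_complement_iso[OF x(1) n0 M])
  moreover have "x \<notin> M" using M(2)[of 1] x(1) n1 by (metis int_pow_1 ord_eq_1)
  then have "M \<subset> carrier G" using subgroup.subset[OF M(1)] x(1) by blast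
  moreover have "y [^] ord x = \<one>" if "y \<in> carrier G" for y using x(2)[OF that] that by (simp add: pow_eq_id)
  moreover have "ord x > 1" using n0 n1 by simp
  ultimately show ?thesis using M(1) by blast
qed

lemma iso_imp_group_hom: "h \<in> iso G H \<Longrightarrow> group G \<Longrightarrow> group H \<Longrightarrow> group_hom G H h"
  by (intro group_hom.intro group_hom_axioms.intro) (auto simp: iso_def)

lemma pow_eq_one_iso:
  assumes iso: "G \<cong> H" and "group G" "group H"
    and pow: "\<And>y. y \<in> carrier H \<Longrightarrow> y [^]\<^bsub>H\<^esub> (n :: nat) = \<one>\<^bsub>H\<^esub>" and x: "x \<in> carrier G"
  shows "x [^]\<^bsub>G\<^esub> n = \<one>\<^bsub>G\<^esub>"
proof -
  obtain h where h: "h \<in> iso G H" using iso unfolding is_iso_def by blast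
  interpret h: group_hom G H h using iso_imp_group_hom[OF h] assms by blast
  have "h (x [^]\<^bsub>G\<^esub> n) = h \<one>\<^bsub>G\<^esub>" using x pow by (simp add: h.hom_nat_pow)
  moreover have "inj_on h (carrier G)" using h by (simp add: iso_def bij_betw_def)
  ultimately show ?thesis using x by (metis h.G.nat_pow_closed h.G.one_closed inj_onD)
qed

theorem finite_comm_group_iso_cyclic_product:
  assumes "comm_group G" "finite (carrier G)"
  shows "\<exists>ns. (\<forall>n \<in> set ns. n > 1) \<and> divisor_chain ns \<and> cyclic_product ns \<cong> G"
  using assms
proof (induction "card (carrier G)" arbitrary: G rule: less_induct)
  case less
  interpret G: comm_group G by fact
  show ?case
  proof (cases "carrier G = {\<one>\<^bsub>G\<^esub>}")
    case True
    have "cyclic_product [] \<cong> G"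
      by (rule is_isoI[of "\<lambda>_. \<one>\<^bsub>G\<^esub>"], rule isoI)
        (auto simp: True hom_def carrier_cyclic_product bij_betw_def)
    then show ?thesis by (intro exI[of _ "[]"]) simp
  next
    case False
    obtain n M where n1: "n > 1" and M: "subgroup M G" "M \<subset> carrier G"
      and iso: "Zmod n \<times>\<times> G\<lparr>carrier := M\<rparr> \<cong> G"
      and pow: "\<And>y. y \<in> carrier G \<Longrightarrow> y [^]\<^bsub>G\<^esub> n = \<one>\<^bsub>G\<^esub>"
      using G.exists_cyclic_factor[OF less.prems(2) False] by blast
    let ?M = "G\<lparr>carrier := M\<rparr>"
    have n: "n > 0" using n1 by simp
    have cM: "comm_group ?M" by (rule G.comm_group_subgroup[OF M(1)])
    then have gM: "group ?M" by (rule comm_group.axioms)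
    have "card (carrier ?M) < card (carrier G)" and finM: "finite (carrier ?M)"
      using less.prems(2) M(2) by (auto intro: psubset_card_mono finite_subset)
    then obtain ms where ms1: "\<forall>n \<in> set ms. n > 1" and ms: "divisor_chain ms" "cyclic_product ms \<cong> ?M"
      using less.hyps[OF _ cM finM] by auto
    have ms0: "0 \<notin> set ms" using ms1 by auto
    have powM: "y [^]\<^bsub>?M\<^esub> n = \<one>\<^bsub>?M\<^esub>" if "y \<in> carrier ?M" for y
      using pow[of y] that M(2) by (auto simp: nat_pow_def)
    have dvd: "\<forall>m \<in> set ms. m dvd n"
      using pow_eq_one_iso[OF ms(2) group_cyclic_product gM powM] pow_eq_one_cyclic_product_iff[OF ms0]
      by blast
    have "cyclic_product [n] \<times>\<times> cyclic_product ms \<cong> Zmod n \<times>\<times> ?M"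
      by (rule group.DirProd_iso_trans[OF group_cyclic_product])
        (use ms(2) group.iso_sym[OF _ cyclic_product_singleton_iso[OF n]] in auto)
    then have "cyclic_product [n] \<times>\<times> cyclic_product ms \<cong> G" using iso by (rule is_iso_trans)
    moreover have "cyclic_product [n] \<times>\<times> cyclic_product ms \<cong> cyclic_product (n # ms)"
      using cyclic_product_append_iso[of "[n]" ms] n ms0 by simp
    then have "cyclic_product (n # ms) \<cong> cyclic_product [n] \<times>\<times> cyclic_product ms"
      by (rule group.iso_sym[OF DirProd_group, rotated 2]) simp_all
    ultimately have "cyclic_product (n # ms) \<cong> G" using is_iso_trans by blast
    then show ?thesis using ms ms1 n1 dvd by (intro exI[of _ "n # ms"]) auto
  qed
qed

section \<open>Extensions\<close>

lemma card_torsion_iso: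
  assumes iso: "G \<cong> H" and "group G" "group H"
  shows "card (torsion G m) = card (torsion H m)"
proof -
  obtain h where h: "h \<in> iso G H" using iso unfolding is_iso_def by blast
  interpret h: group_hom G H h using iso_imp_group_hom[OF h] assms by blast
  have inj: "inj_on h (carrier G)" and surj: "h ` carrier G = carrier H"
    using h by (auto simp: iso_def bij_betw_def)
  have eq: "h x [^]\<^bsub>H\<^esub> m = \<one>\<^bsub>H\<^esub> \<longleftrightarrow> x [^]\<^bsub>G\<^esub> m = \<one>\<^bsub>G\<^esub>" if "x \<in> carrier G" for x
    using that inj by (metis h.G.nat_pow_closed h.G.one_closed h.hom_nat_pow h.hom_one inj_onD)
  have "h ` torsion G m = torsion H m"
    using eq by (auto simp: torsion_def surj[symmetric])
  moreover have "inj_on h (torsion G m)" using inj by (rule inj_on_subset) (auto simp: torsion_def)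
  ultimately show ?thesis by (metis card_image)
qed

lemma gen_bound_iso:
  assumes "G \<cong> H" "group G" "group H" "gen_bound G m l s"
  shows "gen_bound H m l s"
proof -
  obtain h where h: "h \<in> iso G H" using assms(1) unfolding is_iso_def by blast
  interpret h: group_hom G H h using iso_imp_group_hom[OF h] assms by blast
  show ?thesis using h.gen_bound_image[OF assms(4)] h by (simp add: iso_def bij_betw_def)
qed

text \<open>A number of generators that suffices for \<open>d\<close> times the group
  \<open>cyclic_product ns\<close>.\<close>

abbreviation num_not_dvd :: "nat list \<Rightarrow> nat \<Rightarrow> nat" where
  "num_not_dvd ns d \<equiv> length (filter (\<lambda>n. \<not> n dvd d) ns)"

text \<open>For positive entries this is the 2-rank of \<open>cyclic_product ns\<close>.\<close>

abbreviation num_even :: "nat list \<Rightarrow> nat" where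
  "num_even ns \<equiv> length (filter even ns)"

lemma prod_list_gcd_2: "(\<Prod>n \<leftarrow> ns. gcd 2 n) = (2 :: nat) ^ num_even ns"
proof (induction ns)
  case (Cons n ns)
  have "gcd 2 n = (if even n then 2 else 1)"
    by (auto simp: coprime_iff_gcd_eq_1[symmetric] gcd_nat.absorb1)
  then show ?case using Cons by simp
qed simp

text \<open>Groups and maps are listed from left to right along the sequence from \<open>H\<close>
  to \<open>G\<close> to \<open>K\<close>, opposite to \<open>short_exact_sequence\<close>.
  Finiteness and commutativity are imposed on \<open>G\<close> only and are inherited by
  \<open>H\<close> and \<open>K\<close>.\<close>

locale finite_abelian_extension =
  G: comm_group G + f: group_hom H G f + g: group_hom G K g for H G K f g +
  assumes finite_G: "finite (carrier G)" and inj_f: "inj_on f (carrier H)"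
    and surj_g: "g ` carrier G = carrier K" and exact: "kernel G K g = f ` carrier H"
begin

lemma finite_H: "finite (carrier H)"
proof -
  have "f ` carrier H \<subseteq> carrier G" by auto
  then show ?thesis using finite_G inj_f by (meson finite_imageD finite_subset)
qed

lemma finite_K: "finite (carrier K)"
  using finite_G surj_g by (metis finite_imageI)

lemma comm_group_H: "comm_group H"
proof (rule f.G.group_comm_groupI)
  fix x y assume xy: "x \<in> carrier H" "y \<in> carrier H"
  then have "f (x \<otimes>\<^bsub>H\<^esub> y) = f (y \<otimes>\<^bsub>H\<^esub> x)" by (simp add: G.m_comm)
  then show "x \<otimes>\<^bsub>H\<^esub> y = y \<otimes>\<^bsub>H\<^esub> x" using inj_f xy by (metis f.G.m_closed inj_onD)
qed

lemma card_G: "card (carrier G) = card (carrier H) * card (carrier K)"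
  using g.card_eq_card_kernel_mult_card_image[OF finite_G] exact surj_g card_image[OF inj_f] by simp

lemma pow_eq_one_H:
  assumes "\<And>x. x \<in> carrier G \<Longrightarrow> x [^]\<^bsub>G\<^esub> (N :: nat) = \<one>\<^bsub>G\<^esub>" "x \<in> carrier H"
  shows "x [^]\<^bsub>H\<^esub> N = \<one>\<^bsub>H\<^esub>"
proof -
  have "f (x [^]\<^bsub>H\<^esub> N) = f \<one>\<^bsub>H\<^esub>" using assms by (simp add: f.hom_nat_pow)
  then show ?thesis using inj_f assms(2) by (metis f.G.nat_pow_closed f.G.one_closed inj_onD)
qed

lemma pow_eq_one_K:
  assumes "\<And>x. x \<in> carrier G \<Longrightarrow> x [^]\<^bsub>G\<^esub> (N :: nat) = \<one>\<^bsub>G\<^esub>" "x \<in> carrier K"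
  shows "x [^]\<^bsub>K\<^esub> N = \<one>\<^bsub>K\<^esub>"
proof -
  obtain y where "y \<in> carrier G" "x = g y" using assms(2) surj_g by blast
  then show ?thesis using assms(1) by (metis g.hom_nat_pow g.hom_one)
qed

text \<open>The \<open>l\<close>-torsion of \<open>H\<close> is the kernel of the map from the
  \<open>l\<close>-torsion of \<open>G\<close> to that of \<open>K\<close>, so the count forces this
  map to be onto. If \<open>x [^] l\<close> dies in \<open>K\<close>, then \<open>g x\<close> is
  \<open>l\<close>-torsion and lifts to an \<open>l\<close>-torsion element \<open>t\<close>.
  Dividing \<open>x\<close> by \<open>t\<close> leaves the \<open>l\<close>-th power unchanged and
  lands in the image of \<open>f\<close>.\<close>

lemma pure_of_card_torsion:
  assumes card: "card (torsion G l) \<ge> card (torsion H l) * card (torsion K l)"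
    and x: "x \<in> carrier G" "g (x [^]\<^bsub>G\<^esub> l) = \<one>\<^bsub>K\<^esub>"
  shows "\<exists>h \<in> carrier H. x [^]\<^bsub>G\<^esub> l = f (h [^]\<^bsub>H\<^esub> l)"
proof -
  let ?T = "torsion G l"
  interpret H: comm_group H by (rule comm_group_H)
  have sub: "subgroup ?T G" by (rule G.subgroup_torsion)
  have finT: "finite ?T" "finite (torsion H l)" "finite (torsion K l)"
    using finite_G finite_H finite_K by (auto simp: torsion_def)
  interpret t: group_hom "G\<lparr>carrier := ?T\<rparr>" K g
    using sub by (intro group_hom.intro group_hom_axioms.intro)
      (auto simp: subgroup.subgroup_is_group hom_def torsion_def)
  have fpow: "f h [^]\<^bsub>G\<^esub> l = \<one>\<^bsub>G\<^esub> \<longleftrightarrow> h [^]\<^bsub>H\<^esub> l = \<one>\<^bsub>H\<^esub>" if "h \<in> carrier H" for h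
    using that inj_f by (metis f.G.nat_pow_closed f.G.one_closed f.hom_nat_pow f.hom_one inj_onD)
  have "kernel (G\<lparr>carrier := ?T\<rparr>) K g = kernel G K g \<inter> ?T" by (auto simp: kernel_def torsion_def)
  also have "\<dots> = f ` torsion H l" unfolding exact using fpow by (auto simp: torsion_def)
  finally have "card ?T = card (torsion H l) * card (g ` ?T)"
    using t.card_eq_card_kernel_mult_card_image finT(1)
      card_image[OF inj_on_subset[OF inj_f, of "torsion H l"]] by (auto simp: torsion_def)
  moreover have "card (torsion H l) > 0"
    using finT(2) H.subgroup_torsion[of l] subgroup.one_closed by (auto simp: card_gt_0_iff)
  ultimately have "card (torsion K l) \<le> card (g ` ?T)" using card by simp
  moreover have "g ` ?T \<subseteq> torsion K l"
    by (auto simp: torsion_def simp flip: g.hom_nat_pow)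
  ultimately have im: "g ` ?T = torsion K l" using finT(3) card_seteq by blast
  have "g x \<in> torsion K l" using x by (simp add: torsion_def g.hom_nat_pow)
  then have "g x \<in> g ` ?T" unfolding im .
  then obtain t where gt: "g x = g t" and "t \<in> ?T" by (rule imageE)
  then have t: "t \<in> carrier G" "t [^]\<^bsub>G\<^esub> l = \<one>\<^bsub>G\<^esub>" by (auto simp: torsion_def)
  then have "x \<otimes>\<^bsub>G\<^esub> inv\<^bsub>G\<^esub> t \<in> kernel G K g" using x t gt by (simp add: kernel_def)
  then obtain h where h: "h \<in> carrier H" "x \<otimes>\<^bsub>G\<^esub> inv\<^bsub>G\<^esub> t = f h" unfolding exact by blast
  have "x [^]\<^bsub>G\<^esub> l = (x \<otimes>\<^bsub>G\<^esub> inv\<^bsub>G\<^esub> t) [^]\<^bsub>G\<^esub> l"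
    using x t by (simp add: G.nat_pow_distrib G.nat_pow_inv)
  also have "\<dots> = f (h [^]\<^bsub>H\<^esub> l)" unfolding h(2) using h(1) by (simp add: f.hom_nat_pow)
  finally show ?thesis using h(1) by blast
qed

end

text \<open>
  Numerical shadow of an extension \<open>0 \<rightarrow> H \<rightarrow> G \<rightarrow> K \<rightarrow> 0\<close>, where \<open>ns\<close> are the invariant factors of
  \<open>G\<close> and \<open>H\<close>, \<open>K\<close> are products of cyclic groups of orders \<open>hs\<close>, \<open>ks\<close>. The last conjunct is the sharper
  bound that \<open>H \<inter> 2G = 2H\<close> gives once the 2-ranks of \<open>H\<close> and \<open>K\<close> add up to that of \<open>G\<close>.
\<close>
definition extension_type :: "nat list \<Rightarrow> nat list \<Rightarrow> nat list \<Rightarrow> bool" where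
  "extension_type hs ks ns \<longleftrightarrow> 0 \<notin> set ns \<and> divisor_chain ns \<and>
     prod_list ns = prod_list hs * prod_list ks \<and>
     (\<forall>N. (\<forall>n \<in> set ns. n dvd N) \<longrightarrow> (\<forall>h \<in> set hs \<union> set ks. h dvd N)) \<and>
     (\<forall>d e. num_not_dvd hs d + num_not_dvd ks e < length ns \<longrightarrow>
       ns ! (num_not_dvd hs d + num_not_dvd ks e) dvd d * e) \<and>
     (num_even hs + num_even ks \<le> num_even ns \<longrightarrow>
       (\<forall>d e. num_not_dvd hs (2 * d) + num_not_dvd ks (2 * e) < length ns \<longrightarrow>
         ns ! (num_not_dvd hs (2 * d) + num_not_dvd ks (2 * e)) dvd 2 * d * e))"

lemma (in finite_abelian_extension) extension_type:
  assumes hs: "0 \<notin> set hs" "cyclic_product hs \<cong> H" and ks: "0 \<notin> set ks" "cyclic_product ks \<cong> K"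
    and ns: "0 \<notin> set ns" "divisor_chain ns" "cyclic_product ns \<cong> G"
  shows "extension_type hs ks ns"
proof -
  interpret H: comm_group H by (rule comm_group_H)
  have gG: "G \<cong> cyclic_product ns" by (rule group.iso_sym[OF group_cyclic_product ns(3)])
  have tor: "card (torsion H m) = (\<Prod>n \<leftarrow> hs. gcd m n)" "card (torsion K m) = (\<Prod>n \<leftarrow> ks. gcd m n)"
    "card (torsion G m) = (\<Prod>n \<leftarrow> ns. gcd m n)" for m
    using card_torsion_iso[OF hs(2)] card_torsion_iso[OF ks(2)] card_torsion_iso[OF ns(3)]
    by (auto simp: card_torsion_cyclic_product hs ks ns)
  have genH: "gen_bound H m l (num_not_dvd hs m)" if "l dvd m" for l m
    by (rule gen_bound_iso[OF hs(2)]) (use gen_bound_cyclic_product[OF hs(1) that] in auto)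
  have genK: "gen_bound K m l (num_not_dvd ks m)" if "l dvd m" for l m
    by (rule gen_bound_iso[OF ks(2)]) (use gen_bound_cyclic_product[OF ks(1) that] in auto)
  \<comment> \<open>Both families of bounds are instances: for \<open>l = 1\<close> the last
    hypothesis is exactness, for \<open>l = 2\<close> it comes from counting 2-torsion.\<close>
  have bound: "ns ! s dvd l * d * e"
    if "s = num_not_dvd hs (l * d) + num_not_dvd ks (l * e)" "s < length ns"
      and "\<And>x. x \<in> carrier G \<Longrightarrow> g (x [^]\<^bsub>G\<^esub> l) = \<one>\<^bsub>K\<^esub> \<Longrightarrow> \<exists>h \<in> carrier H. x [^]\<^bsub>G\<^esub> l = f (h [^]\<^bsub>H\<^esub> l)"
    for s l d e
  proof (rule nth_dvd_of_gen_bound[OF ns(1,2) _ that(2)])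
    have "gen_bound G (l * d * e) 1 s"
      unfolding that(1)
      by (rule gen_bound_extension[OF G.comm_group_axioms f.group_hom_axioms g.group_hom_axioms exact surj_g])
        (use genH genK that(3) in auto)
    then show "gen_bound (cyclic_product ns) (l * d * e) 1 s"
      by (intro gen_bound_iso[OF gG]) auto
  qed
  have prod: "prod_list ns = prod_list hs * prod_list ks"
    using card_G iso_same_card[OF hs(2)] iso_same_card[OF ks(2)] iso_same_card[OF ns(3)]
    by (simp add: card_cyclic_product hs ks ns)
  have exponent: "\<forall>h \<in> set hs \<union> set ks. h dvd N" if "\<forall>n \<in> set ns. n dvd N" for N
  proof -
    have 1: "x [^]\<^bsub>G\<^esub> N = \<one>\<^bsub>G\<^esub>" if "x \<in> carrier G" for x
      by (rule pow_eq_one_iso[OF gG _ _ _ that])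
        (use pow_eq_one_cyclic_product_iff[OF ns(1), of N] \<open>\<forall>n \<in> set ns. n dvd N\<close> in auto)
    have "\<forall>x \<in> carrier (cyclic_product hs). x [^]\<^bsub>cyclic_product hs\<^esub> N = \<one>\<^bsub>cyclic_product hs\<^esub>"
      using pow_eq_one_iso[OF hs(2) _ _ pow_eq_one_H[OF 1]] by auto
    moreover have "\<forall>x \<in> carrier (cyclic_product ks). x [^]\<^bsub>cyclic_product ks\<^esub> N = \<one>\<^bsub>cyclic_product ks\<^esub>"
      using pow_eq_one_iso[OF ks(2) _ _ pow_eq_one_K[OF 1]] by auto
    ultimately show ?thesis
      using pow_eq_one_cyclic_product_iff[OF hs(1)] pow_eq_one_cyclic_product_iff[OF ks(1)] by blast
  qed
  have bound1: "ns ! (num_not_dvd hs d + num_not_dvd ks e) dvd d * e"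
    if s: "num_not_dvd hs d + num_not_dvd ks e < length ns" for d e
  proof -
    have "\<exists>h \<in> carrier H. x [^]\<^bsub>G\<^esub> (1::nat) = f (h [^]\<^bsub>H\<^esub> (1::nat))"
      if x: "x \<in> carrier G" "g (x [^]\<^bsub>G\<^esub> (1::nat)) = \<one>\<^bsub>K\<^esub>" for x
    proof -
      have "x \<in> f ` carrier H" unfolding exact[symmetric] kernel_def using x by simp
      then show ?thesis using x by force
    qed
    then show ?thesis using bound[of _ 1 d e] s by (simp del: One_nat_def)
  qed
  have bound2: "ns ! (num_not_dvd hs (2 * d) + num_not_dvd ks (2 * e)) dvd 2 * d * e"
    if ev: "num_even hs + num_even ks \<le> num_even ns"
      and s: "num_not_dvd hs (2 * d) + num_not_dvd ks (2 * e) < length ns" for d e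
  proof -
    \<comment> \<open>The 2-torsion has order 2 to the number of even factors, so the hypothesis on
      \<open>num_even\<close> is exactly the count that purity asks for.\<close>
    have "card (torsion G 2) \<ge> card (torsion H 2) * card (torsion K 2)"
      unfolding tor prod_list_gcd_2 using ev by (simp flip: power_add)
    then show ?thesis using bound[OF refl s pure_of_card_torsion] by blast
  qed
  show ?thesis
    unfolding extension_type_def
    by (intro conjI allI impI) (fact ns prod | erule exponent | rule bound1 bound2, assumption+)+
qed

section \<open>Extensions of groups in the two lists\<close>

text \<open>Insensitive to order and to padding by ones. For lists without 0 it suffices for
  isomorphism of the cyclic products, but it is finer: \<open>[6]\<close> and \<open>[2, 3]\<close>
  are not related.\<close>

definition same_factors :: "nat list \<Rightarrow> nat list \<Rightarrow> bool" where
  "same_factors ms ns \<longleftrightarrow> filter_mset (\<lambda>n. n \<noteq> 1) (mset ms) = filter_mset (\<lambda>n. n \<noteq> 1) (mset ns)"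

definition factors1 :: "nat list set" where
  "factors1 = {[k] |k. k \<ge> 1} \<union> {[2, 2]}"

text \<open>
  The five families are called R, B, C, D, E below, in the order of this definition.
\<close>
definition factors2 :: "nat list set" where
  "factors2 = {[k, m] |k m. k \<ge> 1 \<and> m \<ge> 1} \<union> {[2 * k, 2, 2] |k. k \<ge> 1} \<union>
     {[4, 4, 2], [3, 3, 3], [2, 2, 2, 2]}"

definition product22 :: "nat list \<Rightarrow> bool" where
  "product22 ns \<longleftrightarrow> (\<exists>xs \<in> factors2. \<exists>ys \<in> factors2. same_factors ns (xs @ ys))"

lemma extension_typeD:
  assumes "extension_type hs ks ns"
  shows "0 \<notin> set ns" "divisor_chain ns" "prod_list ns = prod_list hs * prod_list ks"
    "\<And>N x. (\<And>n. n \<in> set ns \<Longrightarrow> n dvd N) \<Longrightarrow> x \<in> set hs \<union> set ks \<Longrightarrow> x dvd N"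
    "\<And>d e. num_not_dvd hs d + num_not_dvd ks e < length ns \<Longrightarrow>
       ns ! (num_not_dvd hs d + num_not_dvd ks e) dvd d * e"
    "\<And>d e. num_even hs + num_even ks \<le> num_even ns \<Longrightarrow>
       num_not_dvd hs (2 * d) + num_not_dvd ks (2 * e) < length ns \<Longrightarrow>
       ns ! (num_not_dvd hs (2 * d) + num_not_dvd ks (2 * e)) dvd 2 * d * e"
  using assms unfolding extension_type_def by blast+

lemma extension_typeI:
  assumes "0 \<notin> set ns" "divisor_chain ns" "prod_list ns = prod_list hs * prod_list ks"
    "\<And>N x. (\<And>n. n \<in> set ns \<Longrightarrow> n dvd N) \<Longrightarrow> x \<in> set hs \<union> set ks \<Longrightarrow> x dvd N"
    "\<And>d e. num_not_dvd hs d + num_not_dvd ks e < length ns \<Longrightarrow>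
       ns ! (num_not_dvd hs d + num_not_dvd ks e) dvd d * e"
    "\<And>d e. num_even hs + num_even ks \<le> num_even ns \<Longrightarrow>
       num_not_dvd hs (2 * d) + num_not_dvd ks (2 * e) < length ns \<Longrightarrow>
       ns ! (num_not_dvd hs (2 * d) + num_not_dvd ks (2 * e)) dvd 2 * d * e"
  shows "extension_type hs ks ns"
  unfolding extension_type_def
  by (intro conjI allI impI ballI) (rule assms; (assumption | blast))+

text \<open>Duality of finite abelian groups exchanges subgroup and quotient; numerically this is a
  plain symmetry of the conditions. It reduces the 25 ordered pairs of families to 15.\<close>

lemma extension_type_commute:
  assumes "extension_type hs ks ns"
  shows "extension_type ks hs ns"
proof (rule extension_typeI)
  note ext = extension_typeD[OF assms]
  show "0 \<notin> set ns" "divisor_chain ns" by (fact ext)+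
  show "prod_list ns = prod_list ks * prod_list hs" using ext(3) by (simp only: mult.commute)
  show "x dvd N" if "\<And>n. n \<in> set ns \<Longrightarrow> n dvd N" "x \<in> set ks \<union> set hs" for N x
    by (rule ext(4)) (use that in auto)
  show "ns ! (num_not_dvd ks d + num_not_dvd hs e) dvd d * e"
    if "num_not_dvd ks d + num_not_dvd hs e < length ns" for d e
    using ext(5)[of e d] that by (simp only: add.commute mult.commute)
  show "ns ! (num_not_dvd ks (2 * d) + num_not_dvd hs (2 * e)) dvd 2 * d * e"
    if "num_even ks + num_even hs \<le> num_even ns"
      "num_not_dvd ks (2 * d) + num_not_dvd hs (2 * e) < length ns" for d e
    using ext(6)[of e d] that by (simp only: add.commute mult.commute mult.left_commute)
qed

text \<open>Later factors divide earlier ones, so upper bounds \<open>i\<close> and \<open>j\<close>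
  for the two counts are enough. This avoids deciding which of the free parameters in
  \<open>hs\<close> and \<open>ks\<close> divide \<open>d\<close> and \<open>e\<close>.\<close>

lemma extension_type_dvd:
  assumes "extension_type hs ks ns" "num_not_dvd hs d \<le> i" "num_not_dvd ks e \<le> j" "i + j < length ns"
  shows "ns ! (i + j) dvd d * e"
proof -
  let ?s = "num_not_dvd hs d + num_not_dvd ks e"
  have "ns ! ?s dvd d * e" using assms(2-) by (intro extension_typeD(5)[OF assms(1)]) simp
  moreover have "ns ! (i + j) dvd ns ! ?s"
  proof (cases "?s = i + j")
    case False
    then have "?s < i + j" using assms by simp
    then show ?thesis
      using sorted_wrt_nth_less[OF extension_typeD(2)[OF assms(1)]] assms by blast
  qed simp
  ultimately show ?thesis using dvd_trans by blast
qed

text \<open>In terms of 2G as an extension of 2K by 2H, \<open>num_not_dvd hs (2 * d)\<close> counts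
  generators of d(2H). An even invariant factor n of G becomes n/2 in 2G, and the factor 2 in
  \<open>2 * d * e\<close> undoes this halving.\<close>

lemma extension_type_dvd_even:
  assumes "extension_type hs ks ns" "num_even hs + num_even ks \<le> num_even ns"
    "num_not_dvd hs (2 * d) \<le> i" "num_not_dvd ks (2 * e) \<le> j" "i + j < length ns"
  shows "ns ! (i + j) dvd 2 * d * e"
proof -
  let ?s = "num_not_dvd hs (2 * d) + num_not_dvd ks (2 * e)"
  have "ns ! ?s dvd 2 * d * e" using assms(2-) by (intro extension_typeD(6)[OF assms(1)]) simp_all
  moreover have "ns ! (i + j) dvd ns ! ?s"
  proof (cases "?s = i + j")
    case False
    then have "?s < i + j" using assms by simp
    then show ?thesis
      using sorted_wrt_nth_less[OF extension_typeD(2)[OF assms(1)]] assms by blast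
  qed simp
  ultimately show ?thesis using dvd_trans by blast
qed

lemma extension_type_append_ones:
  assumes "extension_type hs ks ns"
  shows "extension_type hs ks (ns @ replicate r 1)"
proof (rule extension_typeI)
  note ext = extension_typeD[OF assms]
  have nth: "(ns @ replicate r 1) ! s dvd D" if "s < length ns \<Longrightarrow> ns ! s dvd D" "s < length ns + r" for s D :: nat
    using that by (simp add: nth_append)
  show "0 \<notin> set (ns @ replicate r 1)" using ext(1) by simp
  have "divisor_chain (replicate r 1)" by (induction r) auto
  then show "divisor_chain (ns @ replicate r 1)" using ext(2) by (simp add: sorted_wrt_append)
  show "prod_list (ns @ replicate r 1) = prod_list hs * prod_list ks" using ext(3) by simp
  show "x dvd N" if "\<And>n. n \<in> set (ns @ replicate r 1) \<Longrightarrow> n dvd N" "x \<in> set hs \<union> set ks" for N x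
    by (rule ext(4)) (use that in auto)
  show "(ns @ replicate r 1) ! (num_not_dvd hs d + num_not_dvd ks e) dvd d * e"
    if "num_not_dvd hs d + num_not_dvd ks e < length (ns @ replicate r 1)" for d e
    by (rule nth) (use ext(5) that in auto)
  show "(ns @ replicate r 1) ! (num_not_dvd hs (2 * d) + num_not_dvd ks (2 * e)) dvd 2 * d * e"
    if "num_even hs + num_even ks \<le> num_even (ns @ replicate r 1)"
      "num_not_dvd hs (2 * d) + num_not_dvd ks (2 * e) < length (ns @ replicate r 1)" for d e
    by (rule nth, rule ext(6)) (use that in auto)
qed

section \<open>Divisors of small prime powers\<close>

lemma dvd_2: "(x :: nat) dvd 2 \<Longrightarrow> x = 1 \<or> x = 2"
  using two_is_prime_nat by (simp add: prime_nat_iff)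

lemma prime_3: "prime (3 :: nat)"
  by simp

lemma dvd_3: "(x :: nat) dvd 3 \<Longrightarrow> x = 1 \<or> x = 3"
  using prime_3 by (simp add: prime_nat_iff)

lemma dvd_4:
  assumes "(x :: nat) dvd 4" shows "x = 1 \<or> x = 2 \<or> x = 4"
proof -
  have "x dvd 2 ^ 2" using assms by simp
  then obtain i where i: "i \<le> 2" "x = 2 ^ i" using divides_primepow_nat[of 2 x 2] two_is_prime_nat by auto
  then have "i = 0 \<or> i = 1 \<or> i = 2" by linarith
  then show ?thesis using i(2) by auto
qed

lemma dvd_8:
  assumes "(x :: nat) dvd 8" shows "x = 1 \<or> x = 2 \<or> x = 4 \<or> x = 8"
proof -
  have "x dvd 2 ^ 3" using assms by simp
  then obtain i where i: "i \<le> 3" "x = 2 ^ i" using divides_primepow_nat[of 2 x 3] two_is_prime_nat by auto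
  then have "i = 0 \<or> i = 1 \<or> i = 2 \<or> i = 3" by linarith
  then show ?thesis using i(2) by auto
qed

lemma dvd_16:
  assumes "(x :: nat) dvd 16" shows "x = 1 \<or> x = 2 \<or> x = 4 \<or> x = 8 \<or> x = 16"
proof -
  have "x dvd 2 ^ 4" using assms by simp
  then obtain i where i: "i \<le> 4" "x = 2 ^ i" using divides_primepow_nat[of 2 x 4] two_is_prime_nat by auto
  then have "i = 0 \<or> i = 1 \<or> i = 2 \<or> i = 3 \<or> i = 4" by linarith
  then show ?thesis using i(2) by auto
qed

lemma dvd_9:
  assumes "(x :: nat) dvd 9" shows "x = 1 \<or> x = 3 \<or> x = 9"
proof -
  have "x dvd 3 ^ 2" using assms by simp
  then obtain i where i: "i \<le> 2" "x = 3 ^ i" using divides_primepow_nat[of 3 x 2] prime_3 by auto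
  then have "i = 0 \<or> i = 1 \<or> i = 2" by linarith
  then show ?thesis using i(2) by auto
qed

section \<open>Shapes of eight factors that belong to A_2 x A_2\<close>

lemma product22I:
  assumes "mset ns = mset (xs @ ys @ replicate r 1)" "xs \<in> factors2" "ys \<in> factors2"
  shows "product22 ns"
  unfolding product22_def same_factors_def using assms by (intro bexI[of _ xs] bexI[of _ ys]) auto

text \<open>The letters name the families of the two factors. The pair BB has the shape of RE as a
  multiset, and the 2-groups and 3-groups in CD and DE combine into at most four invariant factors,
  as do those in BD; such groups fall under RR.\<close>

lemma product22_RR: "a > 0 \<Longrightarrow> b > 0 \<Longrightarrow> c > 0 \<Longrightarrow> d > 0 \<Longrightarrow> product22 [a, b, c, d, 1, 1, 1, 1]"
  by (rule product22I[of _ "[a, b]" "[c, d]" 4]) (auto simp: factors2_def numeral_eq_Suc)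

lemma product22_RB:
  assumes "a > 0" "b > 0" "c > 0" "even c" shows "product22 [a, b, c, 2, 2, 1, 1, 1]"
proof -
  obtain k where "c = 2 * k" using assms by auto
  then show ?thesis using assms
    by (intro product22I[of _ "[a, b]" "[c, 2, 2]" 3]) (auto simp: factors2_def numeral_eq_Suc)
qed

lemma product22_RC: "a > 0 \<Longrightarrow> b > 0 \<Longrightarrow> product22 [a, b, 4, 4, 2, 1, 1, 1]"
  by (rule product22I[of _ "[a, b]" "[4, 4, 2]" 3]) (auto simp: factors2_def numeral_eq_Suc)

lemma product22_RD: "a > 0 \<Longrightarrow> b > 0 \<Longrightarrow> product22 [a, b, 3, 3, 3, 1, 1, 1]"
  by (rule product22I[of _ "[a, b]" "[3, 3, 3]" 3]) (auto simp: factors2_def numeral_eq_Suc)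

lemma product22_RE: "a > 0 \<Longrightarrow> b > 0 \<Longrightarrow> product22 [a, b, 2, 2, 2, 2, 1, 1]"
  by (rule product22I[of _ "[a, b]" "[2, 2, 2, 2]" 2]) (auto simp: factors2_def numeral_eq_Suc)

lemma product22_BC:
  assumes "a > 0" "even a" shows "product22 [a, 4, 4, 2, 2, 2, 1, 1]"
proof -
  obtain k where "a = 2 * k" using assms by auto
  then show ?thesis using assms
    by (intro product22I[of _ "[a, 2, 2]" "[4, 4, 2]" 2]) (auto simp: factors2_def numeral_eq_Suc add_mset_commute)
qed

lemma product22_CC: "product22 [4, 4, 4, 4, 2, 2, 1, 1]"
  by (rule product22I[of _ "[4, 4, 2]" "[4, 4, 2]" 2]) (auto simp: factors2_def numeral_eq_Suc)

lemma product22_BE: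
  assumes "a > 0" "even a" shows "product22 [a, 2, 2, 2, 2, 2, 2, 1]"
proof -
  obtain k where "a = 2 * k" using assms by auto
  then show ?thesis using assms
    by (intro product22I[of _ "[a, 2, 2]" "[2, 2, 2, 2]" 1]) (auto simp: factors2_def numeral_eq_Suc)
qed

lemma product22_CE: "product22 [4, 4, 2, 2, 2, 2, 2, 1]"
  by (rule product22I[of _ "[4, 4, 2]" "[2, 2, 2, 2]" 1]) (auto simp: factors2_def numeral_eq_Suc)

lemma product22_EE: "product22 [2, 2, 2, 2, 2, 2, 2, 2]"
  by (rule product22I[of _ "[2, 2, 2, 2]" "[2, 2, 2, 2]" 0]) (auto simp: factors2_def)

lemma product22_DD: "product22 [3, 3, 3, 3, 3, 3, 1, 1]"
  by (rule product22I[of _ "[3, 3, 3]" "[3, 3, 3]" 2]) (auto simp: factors2_def numeral_eq_Suc)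

text \<open>
  Two groups of the second list need at most four generators each, so eight invariant factors, padded
  by ones, describe every extension.
\<close>
context
  fixes a b c d e f g h :: nat and hs ks :: "nat list"
  assumes ext: "extension_type hs ks [a, b, c, d, e, f, g, h]"
begin

lemma ext_pos: "a > 0" "b > 0" "c > 0" "d > 0" "e > 0" "f > 0" "g > 0" "h > 0"
  using extension_typeD(1)[OF ext] by auto

lemma ext_chain: "b dvd a" "c dvd b" "d dvd c" "e dvd d" "f dvd e" "g dvd f" "h dvd g"
  using extension_typeD(2)[OF ext] by auto

lemma ext_prod: "a * b * c * d * e * f * g * h = prod_list hs * prod_list ks"
  using extension_typeD(3)[OF ext] by (simp add: mult.assoc)

lemma ext_exponent:
  assumes "x \<in> set hs \<union> set ks" shows "x dvd a"
proof (rule extension_typeD(4)[OF ext _ assms])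
  fix n assume n: "n \<in> set [a, b, c, d, e, f, g, h]"
  have "\<forall>n \<in> set [b, c, d, e, f, g, h]. n dvd a"
    using extension_typeD(2)[OF ext] unfolding sorted_wrt.simps by (elim conjE)
  moreover have "n = a \<or> n \<in> set [b, c, d, e, f, g, h]" using n unfolding set_simps by (rule insertE) simp_all
  ultimately show "n dvd a" by (metis dvd_refl)
qed

lemmas ext_dvd = extension_type_dvd[OF ext]
lemmas ext_dvd_even = extension_type_dvd_even[OF ext]

text \<open>Four invariant factors split into two pairs, each from family R. Only a nontrivial fifth
  factor \<open>e\<close> leaves work to do.\<close>

lemma product22_of_e: "e = 1 \<Longrightarrow> product22 [a, b, c, d, e, f, g, h]"
  using ext_chain ext_pos product22_RR by (auto simp del: One_nat_def)

end

section \<open>The fifteen pairs of families\<close>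

lemma extension_RR:
  assumes ext: "extension_type [k, m] [k', m'] [a, b, c, d, e, f, g, h]"
  shows "product22 [a, b, c, d, e, f, g, h]"
  \<comment> \<open>The four numbers are \<open>d\<close>, \<open>i\<close>, \<open>e\<close>,
    \<open>j\<close> of the general bound: at most \<open>i\<close> entries of the first list fail
    to divide \<open>d\<close>, at most \<open>j\<close> of the second fail to divide
    \<open>e\<close>, and the factor at index \<open>i + j\<close>, counted from \<open>a\<close> at
    0, divides \<open>d * e\<close>. Here index 4 gives \<open>e dvd 1\<close>. All later instances
    are read the same way.\<close>
  using ext_dvd[OF ext, of 1 2 1 2] by (intro product22_of_e[OF ext]) simp

lemma extension_RB:
  assumes ext: "extension_type [k, m] [2 * l, 2, 2] [a, b, c, d, e, f, g, h]"
  shows "product22 [a, b, c, d, e, f, g, h]"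
proof -
  note ch = ext_chain[OF ext] and pos = ext_pos[OF ext] and e1 = product22_of_e[OF ext]
  have f: "f = 1" using ext_dvd[OF ext, of 1 2 1 3] by simp
  have d2: "d dvd 2" using ext_dvd[OF ext, of 1 2 2 1] by simp
  show ?thesis
    using dvd_2[OF d2] dvd_2[OF dvd_trans[OF ch(4) d2]] ch pos f e1 product22_RB[of a b c] by auto
qed

lemma extension_RC:
  assumes ext: "extension_type [k, m] [4, 4, 2] [a, b, c, d, e, f, g, h]"
  shows "product22 [a, b, c, d, e, f, g, h]"
proof -
  note ch = ext_chain[OF ext] and pos = ext_pos[OF ext] and e1 = product22_of_e[OF ext]
  have f: "f = 1" using ext_dvd[OF ext, of 1 2 1 3] by simp
  have e2: "e dvd 2" using ext_dvd[OF ext, of 1 2 2 2] by simp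
  have c4: "c dvd 4" using ext_dvd[OF ext, of 1 2 4 0] by simp
  show ?thesis
    using dvd_2[OF e2] dvd_4[OF c4] dvd_4[OF dvd_trans[OF ch(3) c4]] ch pos f e1
      product22_RB[of a b c] product22_RC[of a b] by auto
qed

lemma extension_RD:
  assumes ext: "extension_type [k, m] [3, 3, 3] [a, b, c, d, e, f, g, h]"
  shows "product22 [a, b, c, d, e, f, g, h]"
proof -
  note ch = ext_chain[OF ext] and pos = ext_pos[OF ext] and e1 = product22_of_e[OF ext]
  have f: "f = 1" using ext_dvd[OF ext, of 1 2 1 3] by simp
  have c3: "c dvd 3" using ext_dvd[OF ext, of 1 2 3 0] by simp
  show ?thesis
    using dvd_3[OF c3] dvd_3[OF dvd_trans[OF ch(3) c3]] dvd_3[OF dvd_trans[OF dvd_trans[OF ch(4,3)] c3]]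
      ch pos f e1 product22_RD[of a b] by auto
qed

lemma extension_RE:
  assumes ext: "extension_type [k, m] [2, 2, 2, 2] [a, b, c, d, e, f, g, h]"
  shows "product22 [a, b, c, d, e, f, g, h]"
proof -
  note ch = ext_chain[OF ext] and pos = ext_pos[OF ext] and e1 = product22_of_e[OF ext]
  have g: "g = 1" using ext_dvd[OF ext, of 1 2 1 4] by simp
  have c2: "c dvd 2" using ext_dvd[OF ext, of 1 2 2 0] by simp
  show ?thesis
    using dvd_2[OF c2] dvd_2[OF dvd_trans[OF ch(3) c2]] dvd_2[OF dvd_trans[OF dvd_trans[OF ch(4,3)] c2]]
      dvd_2[OF dvd_trans[OF dvd_trans[OF dvd_trans[OF ch(5,4)] ch(3)] c2]]
      ch pos g e1 product22_RB[of a b c] product22_RE[of a b] by auto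
qed

lemma extension_BB:
  assumes ext: "extension_type [2 * l, 2, 2] [2 * l', 2, 2] [a, b, c, d, e, f, g, h]"
  shows "product22 [a, b, c, d, e, f, g, h]"
proof -
  note ch = ext_chain[OF ext] and pos = ext_pos[OF ext] and e1 = product22_of_e[OF ext]
  have g: "g = 1" using ext_dvd[OF ext, of 1 3 1 3] by simp
  have e2: "e dvd 2" using ext_dvd[OF ext, of 1 3 2 1] by simp
  have c4: "c dvd 4" using ext_dvd[OF ext, of 2 1 2 1] by simp
  have f2: "f dvd 2" using ch(5) e2 by (rule dvd_trans)
  \<comment> \<open>Six even factors match the 2-ranks 3 + 3, so 2G is an extension of a cyclic
    group by a cyclic group and its third factor is trivial. The plain bound only gives
    \<open>c dvd 4\<close>.\<close>
  have "c dvd 2" if "f = 2"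
  proof -
    have "2 dvd e" "2 dvd d" "2 dvd c" "2 dvd b" "2 dvd a" using that ch by (metis dvd_trans)+
    then show ?thesis using ext_dvd_even[OF ext, of 1 1 1 1] that by simp
  qed
  then show ?thesis
    using dvd_2[OF f2] dvd_2[OF e2] dvd_4[OF c4] dvd_4[OF dvd_trans[OF ch(3) c4]] ch pos g e1
      product22_RB[of a b c] product22_RC[of a b] product22_RE[of a b] by auto
qed

lemma extension_BC:
  assumes ext: "extension_type [2 * l, 2, 2] [4, 4, 2] [a, b, c, d, e, f, g, h]"
  shows "product22 [a, b, c, d, e, f, g, h]"
proof -
  note ch = ext_chain[OF ext] and pos = ext_pos[OF ext] and e1 = product22_of_e[OF ext]
  have g: "g = 1" using ext_dvd[OF ext, of 1 3 1 3] by simp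
  have e2: "e dvd 2" using ext_dvd[OF ext, of 2 1 1 3] by simp
  have d4: "d dvd 4" using ext_dvd[OF ext, of 2 1 2 2] by simp
  have b8: "b dvd 8" using ext_dvd[OF ext, of 2 1 4 0] by simp
  have f2: "f dvd 2" using ch(5) e2 by (rule dvd_trans)
  have even: "2 dvd a" "2 dvd b" "2 dvd c" "2 dvd d" if "e = 2" using that ch by (metis dvd_trans)+
  \<comment> \<open>With six even factors, 2G is an extension of (Z/2)^2 by a cyclic group. It needs
    at most three generators, and 2(2G) is cyclic; this bounds \<open>d\<close> and \<open>b\<close>
    respectively.\<close>
  have bd: "d dvd 2 \<and> b dvd 4" if "f = 2"
  proof -
    have "2 dvd e" "e = 2" using that ch(5) e2 by (auto simp: dvd_antisym)
    then show ?thesis using ext_dvd_even[OF ext, of 1 1 1 2] ext_dvd_even[OF ext, of 1 1 2 0] that even by simp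
  qed
  \<comment> \<open>The divisibilities leave this one bad shape. Comparing orders gives l = 2a,
    whereas the exponent gives 2l dvd a.\<close>
  have "\<not> (b = 8 \<and> c = 8 \<and> d = 4 \<and> e = 2 \<and> f = 1)"
  proof
    assume "b = 8 \<and> c = 8 \<and> d = 4 \<and> e = 2 \<and> f = 1"
    then have "a * 512 = l * 256" using ext_prod[OF ext] g ch(7) by simp
    moreover have "2 * l \<le> a" using ext_exponent[OF ext, of "2 * l"] pos(1) by (intro dvd_imp_le) auto
    ultimately show False using pos(1) by linarith
  qed
  note case8 = this
  show ?thesis
  proof (cases "e = 1")
    case False
    then have e: "e = 2" using dvd_2[OF e2] by simp
    have c: "c = 2 \<or> c = 4 \<or> c = 8" using dvd_8[OF dvd_trans[OF ch(2) b8]] even(3)[OF e] by auto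
    have d: "d = 2 \<or> d = 4" using dvd_4[OF d4] even(4)[OF e] by auto
    from dvd_2[OF f2] show ?thesis
    proof
      assume f: "f = 1"
      show ?thesis using d
      proof
        assume "d = 2"
        then show ?thesis using product22_RB[OF pos(1-3) even(3)[OF e]] e f g ch(7) by simp
      next
        assume d: "d = 4"
        then have "c = 4 \<or> c = 8" using c ch(3) by auto
        moreover have "c \<noteq> 8"
        proof
          assume "c = 8"
          moreover from this have "b = 8" using ch(2) b8 by (simp add: dvd_antisym)
          ultimately show False using case8 d e f by simp
        qed
        ultimately show ?thesis using product22_RC[OF pos(1,2)] d e f g ch(7) by simp
      qed
    next
      assume f: "f = 2"
      then have b4: "b dvd 4" and d: "d = 2" using bd d by auto
      have "c = 2 \<or> b = 4 \<and> c = 4"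
        using dvd_4[OF b4] dvd_4[OF dvd_trans[OF ch(2) b4]] even(3)[OF e] ch(2) by auto
      then show ?thesis
        using product22_RE[OF pos(1,2)] product22_BC[OF pos(1) even(1)[OF e]] d e f g ch(7) by auto
    qed
  qed (rule e1)
qed

text \<open>As \<open>e\<close> divides \<open>d\<close>, it divides both 3 and 2. The pairs CD and
  DE end in the same clash of coprime divisors.\<close>

lemma extension_BD:
  assumes ext: "extension_type [2 * l, 2, 2] [3, 3, 3] [a, b, c, d, e, f, g, h]"
  shows "product22 [a, b, c, d, e, f, g, h]"
proof -
  note ch = ext_chain[OF ext] and pos = ext_pos[OF ext] and e1 = product22_of_e[OF ext]
  have d3: "d dvd 3" using ext_dvd[OF ext, of 1 3 3 0] by simp
  have e2: "e dvd 2" using ext_dvd[OF ext, of 2 1 1 3] by simp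
  show ?thesis using dvd_3[OF d3] dvd_2[OF e2] ch e1 by auto
qed

lemma extension_BE:
  assumes ext: "extension_type [2 * l, 2, 2] [2, 2, 2, 2] [a, b, c, d, e, f, g, h]"
  shows "product22 [a, b, c, d, e, f, g, h]"
proof -
  note ch = ext_chain[OF ext] and pos = ext_pos[OF ext] and e1 = product22_of_e[OF ext]
  have h: "h = 1" using ext_dvd[OF ext, of 1 3 1 4] by simp
  have d2: "d dvd 2" using ext_dvd[OF ext, of 1 3 2 0] by simp
  have b4: "b dvd 4" using ext_dvd[OF ext, of 2 1 2 0] by simp
  have e2: "e dvd 2" and f2: "f dvd 2" and g2: "g dvd 2" using ch(4-6) d2 by (metis dvd_trans)+
  have even: "2 dvd a" "2 dvd b" "2 dvd c" if "e = 2" using that ch by (metis dvd_trans)+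
  \<comment> \<open>Seven even factors match 3 + 4. Since 2K is trivial here, 2G is isomorphic to
    the cyclic group 2H.\<close>
  have b2: "b dvd 2" if "g = 2"
  proof -
    have "f = 2" "e = 2" "d = 2" using that ch(4-6) d2 e2 f2 by (metis dvd_antisym dvd_trans)+
    then show ?thesis using ext_dvd_even[OF ext, of 1 1 1 0] that even by simp
  qed
  show ?thesis
  proof (cases "e = 1")
    case False
    then have e: "e = 2" and d: "d = 2" using dvd_2[OF e2] dvd_2[OF d2] ch(4) by auto
    have bc: "c = 2 \<or> b = 4 \<and> c = 4"
      using dvd_4[OF b4] dvd_4[OF dvd_trans[OF ch(2) b4]] even(3)[OF e] ch(2) by auto
    consider "f = 1" "g = 1" | "f = 2" "g = 1" | "f = 2" "g = 2" using dvd_2[OF f2] dvd_2[OF g2] ch(6) by auto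
    then show ?thesis
    proof cases
      case 1
      then show ?thesis using product22_RB[OF pos(1-3) even(3)[OF e]] d e h by simp
    next
      case 2
      then show ?thesis using bc product22_RE[OF pos(1,2)] product22_BC[OF pos(1) even(1)[OF e]] d e h by auto
    next
      case 3
      then have "b = 2" "c = 2" using dvd_2[OF b2] even(2)[OF e] bc by auto
      then show ?thesis using 3 product22_BE[OF pos(1) even(1)[OF e]] d e h by simp
    qed
  qed (rule e1)
qed

lemma extension_CC:
  assumes ext: "extension_type [4, 4, 2] [4, 4, 2] [a, b, c, d, e, f, g, h]"
  shows "product22 [a, b, c, d, e, f, g, h] \<or> [a, b, c, d, e, f, g, h] = [4, 4, 4, 4, 4, 1, 1, 1]"
proof -
  note ch = ext_chain[OF ext] and pos = ext_pos[OF ext] and e1 = product22_of_e[OF ext]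
  have g: "g = 1" using ext_dvd[OF ext, of 1 3 1 3] by simp
  have f2: "f dvd 2" using ext_dvd[OF ext, of 2 2 1 3] by simp
  have d4: "d dvd 4" using ext_dvd[OF ext, of 4 0 1 3] by simp
  have c8: "c dvd 8" using ext_dvd[OF ext, of 4 0 2 2] by simp
  have a16: "a dvd 16" using ext_dvd[OF ext, of 4 0 4 0] by simp
  have b16: "b dvd 16" and e4: "e dvd 4" using ch(1,4) a16 d4 by (metis dvd_trans)+
  \<comment> \<open>Now 2G is an extension of (Z/2)^2 by (Z/2)^2: it has at most four generators,
    and 2(2G) at most two.\<close>
  have ec: "e dvd 2 \<and> c dvd 4" if "f = 2"
  proof -
    have "2 dvd e" "2 dvd d" "2 dvd c" "2 dvd b" "2 dvd a" using that ch by (metis dvd_trans)+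
    then show ?thesis using ext_dvd_even[OF ext, of 1 2 1 2] ext_dvd_even[OF ext, of 2 0 1 2] that by simp
  qed
  have h: "h = 1" using g ch(7) by simp
  have prod: "a * b * c * d * e * f = 1024" using ext_prod[OF ext] g h by simp
  note a = dvd_16[OF a16] and b = dvd_16[OF b16] and c = dvd_8[OF c8] and d = dvd_4[OF d4] and e = dvd_4[OF e4]
  show ?thesis
  proof (cases "e = 1")
    case False
    from dvd_2[OF f2] show ?thesis
    proof
      assume f: "f = 1"
      have "e = 2 \<and> d = 2 \<or> e = 2 \<and> d = 4 \<or> e = 4 \<and> d = 4" using e d False ch(4) by auto
      then show ?thesis
      proof (elim disjE conjE)
        assume "e = 2" "d = 2"
        moreover from this have "even c" using ch(3) by simp
        ultimately show ?thesis using product22_RB[OF pos(1-3)] f g h by simp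
      next
        assume de: "e = 2" "d = 4"
        then have c: "c = 4 \<or> c = 8" using c ch(3) by auto
        \<comment> \<open>\<open>c = 8\<close> would make \<open>a\<close> and \<open>b\<close>
          multiples of 8, but the order leaves only 16 for \<open>a * b\<close>.\<close>
        have "c \<noteq> 8"
        proof
          assume "c = 8"
          then have "8 dvd b" "8 dvd a" using ch(1,2) by (metis dvd_trans)+
          then have "8 \<le> b" "8 \<le> a" using pos(1,2) by (auto intro: dvd_imp_le)
          then have "8 * 8 \<le> a * b" by (rule mult_le_mono[rotated])
          moreover have "a * b * 64 = 1024" using prod \<open>c = 8\<close> de f by simp
          ultimately show False by linarith
        qed
        then show ?thesis using c product22_RC[OF pos(1,2)] de f g h by simp
      next
        \<comment> \<open>The origin of the exception: five factors divisible by 4 in a group of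
          order 4^5 must all equal 4.\<close>
        assume de: "e = 4" "d = 4"
        then have "4 dvd c" "4 dvd b" "4 dvd a" using ch(1-3) by (metis dvd_trans)+
        then have "c = 4 \<or> c = 8" "b = 4 \<or> b = 8 \<or> b = 16" "a = 4 \<or> a = 8 \<or> a = 16" using a b c by auto
        moreover have "a * b * c = 64" using prod de f by simp
        ultimately have "a = 4 \<and> b = 4 \<and> c = 4" by (elim disjE) simp_all
        then show ?thesis using de f g h by simp
      qed
    next
      assume f: "f = 2"
      then have "2 dvd e" "2 dvd d" "2 dvd c" using ch(3-5) by (metis dvd_trans)+
      then have e: "e = 2" and c: "c = 2 \<or> c = 4" using ec[OF f] dvd_2[of e] dvd_4[of c] by auto
      show ?thesis using c
      proof
        assume "c = 2"
        moreover from this have "d = 2" using ch(3) \<open>2 dvd d\<close> by (simp add: dvd_antisym)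
        ultimately show ?thesis using product22_RE[OF pos(1,2)] e f g h by simp
      next
        assume c: "c = 4"
        then have "4 dvd b" "4 dvd a" using ch(1,2) by (metis dvd_trans)+
        then have ab: "b = 4 \<or> b = 8 \<or> b = 16" "a = 4 \<or> a = 8 \<or> a = 16" using a b by auto
        have "d = 2 \<or> d = 4" using d \<open>2 dvd d\<close> by auto
        then show ?thesis
        proof
          assume d: "d = 2"
          then have "a * b = 32" using prod c e f by simp
          then have "b = 4 \<and> a = 8" using ab ch(1) by (elim disjE) simp_all
          then show ?thesis using product22_BC[of 8] c d e f g h by simp
        next
          assume d: "d = 4"
          then have "a * b = 16" using prod c e f by simp
          then have "b = 4 \<and> a = 4" using ab by (elim disjE) simp_all
          then show ?thesis using product22_CC c d e f g h by simp
        qed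
      qed
    qed
  qed (use e1 in blast)
qed

lemma extension_CD:
  assumes ext: "extension_type [4, 4, 2] [3, 3, 3] [a, b, c, d, e, f, g, h]"
  shows "product22 [a, b, c, d, e, f, g, h]"
proof -
  note ch = ext_chain[OF ext] and pos = ext_pos[OF ext] and e1 = product22_of_e[OF ext]
  have d3: "d dvd 3" using ext_dvd[OF ext, of 1 3 3 0] by simp
  have d4: "d dvd 4" using ext_dvd[OF ext, of 4 0 1 3] by simp
  show ?thesis using dvd_3[OF d3] dvd_4[OF d4] ch e1 by auto
qed

lemma extension_CE:
  assumes ext: "extension_type [4, 4, 2] [2, 2, 2, 2] [a, b, c, d, e, f, g, h]"
  shows "product22 [a, b, c, d, e, f, g, h]"
proof -
  note ch = ext_chain[OF ext] and pos = ext_pos[OF ext] and e1 = product22_of_e[OF ext]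
  have h: "h = 1" using ext_dvd[OF ext, of 1 3 1 4] by simp
  have d2: "d dvd 2" using ext_dvd[OF ext, of 1 3 2 0] by simp
  have c4: "c dvd 4" using ext_dvd[OF ext, of 2 2 2 0] by simp
  have a8: "a dvd 8" using ext_dvd[OF ext, of 4 0 2 0] by simp
  have e2: "e dvd 2" and f2: "f dvd 2" and g2: "g dvd 2" and b8: "b dvd 8"
    using ch(1,4-6) d2 a8 by (metis dvd_trans)+
  have even: "2 dvd a" "2 dvd b" "2 dvd c" if "e = 2" using that ch by (metis dvd_trans)+
  \<comment> \<open>Again 2K is trivial, so 2G is isomorphic to 2H = (Z/2)^2.\<close>
  have ca: "c dvd 2 \<and> a dvd 4" if "g = 2"
  proof -
    have "f = 2" "e = 2" "d = 2" using that ch(4-6) d2 e2 f2 by (metis dvd_antisym dvd_trans)+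
    then show ?thesis
      using ext_dvd_even[OF ext, of 1 2 1 0] ext_dvd_even[OF ext, of 2 0 1 0] that even by simp
  qed
  have prod: "a * b * c * d * e * f * g = 512" using ext_prod[OF ext] h by simp
  show ?thesis
  proof (cases "e = 1")
    case False
    then have e: "e = 2" and d: "d = 2" using dvd_2[OF e2] dvd_2[OF d2] ch(4) by auto
    have c: "c = 2 \<or> c = 4" using dvd_4[OF c4] even(3)[OF e] by auto
    have ab: "b = 2 \<or> b = 4 \<or> b = 8" "a = 2 \<or> a = 4 \<or> a = 8"
      using dvd_8[OF a8] dvd_8[OF b8] even[OF e] by auto
    consider "f = 1" "g = 1" | "f = 2" "g = 1" | "f = 2" "g = 2" using dvd_2[OF f2] dvd_2[OF g2] ch(6) by auto
    then show ?thesis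
    proof cases
      case 1
      then show ?thesis using product22_RB[OF pos(1-3) even(3)[OF e]] d e h by simp
    next
      case 2
      show ?thesis using c
      proof
        assume c: "c = 4"
        then have "a * b = 16" using prod d e 2 by simp
        then have "b = 4 \<and> a = 4" using ab ch(1,2) c by (elim disjE) simp_all
        then show ?thesis using product22_BC[of 4] 2 c d e h by simp
      qed (use product22_RE[OF pos(1,2)] 2 d e h in simp)
    next
      case 3
      then have c: "c = 2" and a: "a = 2 \<or> a = 4"
        using dvd_2[of c] dvd_4[of a] ca even[OF e] by auto
      have "a * b = 16" using prod c d e 3 by simp
      then have "b = 4 \<and> a = 4" using ab(1) a ch(1) by (elim disjE) simp_all
      then show ?thesis using product22_CE 3 c d e h by simp
    qed
  qed (rule e1)
qed

text \<open>Here the order 3^6 and the exponent at most 9 do the work of the sharper bound. With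
  five factors, \<open>c = 9\<close> would give \<open>a * b * c\<close> the value 729 instead of
  81; with six, all factors must equal 3.\<close>

lemma extension_DD:
  assumes ext: "extension_type [3, 3, 3] [3, 3, 3] [a, b, c, d, e, f, g, h]"
  shows "product22 [a, b, c, d, e, f, g, h]"
proof -
  note ch = ext_chain[OF ext] and pos = ext_pos[OF ext] and e1 = product22_of_e[OF ext]
  have g: "g = 1" using ext_dvd[OF ext, of 1 3 1 3] by simp
  have d3: "d dvd 3" using ext_dvd[OF ext, of 3 0 1 3] by simp
  have a9: "a dvd 9" using ext_dvd[OF ext, of 3 0 3 0] by simp
  have b9: "b dvd 9" and c9: "c dvd 9" and e3: "e dvd 3" and f3: "f dvd 3"
    using ch(1,2,4,5) a9 d3 by (metis dvd_trans)+
  have h: "h = 1" using g ch(7) by simp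
  have prod: "a * b * c * d * e * f = 729" using ext_prod[OF ext] g h by simp
  show ?thesis
  proof (cases "e = 1")
    case False
    then have e: "e = 3" and d: "d = 3" using dvd_3[OF e3] dvd_3[OF d3] ch(4) by auto
    then have "3 dvd c" "3 dvd b" "3 dvd a" using ch(1-3) by (metis dvd_trans)+
    then have abc: "c = 3 \<or> c = 9" "b = 3 \<or> b = 9" "a = 3 \<or> a = 9"
      using dvd_9[OF a9] dvd_9[OF b9] dvd_9[OF c9] by auto
    from dvd_3[OF f3] show ?thesis
    proof
      assume f: "f = 1"
      then have "a * b * c = 81" using prod d e by simp
      then have "c = 3" using abc ch(1,2) by (elim disjE) simp_all
      then show ?thesis using product22_RD[OF pos(1,2)] d e f g h by simp
    next
      assume f: "f = 3"
      then have "a * b * c = 27" using prod d e by simp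
      then have "a = 3 \<and> b = 3 \<and> c = 3" using abc by (elim disjE) simp_all
      then show ?thesis using product22_DD d e f g h by simp
    qed
  qed (rule e1)
qed

lemma extension_DE:
  assumes ext: "extension_type [3, 3, 3] [2, 2, 2, 2] [a, b, c, d, e, f, g, h]"
  shows "product22 [a, b, c, d, e, f, g, h]"
proof -
  note ch = ext_chain[OF ext] and pos = ext_pos[OF ext] and e1 = product22_of_e[OF ext]
  have d2: "d dvd 2" using ext_dvd[OF ext, of 1 3 2 0] by simp
  have e3: "e dvd 3" using ext_dvd[OF ext, of 3 0 1 4] by simp
  show ?thesis using dvd_2[OF d2] dvd_3[OF e3] ch e1 by auto
qed

text \<open>All factors divide 4, those from \<open>e\<close> on divide 2, and the order is 2^8. So
  each further nontrivial factor after \<open>e\<close> forces one more of \<open>d\<close>,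
  \<open>c\<close>, \<open>b\<close>, \<open>a\<close> down to 2.\<close>

lemma extension_EE:
  assumes ext: "extension_type [2, 2, 2, 2] [2, 2, 2, 2] [a, b, c, d, e, f, g, h]"
  shows "product22 [a, b, c, d, e, f, g, h]"
proof -
  note ch = ext_chain[OF ext] and pos = ext_pos[OF ext] and e1 = product22_of_e[OF ext]
  have e2: "e dvd 2" using ext_dvd[OF ext, of 1 4 2 0] by simp
  have a4: "a dvd 4" using ext_dvd[OF ext, of 2 0 2 0] by simp
  have b4: "b dvd 4" and c4: "c dvd 4" and d4: "d dvd 4" and f2: "f dvd 2" and g2: "g dvd 2" and h2: "h dvd 2"
    using ch a4 e2 by (metis dvd_trans)+
  have prod: "a * b * c * d * e * f * g * h = 256" using ext_prod[OF ext] by simp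
  show ?thesis
  proof (cases "e = 1")
    case False
    then have e: "e = 2" using dvd_2[OF e2] by simp
    have even: "2 dvd a" "2 dvd b" "2 dvd c" "2 dvd d" using e ch by (metis dvd_trans)+
    have abcd: "a = 2 \<or> a = 4" "b = 2 \<or> b = 4" "c = 2 \<or> c = 4" "d = 2 \<or> d = 4"
      using dvd_4[OF a4] dvd_4[OF b4] dvd_4[OF c4] dvd_4[OF d4] even by auto
    consider "f = 1" "g = 1" "h = 1" | "f = 2" "g = 1" "h = 1" | "f = 2" "g = 2" "h = 1" | "f = 2" "g = 2" "h = 2"
    proof -
      have "h = 2 \<Longrightarrow> g = 2" "g = 2 \<Longrightarrow> f = 2" using ch(6,7) dvd_2[OF g2] dvd_2[OF f2] by auto
      then show thesis using that dvd_2[OF f2] dvd_2[OF g2] dvd_2[OF h2] by metis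
    qed
    then show ?thesis
    proof cases
      case 1
      then have "a * b * c * d = 128" using prod e by simp
      then have "d = 2" using abcd ch(1-3) by (elim disjE) simp_all
      then show ?thesis using product22_RB[OF pos(1-3) even(3)] 1 e by simp
    next
      case 2
      then have "a * b * c * d = 64" using prod e by simp
      then have "d = 2 \<and> c = 2" using abcd ch(1-3) by (elim disjE) simp_all
      then show ?thesis using product22_RE[OF pos(1,2)] 2 e by simp
    next
      case 3
      then have "a * b * c * d = 32" using prod e by simp
      then have "d = 2 \<and> c = 2 \<and> b = 2" using abcd ch(1-3) by (elim disjE) simp_all
      then show ?thesis using product22_BE[OF pos(1) even(1)] 3 e by simp
    next
      case 4
      then have "a * b * c * d = 16" using prod e by simp
      then have "d = 2 \<and> c = 2 \<and> b = 2 \<and> a = 2" using abcd by (elim disjE) simp_all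
      then show ?thesis using product22_EE 4 e by simp
    qed
  qed (rule e1)
qed

theorem extension_type_factors2:
  assumes hs: "hs \<in> factors2" and ks: "ks \<in> factors2" and ext: "extension_type hs ks [a, b, c, d, e, f, g, h]"
  shows "product22 [a, b, c, d, e, f, g, h] \<or> [a, b, c, d, e, f, g, h] = [4, 4, 4, 4, 4, 1, 1, 1]"
proof -
  have cases: "(\<exists>k m. xs = [k, m]) \<or> (\<exists>l. xs = [2 * l, 2, 2]) \<or> xs = [4, 4, 2] \<or> xs = [3, 3, 3] \<or>
      xs = [2, 2, 2, 2]" if "xs \<in> factors2" for xs
    using that by (auto simp: factors2_def)
  note thms = extension_RR extension_RB extension_RC extension_RD extension_RE extension_BB extension_BC
    extension_BD extension_BE extension_CC extension_CD extension_CE extension_DD extension_DE extension_EE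
  show ?thesis using cases[OF hs] cases[OF ks] ext extension_type_commute[OF ext]
    by (elim disjE exE; hypsubst) (blast dest: thms)+
qed

text \<open>Padding to eight factors allows the same bounds to be reused. Two cyclic groups leave at
  most two nontrivial factors. A cyclic group with (Z/2)^2 leaves at most three, and if there are
  three the last two equal 2. For two copies of (Z/2)^2 the order 16 decides.\<close>

theorem extension_type_factors1:
  assumes hs: "hs \<in> factors1" and ks: "ks \<in> factors1" and ext: "extension_type hs ks [a, b, c, d, e, f, g, h]"
  shows "\<exists>xs \<in> factors2. same_factors [a, b, c, d, e, f, g, h] xs"
proof -
  have rank2: "\<exists>xs \<in> factors2. same_factors [a, b, c, d, e, f, g, h] xs"
    if ext: "extension_type hs ks [a, b, c, d, e, f, g, h]" "c = 1" for hs ks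
    using ext_chain[OF ext(1)] ext_pos[OF ext(1)] ext(2)
    by (intro bexI[of _ "[a, b]"]) (auto simp: factors2_def same_factors_def)
  have rank3: "\<exists>xs \<in> factors2. same_factors [a, b, c, d, e, f, g, h] xs"
    if ext: "extension_type hs ks [a, b, c, d, e, f, g, h]" "b = 2" "c = 2" "d = 1" for hs ks
  proof -
    obtain k where "a = 2 * k" using ext_chain(1)[OF ext(1)] ext(2) by auto
    then show ?thesis using ext_chain[OF ext(1)] ext_pos[OF ext(1)] ext(2-4)
      by (intro bexI[of _ "[a, 2, 2]"]) (auto simp: factors2_def same_factors_def)
  qed
  have mixed: "\<exists>xs \<in> factors2. same_factors [a, b, c, d, e, f, g, h] xs"
    if ext: "extension_type [k] [2, 2] [a, b, c, d, e, f, g, h]" for k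
  proof -
    have d: "d = 1" using ext_dvd[OF ext, of 1 1 1 2] by simp
    have b2: "b dvd 2" using ext_dvd[OF ext, of 1 1 2 0] by simp
    have "c = 1 \<or> b = 2 \<and> c = 2"
      using dvd_2[OF b2] dvd_2[OF dvd_trans[OF ext_chain(2)[OF ext] b2]] ext_chain(2)[OF ext] by auto
    then show ?thesis using rank2[OF ext] rank3[OF ext] d by blast
  qed
  consider (CC) k m where "hs = [k]" "ks = [m]" | (CV) k where "hs = [k]" "ks = [2, 2]"
    | (VC) k where "hs = [2, 2]" "ks = [k]" | (VV) "hs = [2, 2]" "ks = [2, 2]"
    using hs ks by (auto simp: factors1_def)
  then show ?thesis
  proof cases
    case CC
    then show ?thesis using ext_dvd[OF ext, of 1 1 1 1] by (intro rank2[OF ext]) simp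
  next
    case CV
    then show ?thesis using mixed ext by simp
  next
    case VC
    then show ?thesis using mixed extension_type_commute[OF ext] by simp
  next
    case VV
    note ext = ext[unfolded VV]
    note ch = ext_chain[OF ext]
    have e: "e = 1" using ext_dvd[OF ext, of 1 2 1 2] by simp
    have c2: "c dvd 2" using ext_dvd[OF ext, of 1 2 2 0] by simp
    have a4: "a dvd 4" using ext_dvd[OF ext, of 2 0 2 0] by simp
    have b4: "b dvd 4" and d2: "d dvd 2" using a4 c2 ch by (metis dvd_trans)+
    have fgh: "f = 1" "g = 1" "h = 1" using e ch by simp_all
    have prod: "a * b * c * d = 16" using ext_prod[OF ext] e fgh by simp
    show ?thesis
    proof (cases "c = 1")
      case False
      then have c: "c = 2" using dvd_2[OF c2] by simp
      then have "2 dvd b" "2 dvd a" using ch(1,2) by (metis dvd_trans)+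
      then have ab: "b = 2 \<or> b = 4" "a = 2 \<or> a = 4" using dvd_4[OF a4] dvd_4[OF b4] by auto
      from dvd_2[OF d2] show ?thesis
      proof
        assume d: "d = 1"
        then have "a * b = 8" using prod c by simp
        then have "b = 2" using ab ch(1) by (elim disjE) simp_all
        then show ?thesis using rank3[OF ext] c d by simp
      next
        assume d: "d = 2"
        then have "a * b = 4" using prod c by simp
        then have "a = 2 \<and> b = 2" using ab by (elim disjE) simp_all
        then show ?thesis using c d e fgh
          by (intro bexI[of _ "[2, 2, 2, 2]"]) (auto simp: factors2_def same_factors_def)
      qed
    qed (use rank2[OF ext] in simp)
  qed
qed

section \<open>From the numerical classification back to groups\<close>

lemma same_factors_iso:
  assumes eq: "same_factors ms ns" and ms: "0 \<notin> set ms" and ns: "0 \<notin> set ns"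
  shows "cyclic_product ms \<cong> cyclic_product ns"
proof -
  let ?f = "filter (\<lambda>n. n \<noteq> (1 :: nat))"
  have "mset (?f ns) = mset (?f ms)" using eq by (simp add: same_factors_def)
  then have "cyclic_product (?f ms) \<cong> cyclic_product (?f ns)"
    by (rule cyclic_product_mset_iso) (use ms in simp)
  moreover have "cyclic_product (?f ns) \<cong> cyclic_product ns"
    by (rule group.iso_sym[OF group_cyclic_product cyclic_product_filter_iso[OF ns]])
  ultimately show ?thesis using cyclic_product_filter_iso[OF ms] is_iso_trans by blast
qed

lemma factors1_pos: "xs \<in> factors1 \<Longrightarrow> 0 \<notin> set xs"
  by (auto simp: factors1_def)

lemma factors2_pos: "xs \<in> factors2 \<Longrightarrow> 0 \<notin> set xs"
  by (auto simp: factors2_def)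

lemma (in finite_abelian_extension) extension_type_length_8:
  assumes hs: "0 \<notin> set hs" "cyclic_product hs \<cong> H" "length hs \<le> 4"
    and ks: "0 \<notin> set ks" "cyclic_product ks \<cong> K" "length ks \<le> 4"
  obtains a b c d e f' g' h where "extension_type hs ks [a, b, c, d, e, f', g', h]"
    "cyclic_product [a, b, c, d, e, f', g', h] \<cong> G"
proof -
  obtain ns where n1: "\<forall>n \<in> set ns. n > 1" and ns: "divisor_chain ns" "cyclic_product ns \<cong> G"
    using finite_comm_group_iso_cyclic_product[OF G.comm_group_axioms finite_G] by blast
  have n0: "0 \<notin> set ns" using n1 by auto
  have ext: "extension_type hs ks ns" by (rule extension_type[OF hs(1,2) ks(1,2) n0 ns])
  have "length ns \<le> 8"
  proof (rule ccontr)
    assume len: "\<not> length ns \<le> 8"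
    have "num_not_dvd hs 1 \<le> 4" "num_not_dvd ks 1 \<le> 4"
      using hs(3) ks(3) length_filter_le le_trans by blast+
    \<comment> \<open>Index 8 is the ninth invariant factor. Trivial factors were excluded from
      \<open>ns\<close>, so it cannot divide 1.\<close>
    then have "ns ! (4 + 4) dvd 1 * 1" by (rule extension_type_dvd[OF ext]) (use len in simp)
    moreover have "ns ! 8 > 1" using n1 len by simp
    ultimately show False by simp
  qed
  define ms where "ms = ns @ replicate (8 - length ns) 1"
  have len: "length ms = 8" using \<open>length ns \<le> 8\<close> by (simp add: ms_def)
  have ext': "extension_type hs ks ms" unfolding ms_def by (rule extension_type_append_ones[OF ext])
  have iso: "cyclic_product ms \<cong> G"
    unfolding ms_def by (rule is_iso_trans[OF cyclic_product_append_ones_iso[OF n0] ns(2)])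
  obtain a b c d e f' g' h where "ms = [a, b, c, d, e, f', g', h]"
    using len by (auto simp: length_Suc_conv numeral_eq_Suc)
  then show thesis using that ext' iso by blast
qed

lemma (in finite_abelian_extension) iso_factors2:
  assumes hs: "hs \<in> factors1" "cyclic_product hs \<cong> H" and ks: "ks \<in> factors1" "cyclic_product ks \<cong> K"
  shows "\<exists>xs \<in> factors2. cyclic_product xs \<cong> G"
proof -
  have len: "length xs \<le> 4" if "xs \<in> factors1" for xs using that by (auto simp: factors1_def)
  obtain a b c d e f' g' h where ext: "extension_type hs ks [a, b, c, d, e, f', g', h]"
    and iso: "cyclic_product [a, b, c, d, e, f', g', h] \<cong> G"
    using extension_type_length_8[OF factors1_pos[OF hs(1)] hs(2) len[OF hs(1)]
        factors1_pos[OF ks(1)] ks(2) len[OF ks(1)]] by blast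
  obtain xs where xs: "xs \<in> factors2" "same_factors [a, b, c, d, e, f', g', h] xs"
    using extension_type_factors1[OF hs(1) ks(1) ext] by blast
  have "cyclic_product [a, b, c, d, e, f', g', h] \<cong> cyclic_product xs"
    by (rule same_factors_iso[OF xs(2) extension_typeD(1)[OF ext] factors2_pos[OF xs(1)]])
  then have "cyclic_product xs \<cong> cyclic_product [a, b, c, d, e, f', g', h]"
    by (rule group.iso_sym[OF group_cyclic_product])
  then show ?thesis using xs(1) is_iso_trans[OF _ iso] by blast
qed

lemma (in finite_abelian_extension) iso_product_factors2:
  assumes hs: "hs \<in> factors2" "cyclic_product hs \<cong> H" and ks: "ks \<in> factors2" "cyclic_product ks \<cong> K"
  shows "(\<exists>xs \<in> factors2. \<exists>ys \<in> factors2. cyclic_product (xs @ ys) \<cong> G) \<or> cyclic_product [4, 4, 4, 4, 4] \<cong> G"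
proof -
  have len: "length xs \<le> 4" if "xs \<in> factors2" for xs using that by (auto simp: factors2_def)
  obtain a b c d e f' g' h where ext: "extension_type hs ks [a, b, c, d, e, f', g', h]"
    and iso: "cyclic_product [a, b, c, d, e, f', g', h] \<cong> G"
    using extension_type_length_8[OF factors2_pos[OF hs(1)] hs(2) len[OF hs(1)]
        factors2_pos[OF ks(1)] ks(2) len[OF ks(1)]] by blast
  have trans: "cyclic_product ms \<cong> G" if "same_factors [a, b, c, d, e, f', g', h] ms" "0 \<notin> set ms" for ms
    using same_factors_iso[OF that(1) extension_typeD(1)[OF ext] that(2)] iso
    by (meson group.iso_sym group_cyclic_product is_iso_trans)
  from extension_type_factors2[OF hs(1) ks(1) ext] show ?thesis
  proof
    assume "product22 [a, b, c, d, e, f', g', h]"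
    then obtain xs ys where "xs \<in> factors2" "ys \<in> factors2" "same_factors [a, b, c, d, e, f', g', h] (xs @ ys)"
      unfolding product22_def by blast
    then show ?thesis using trans[of "xs @ ys"] factors2_pos by auto
  next
    assume "[a, b, c, d, e, f', g', h] = [4, 4, 4, 4, 4, 1, 1, 1]"
    then show ?thesis using trans[of "[4, 4, 4, 4, 4]"] by (simp add: same_factors_def)
  qed
qed

text \<open>\<open>L\<close> is the kernel of the composite from \<open>G\<close> through
  \<open>K\<close> to \<open>B\<close>, in other words the preimage of the factor \<open>A\<close>.
  It contains the image of \<open>f\<close>, maps onto \<open>A\<close> with kernel that image, and
  has quotient \<open>B\<close> in \<open>G\<close>; \<open>id\<close> is its inclusion.\<close>

lemma (in finite_abelian_extension) quotient_DirProd: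
  assumes iso: "K \<cong> A \<times>\<times> B" and "group A" "group B"
  obtains L p q where "finite_abelian_extension H (G\<lparr>carrier := L\<rparr>) A f p"
    "finite_abelian_extension (G\<lparr>carrier := L\<rparr>) G B id q"
proof -
  obtain \<phi> where \<phi>: "\<phi> \<in> iso K (A \<times>\<times> B)" using iso unfolding is_iso_def by blast
  interpret phi: group_hom K "A \<times>\<times> B" \<phi>
    by (rule iso_imp_group_hom[OF \<phi> g.H.group_axioms DirProd_group[OF assms(2,3)]])
  have surj: "\<phi> ` carrier K = carrier A \<times> carrier B" and inj: "inj_on \<phi> (carrier K)"
    using \<phi> by (auto simp: iso_def bij_betw_def)
  let ?p = "\<lambda>x. fst (\<phi> (g x))" and ?q = "\<lambda>x. snd (\<phi> (g x))"
  have img: "\<phi> (g x) \<in> carrier A \<times> carrier B" if "x \<in> carrier G" for x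
    using phi.hom_closed[OF g.hom_closed[OF that]] by simp
  have mult: "\<phi> (g (x \<otimes>\<^bsub>G\<^esub> y)) = (?p x \<otimes>\<^bsub>A\<^esub> ?p y, ?q x \<otimes>\<^bsub>B\<^esub> ?q y)" if "x \<in> carrier G" "y \<in> carrier G" for x y
    using that by (simp add: mult_DirProd')
  interpret q: group_hom G B ?q
    by (intro group_hom.intro group_hom_axioms.intro G.group_axioms assms homI)
      (use img mult in \<open>auto simp: mem_Times_iff\<close>)
  let ?L = "G\<lparr>carrier := kernel G B ?q\<rparr>"
  have subL: "subgroup (kernel G B ?q) G" by (rule q.subgroup_kernel)
  have cL: "comm_group ?L" by (rule G.comm_group_subgroup[OF subL])
  then have gL: "group ?L" by (rule comm_group.axioms)
  have Lc: "x \<in> kernel G B ?q \<longleftrightarrow> x \<in> carrier G \<and> ?q x = \<one>\<^bsub>B\<^esub>" for x by (simp add: kernel_def)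
  have gf: "g (f h) = \<one>\<^bsub>K\<^esub>" if "h \<in> carrier H" for h using exact that unfolding kernel_def by blast
  have lift: "\<exists>x \<in> carrier G. \<phi> (g x) = (u, v)" if "u \<in> carrier A" "v \<in> carrier B" for u v
  proof -
    have "(u, v) \<in> \<phi> ` g ` carrier G" unfolding surj_g surj using that by simp
    then show ?thesis by force
  qed
  have one: "\<phi> (g x) = (\<one>\<^bsub>A\<^esub>, \<one>\<^bsub>B\<^esub>) \<longleftrightarrow> g x = \<one>\<^bsub>K\<^esub>" if "x \<in> carrier G" for x
    using inj that phi.hom_one by (metis g.hom_closed g.H.one_closed inj_onD one_DirProd)
  have homp: "group_hom ?L A ?p"
    by (intro group_hom.intro group_hom_axioms.intro gL assms homI) (use img mult in \<open>auto simp: Lc mem_Times_iff\<close>)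
  have homf: "group_hom H ?L f"
    by (intro group_hom.intro group_hom_axioms.intro gL f.G.group_axioms homI)
      (auto simp: Lc gf)
  have 1: "finite_abelian_extension H ?L A f ?p"
  proof (intro finite_abelian_extension.intro finite_abelian_extension_axioms.intro cL homp homf inj_f)
    show "finite (carrier ?L)" using finite_G by (simp add: kernel_def)
    show "?p ` carrier ?L = carrier A"
    proof (intro equalityI subsetI)
      fix u assume "u \<in> carrier A"
      then obtain x where "x \<in> carrier G" "\<phi> (g x) = (u, \<one>\<^bsub>B\<^esub>)" using lift[of u "\<one>\<^bsub>B\<^esub>"] by auto
      then show "u \<in> ?p ` carrier ?L" by (intro image_eqI[of _ _ x]) (auto simp: Lc)
    qed (use img in \<open>auto simp: Lc mem_Times_iff\<close>)
    have "kernel ?L A ?p = {x \<in> carrier G. \<phi> (g x) = (\<one>\<^bsub>A\<^esub>, \<one>\<^bsub>B\<^esub>)}"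
      by (auto simp: kernel_def prod_eq_iff)
    also have "\<dots> = kernel G K g" using one by (auto simp: kernel_def)
    finally show "kernel ?L A ?p = f ` carrier H" using exact by simp
  qed
  have 2: "finite_abelian_extension ?L G B id ?q"
  proof (intro finite_abelian_extension.intro finite_abelian_extension_axioms.intro G.comm_group_axioms
      q.group_hom_axioms finite_G)
    show "group_hom ?L G id"
      by (intro group_hom.intro group_hom_axioms.intro gL G.group_axioms homI) (auto simp: Lc)
    show "?q ` carrier G = carrier B"
    proof (intro equalityI subsetI)
      fix v assume "v \<in> carrier B"
      then obtain x where "x \<in> carrier G" "\<phi> (g x) = (\<one>\<^bsub>A\<^esub>, v)"
        using lift[of "\<one>\<^bsub>A\<^esub>" v] group.is_monoid[OF assms(2)] monoid.one_closed by blast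
      then show "v \<in> ?q ` carrier G" by (intro image_eqI[of _ _ x]) auto
    qed auto
  qed auto
  show thesis by (rule that[OF 1 2])
qed

lemma (in finite_abelian_extension) iso_product_factors2_of_factors12:
  assumes hs: "hs \<in> factors1" "cyclic_product hs \<cong> H"
    and xs: "xs \<in> factors1" and ys: "ys \<in> factors2" and K: "cyclic_product (xs @ ys) \<cong> K"
  shows "(\<exists>xs \<in> factors2. \<exists>ys \<in> factors2. cyclic_product (xs @ ys) \<cong> G) \<or> cyclic_product [4, 4, 4, 4, 4] \<cong> G"
proof -
  have "K \<cong> cyclic_product (xs @ ys)" by (rule group.iso_sym[OF group_cyclic_product K])
  also have "cyclic_product (xs @ ys) \<cong> cyclic_product xs \<times>\<times> cyclic_product ys"
    by (rule group.iso_sym[OF DirProd_group cyclic_product_append_iso])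
      (use xs ys factors1_pos factors2_pos in auto)
  finally (is_iso_trans) have "K \<cong> cyclic_product xs \<times>\<times> cyclic_product ys" .
  then obtain L p q where L: "finite_abelian_extension H (G\<lparr>carrier := L\<rparr>) (cyclic_product xs) f p"
    "finite_abelian_extension (G\<lparr>carrier := L\<rparr>) G (cyclic_product ys) id q"
    by (rule quotient_DirProd) auto
  have refl: "cyclic_product zs \<cong> cyclic_product zs" for zs unfolding is_iso_def using id_iso by blast
  obtain zs where "zs \<in> factors2" "cyclic_product zs \<cong> G\<lparr>carrier := L\<rparr>"
    using finite_abelian_extension.iso_factors2[OF L(1) hs xs refl] by blast
  then show ?thesis using finite_abelian_extension.iso_product_factors2[OF L(2)] ys refl by blast
qed

section \<open>Isomorphism classes\<close>

lemma iso_class_cong: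
  assumes "G \<cong> H" "group G" "group H"
  shows "iso_class G = iso_class H"
proof -
  have HG: "H \<cong> G" by (rule group.iso_sym[OF assms(2,1)])
  have "N \<cong> G \<longleftrightarrow> N \<cong> H" for N :: "nat monoid"
    using is_iso_trans[OF _ assms(1), of N] is_iso_trans[OF _ HG, of N] by blast
  then show ?thesis by (simp add: iso_class_def)
qed

text \<open>Isomorphism classes contain only groups carried by natural numbers. A concrete group
  such as \<open>cyclic_product xs\<close> has to be replaced by such a copy before it can serve as
  a member.\<close>

lemma iso_imp_nat_copy:
  assumes "group G" "finite (carrier G)"
  obtains N :: "nat monoid" where "group N" "N \<cong> G"
proof -
  interpret G: group G by fact
  obtain h :: "'a \<Rightarrow> nat" where h: "inj_on h (carrier G)"
    using finite_imp_inj_to_nat_seg[OF assms(2)] by blast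
  let ?k = "inv_into (carrier G) h"
  let ?N = "\<lparr>carrier = h ` carrier G, monoid.mult = (\<lambda>a b. h (?k a \<otimes>\<^bsub>G\<^esub> ?k b)), one = h \<one>\<^bsub>G\<^esub>\<rparr> :: nat monoid"
  have k: "?k (h x) = x" if "x \<in> carrier G" for x using h that by simp
  have iso: "h \<in> iso G ?N"
    by (rule isoI) (use h in \<open>auto simp: hom_def bij_betw_def k\<close>)
  have N: "group ?N" using G.iso_imp_img_group[OF iso] by simp
  show thesis using that[OF N] G.iso_sym[OF is_isoI[OF iso]] by blast
qed

lemma DirProd_cyclic_product_iso:
  assumes "group G" "group H" "G \<cong> cyclic_product xs" "H \<cong> cyclic_product ys" "0 \<notin> set xs" "0 \<notin> set ys"
  shows "G \<times>\<times> H \<cong> cyclic_product (xs @ ys)"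
  using group.DirProd_iso_trans[OF assms(1,3,4)] cyclic_product_append_iso[OF assms(5,6)] is_iso_trans
  by blast

abbreviation cyclic_class :: "nat list \<Rightarrow> group_class" where
  "cyclic_class ns \<equiv> iso_class (cyclic_product ns)"

lemma Zmod_iso: "k \<ge> 1 \<Longrightarrow> Zmod k \<cong> cyclic_product [k]"
  by (rule cyclic_product_singleton_iso) simp

lemma Zmod_power_eq: "Zmod_power k r = cyclic_product (replicate r k)"
  by (simp add: cyclic_product_replicate)

lemma is_iso_refl: "G \<cong> G"
  unfolding is_iso_def using id_iso by blast

lemma rank1_list_eq: "rank1_list = cyclic_class ` factors1"
proof -
  have "iso_class (Zmod k) = cyclic_class [k]" if "k \<ge> 1" for k
    using iso_class_cong[OF Zmod_iso[OF that]] by simp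
  then have "{iso_class (Zmod k) |k. k \<ge> 1} = cyclic_class ` {[k] |k. k \<ge> 1}" by blast
  moreover have "Zmod_power 2 2 = cyclic_product [2, 2]" by (simp add: Zmod_power_eq numeral_2_eq_2)
  ultimately show ?thesis unfolding rank1_list_def factors1_def image_Un by simp
qed

lemma rank2_list_eq: "rank2_list = cyclic_class ` factors2"
proof -
  have pow: "Zmod_power 2 2 = cyclic_product [2, 2]" "Zmod_power 4 2 = cyclic_product [4, 4]"
    "Zmod_power 3 3 = cyclic_product [3, 3, 3]" "Zmod_power 2 4 = cyclic_product [2, 2, 2, 2]"
    by (simp_all add: Zmod_power_eq numeral_eq_Suc)
  have "iso_class (Zmod k \<times>\<times> Zmod m) = cyclic_class [k, m]" if "k \<ge> 1" "m \<ge> 1" for k m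
    using iso_class_cong[OF DirProd_cyclic_product_iso[OF _ _ Zmod_iso[OF that(1)] Zmod_iso[OF that(2)]]] that
    by (simp add: DirProd_group)
  then have 1: "{iso_class (Zmod k \<times>\<times> Zmod m) |k m. k \<ge> 1 \<and> m \<ge> 1} = cyclic_class ` {[k, m] |k m. k \<ge> 1 \<and> m \<ge> 1}"
    by blast
  have "iso_class (Zmod (2 * k) \<times>\<times> Zmod_power 2 2) = cyclic_class [2 * k, 2, 2]" if "k \<ge> 1" for k
    unfolding pow
    using iso_class_cong[OF DirProd_cyclic_product_iso[OF _ _ Zmod_iso[of "2 * k"] is_iso_refl[of "cyclic_product [2, 2]"]]] that
    by (simp add: DirProd_group)
  then have 2: "{iso_class (Zmod (2 * k) \<times>\<times> Zmod_power 2 2) |k. k \<ge> 1} = cyclic_class ` {[2 * k, 2, 2] |k. k \<ge> 1}"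
    by blast
  have 3: "iso_class (Zmod_power 4 2 \<times>\<times> Zmod 2) = cyclic_class [4, 4, 2]"
    unfolding pow
    using iso_class_cong[OF DirProd_cyclic_product_iso[OF _ _ is_iso_refl[of "cyclic_product [4, 4]"] Zmod_iso[of 2]]]
    by (simp add: DirProd_group)
  show ?thesis unfolding rank2_list_def factors2_def image_Un 1 2 3 by (simp add: pow(3,4))
qed

lemma mem_Union_cyclic_class:
  "N \<in> \<Union>(cyclic_class ` X) \<longleftrightarrow> (\<exists>xs \<in> X. group N \<and> N \<cong> cyclic_product xs)"
  by (auto simp: iso_class_def)

lemma nat_copy_cyclic_product:
  assumes "0 \<notin> set xs"
  obtains N :: "nat monoid" where "group N" "N \<cong> cyclic_product xs"
  using iso_imp_nat_copy[OF group_cyclic_product finite_cyclic_product[OF assms]] by blast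

text \<open>On lists of orders, the product of classes is concatenation. Positive entries keep the
  groups finite, so that natural number copies of both factors exist.\<close>

lemma class_times_cyclic:
  assumes X: "\<And>xs. xs \<in> X \<Longrightarrow> 0 \<notin> set xs" and Y: "\<And>ys. ys \<in> Y \<Longrightarrow> 0 \<notin> set ys"
  shows "(cyclic_class ` X) \<times>\<^sub>c (cyclic_class ` Y) = cyclic_class ` {xs @ ys |xs ys. xs \<in> X \<and> ys \<in> Y}"
proof (intro equalityI subsetI)
  have eq: "iso_class (H \<times>\<times> K) = cyclic_class (xs @ ys)"
    if "group H" "H \<cong> cyclic_product xs" "group K" "K \<cong> cyclic_product ys" "xs \<in> X" "ys \<in> Y"
    for H K :: "nat monoid" and xs ys
    using iso_class_cong[OF DirProd_cyclic_product_iso[OF that(1,3,2,4) X[OF that(5)] Y[OF that(6)]]] that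
    by (simp add: DirProd_group)
  {
    fix c assume "c \<in> (cyclic_class ` X) \<times>\<^sub>c (cyclic_class ` Y)"
    then show "c \<in> cyclic_class ` {xs @ ys |xs ys. xs \<in> X \<and> ys \<in> Y}"
      unfolding class_times_def mem_Union_cyclic_class using eq by blast
  next
    fix c assume "c \<in> cyclic_class ` {xs @ ys |xs ys. xs \<in> X \<and> ys \<in> Y}"
    then obtain xs ys where c: "c = cyclic_class (xs @ ys)" "xs \<in> X" "ys \<in> Y" by blast
    obtain H :: "nat monoid" where H: "group H" "H \<cong> cyclic_product xs"
      using nat_copy_cyclic_product[OF X[OF c(2)]] by blast
    obtain K :: "nat monoid" where K: "group K" "K \<cong> cyclic_product ys"
      using nat_copy_cyclic_product[OF Y[OF c(3)]] by blast
    show "c \<in> (cyclic_class ` X) \<times>\<^sub>c (cyclic_class ` Y)"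
      unfolding class_times_def mem_Union_cyclic_class
      using eq[OF H K c(2,3)] H K c by blast
  }
qed

text \<open>Here \<open>f\<close> is the surjection from \<open>G\<close> to \<open>K\<close> and
  \<open>g\<close> the injection from \<open>H\<close> to \<open>G\<close>, hence the swap of the
  two maps.\<close>

lemma short_exact_sequence_imp_extension:
  assumes "comm_group G" "finite (carrier G)" "short_exact_sequence K G H f g"
  shows "finite_abelian_extension H G K g f"
proof -
  have ses: "exact_seq ([K, G, H], [f, g])" "f \<in> epi G K" "g \<in> mon H G"
    using short_exact_sequenceD[OF assms(3)] by auto
  then show ?thesis using assms(1,2)
    by (intro finite_abelian_extension.intro finite_abelian_extension_axioms.intro)
      (auto simp: epi_def mon_def group_hom_def group_hom_axioms_def)
qed

text \<open>In \<open>class_ext\<close> all three groups are carried by natural numbers. An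
  extension of groups of other types is transported there by conjugating both maps with
  isomorphisms.\<close>

lemma class_ext_nat_copies:
  assumes ext: "finite_abelian_extension H G K f g"
    and hs: "hs \<in> X" "H \<cong> cyclic_product hs" and ks: "ks \<in> Y" "K \<cong> cyclic_product ks"
  shows "iso_class G \<in> (cyclic_class ` X) \<bullet>\<^sub>c (cyclic_class ` Y)"
proof -
  interpret finite_abelian_extension H G K f g by fact
  obtain NH :: "nat monoid" where NH: "group NH" "NH \<cong> H"
    using iso_imp_nat_copy[OF f.G.group_axioms finite_H] by blast
  obtain NG :: "nat monoid" where NG: "group NG" "NG \<cong> G"
    using iso_imp_nat_copy[OF G.group_axioms finite_G] by blast
  obtain NK :: "nat monoid" where NK: "group NK" "NK \<cong> K"
    using iso_imp_nat_copy[OF g.H.group_axioms finite_K] by blast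
  obtain u where u: "u \<in> iso NH H" using NH(2) unfolding is_iso_def by blast
  obtain v w where "group_isomorphisms NG G v w"
    using NG unfolding is_iso_def by (metis ex_in_conv group.iso_iff_group_isomorphisms)
  then have vw': "group_isomorphisms NG G v w" .
  have v: "v \<in> iso NG G" by (rule group_isomorphisms_imp_iso[OF vw'])
  have w: "w \<in> iso G NG" by (rule group_isomorphisms_imp_iso[OF group_isomorphisms_sym[OF vw']])
  have wv: "w (v x) = x" if "x \<in> carrier NG" for x using vw' that by (simp add: group_isomorphisms_def)
  have vw: "v (w x) = x" if "x \<in> carrier G" for x using vw' that by (simp add: group_isomorphisms_def)
  obtain t where t: "t \<in> iso K NK" using group.iso_sym[OF NK] unfolding is_iso_def by blast
  interpret u: group_hom NH H u by (rule iso_imp_group_hom[OF u NH(1) f.G.group_axioms])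
  interpret v: group_hom NG G v by (rule iso_imp_group_hom[OF v NG(1) G.group_axioms])
  interpret w: group_hom G NG w by (rule iso_imp_group_hom[OF w G.group_axioms NG(1)])
  interpret t: group_hom K NK t by (rule iso_imp_group_hom[OF t g.H.group_axioms NK(1)])
  have su: "u ` carrier NH = carrier H" and sv: "v ` carrier NG = carrier G" and st: "t ` carrier K = carrier NK"
    and iu: "inj_on u (carrier NH)" and iw: "inj_on w (carrier G)" and it: "inj_on t (carrier K)"
    using u v w t by (auto simp: iso_def bij_betw_def)
  have cNG: "comm_group NG" by (rule G.iso_imp_comm_group[OF group.iso_sym[OF NG] v.G.monoid_axioms])
  have fin: "finite (carrier NG)" using iso_finite[OF NG(2)] finite_G by simp
  let ?f = "\<lambda>x. w (f (u x))" and ?g = "\<lambda>x. t (g (v x))"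
  have hf: "?f \<in> hom NH NG" and hg: "?g \<in> hom NG NK" by (auto intro!: homI)
  have "kernel NG NK ?g = w ` kernel G K g"
  proof -
    have "t (g (v x)) = \<one>\<^bsub>NK\<^esub> \<longleftrightarrow> g (v x) = \<one>\<^bsub>K\<^esub>" if "x \<in> carrier NG" for x
      using that it by (metis g.H.one_closed g.hom_closed inj_onD t.hom_one v.hom_closed)
    then have "kernel NG NK ?g = {x \<in> carrier NG. v x \<in> kernel G K g}" by (auto simp: kernel_def)
    also have "\<dots> = w ` kernel G K g"
    proof (intro equalityI subsetI)
      fix x assume "x \<in> {x \<in> carrier NG. v x \<in> kernel G K g}"
      then show "x \<in> w ` kernel G K g" using wv by (intro image_eqI[of _ _ "v x"]) auto
    qed (use vw in \<open>auto simp: kernel_def\<close>)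
    finally show ?thesis .
  qed
  then have ker: "kernel NG NK ?g = ?f ` carrier NH" unfolding exact su[symmetric] image_image .
  have surj: "?g ` carrier NG = carrier NK"
    unfolding st[symmetric] surj_g[symmetric] sv[symmetric] image_image ..
  have inj: "inj_on ?f (carrier NH)"
    by (rule inj_onI) (metis f.hom_closed inj_f inj_onD iu iw u.hom_closed)
  have "exact_seq ([NK, NG, NH], [?g, ?f])"
    using hf hg ker NH NG NK by (simp add: group_hom_def group_hom_axioms_def)
  then have ses: "short_exact_sequence NK NG NH ?g ?f"
    unfolding short_exact_sequence_iff using hf hg surj inj by (simp add: epi_def mon_def)
  have "NH \<in> \<Union>(cyclic_class ` X)"
    unfolding mem_Union_cyclic_class using NH hs is_iso_trans by blast
  moreover have "NK \<in> \<Union>(cyclic_class ` Y)"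
    unfolding mem_Union_cyclic_class using NK ks is_iso_trans by blast
  moreover have "iso_class G = iso_class NG"
    by (rule iso_class_cong[symmetric, OF NG(2,1) G.group_axioms])
  ultimately show ?thesis unfolding class_ext_def using ses cNG fin by blast
qed

text \<open>The subgroup fills the first two coordinates and the even residues of the third. The
  quotient keeps the parity of the third coordinate and the last two coordinates, which explains the
  order \<open>[2, 4, 4]\<close>: the two factors Z/2 meet in the third Z/4.\<close>

lemma five_copies_of_Zmod4_extension:
  "finite_abelian_extension (cyclic_product [4, 4, 2]) (cyclic_product [4, 4, 4, 4, 4]) (cyclic_product [2, 4, 4])
    (\<lambda>x. \<lambda>i \<in> {..<5}. if i < 2 then x i else if i = 2 then 2 * x 2 else 0)
    (\<lambda>x. \<lambda>i \<in> {..<3}. if i = 0 then x 2 mod 2 else x (i + 2))"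
  (is "finite_abelian_extension ?H ?G ?K ?f ?g")
proof -
  have I: "{..<3 :: nat} = {0, 1, 2}" "{..<5 :: nat} = {0, 1, 2, 3, 4}"
    "{..<length [a, b, c]} = {0, 1, 2}" "{..<length [a, b, c, d, e]} = {0, 1, 2, 3, 4}" for a b c d e :: nat
    by auto
  have pos: "0 \<notin> set [4, 4, 2 :: nat]" "0 \<notin> set [2, 4, 4 :: nat]" "0 \<notin> set [4, 4, 4, 4, 4 :: nat]" by simp_all
  have H: "x \<in> carrier ?H \<longleftrightarrow> x \<in> extensional {0, 1, 2} \<and> x 0 \<in> {0..<4} \<and> x 1 \<in> {0..<4} \<and> x 2 \<in> {0..<2}" for x
    unfolding carrier_cyclic_product[OF pos(1)] I by (auto simp: PiE_iff)
  have K: "x \<in> carrier ?K \<longleftrightarrow> x \<in> extensional {0, 1, 2} \<and> x 0 \<in> {0..<2} \<and> x 1 \<in> {0..<4} \<and> x 2 \<in> {0..<4}" for x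
    unfolding carrier_cyclic_product[OF pos(2)] I by (auto simp: PiE_iff)
  have G: "x \<in> carrier ?G \<longleftrightarrow> x \<in> extensional {0, 1, 2, 3, 4} \<and> x 0 \<in> {0..<4} \<and> x 1 \<in> {0..<4} \<and> x 2 \<in> {0..<4} \<and>
      x 3 \<in> {0..<4} \<and> x 4 \<in> {0..<4}" for x
    unfolding carrier_cyclic_product[OF pos(3)] I by (auto simp: PiE_iff)
  have mult: "x \<otimes>\<^bsub>?H\<^esub> y = (\<lambda>i \<in> {0, 1, 2}. (x i + y i) mod int ([4, 4, 2] ! i))"
    "x \<otimes>\<^bsub>?K\<^esub> y = (\<lambda>i \<in> {0, 1, 2}. (x i + y i) mod int ([2, 4, 4] ! i))"
    "x \<otimes>\<^bsub>?G\<^esub> y = (\<lambda>i \<in> {0, 1, 2, 3, 4}. (x i + y i) mod int ([4, 4, 4, 4, 4] ! i))" for x y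
    unfolding mult_cyclic_product I by (rule refl)+
  have oneK: "\<one>\<^bsub>?K\<^esub> = (\<lambda>i \<in> {0, 1, 2}. 0)" unfolding one_cyclic_product I by (rule refl)
  have double: "2 * (a mod 2) = 2 * a mod 4" for a :: int by presburger
  have f: "group_hom ?H ?G ?f"
    unfolding I
    by (intro group_hom.intro group_hom_axioms.intro group_cyclic_product homI)
      (auto simp: H G mult fun_eq_iff double distrib_left)
  have g: "group_hom ?G ?K ?g"
    unfolding I
    by (intro group_hom.intro group_hom_axioms.intro group_cyclic_product homI)
      (auto simp: G K mult fun_eq_iff mod_add_eq mod_mod_cancel simp del: One_nat_def)
  show ?thesis
  proof (intro finite_abelian_extension.intro finite_abelian_extension_axioms.intro comm_group_cyclic_product f g)
    show "finite (carrier ?G)" by (rule finite_cyclic_product[OF pos(3)])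
    show "inj_on ?f (carrier ?H)"
    proof (rule inj_onI)
      fix x y assume xy: "x \<in> carrier ?H" "y \<in> carrier ?H" and eq: "?f x = ?f y"
      have "x i = y i" if "i \<in> {0, 1, 2}" for i
        using fun_cong[OF eq, of i] that by auto
      then show "x = y" using xy unfolding H by (intro extensionalityI[of x "{0, 1, 2}" y]) auto
    qed
    show "?g ` carrier ?G = carrier ?K"
    proof (intro equalityI subsetI)
      fix y assume y: "y \<in> carrier ?K"
      let ?z = "\<lambda>i \<in> {0, 1, 2, 3, 4}. if i < 2 then 0 else if i = 2 then y 0 else y (i - 2)"
      have eq: "y = ?g ?z"
        by (rule sym, rule extensionalityI[of _ "{0, 1, 2}"]) (use y in \<open>auto simp: I K\<close>)
      have mem: "?z \<in> carrier ?G" using y unfolding G K by auto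
      show "y \<in> ?g ` carrier ?G" by (rule image_eqI[where f = ?g and x = ?z]) (fact eq mem)+
    qed (use group_hom.hom_closed[OF g] in blast)
    show "kernel ?G ?K ?g = ?f ` carrier ?H"
    proof (intro equalityI subsetI)
      fix x assume "x \<in> kernel ?G ?K ?g"
      then have x: "x \<in> carrier ?G" and eq: "?g x = \<one>\<^bsub>?K\<^esub>" by (auto simp: kernel_def)
      have x0: "x 2 mod 2 = 0" "x 3 = 0" "x 4 = 0"
        using fun_cong[OF eq, of 0] fun_cong[OF eq, of 1] fun_cong[OF eq, of 2] unfolding oneK by (simp_all del: One_nat_def)
      let ?z = "\<lambda>i \<in> {0, 1, 2}. if i = 2 then x 2 div 2 else x i"
      have eq: "x = ?f ?z"
        by (rule sym, rule extensionalityI[of _ "{0, 1, 2, 3, 4}"]) (use x x0 in \<open>auto simp: I G\<close>)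
      have mem: "?z \<in> carrier ?H" using x unfolding G H by auto
      show "x \<in> ?f ` carrier ?H" by (rule image_eqI[where f = ?f and x = ?z]) (fact eq mem)+
    next
      fix x assume "x \<in> ?f ` carrier ?H"
      then obtain y where y: "y \<in> carrier ?H" "x = ?f y" by blast
      then show "x \<in> kernel ?G ?K ?g"
        using group_hom.hom_closed[OF f y(1)] by (auto simp: kernel_def oneK I)
    qed
  qed
qed

text \<open>Each even order contributes a factor 2 to the number of 2-torsion elements, and each
  order divisible by 4 one more factor 2 to the number of 4-torsion elements. These numbers are 2^5
  and 2^10.\<close>

lemma num_factors_of_iso_five_copies_of_Zmod4:
  assumes iso: "cyclic_product zs \<cong> cyclic_product [4, 4, 4, 4, 4]" and zs: "0 \<notin> set zs"
  shows "length (filter even zs) = 5" "length (filter (\<lambda>n. 4 dvd n) zs) = 5"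
proof -
  have tor: "(\<Prod>n \<leftarrow> zs. gcd m n) = (\<Prod>n \<leftarrow> [4, 4, 4, 4, 4]. gcd m n)" for m
    using card_torsion_iso[OF iso group_cyclic_product group_cyclic_product, of m]
      card_torsion_cyclic_product[OF zs, of m] card_torsion_cyclic_product[of "[4, 4, 4, 4, 4]" m] by simp
  have "gcd 4 n = (if even n then 2 else 1) * (if 4 dvd n then 2 else 1)" for n :: nat
  proof -
    have "n mod 4 = 0 \<or> n mod 4 = 1 \<or> n mod 4 = 2 \<or> n mod 4 = 3" by linarith
    moreover have "gcd 4 n = gcd 4 (n mod 4)" by (metis gcd.commute gcd_red_nat)
    moreover have "even n \<longleftrightarrow> even (n mod 4)" "4 dvd n \<longleftrightarrow> n mod 4 = 0" by presburger+
    ultimately show ?thesis by (elim disjE) (simp_all add: gcd_non_0_nat)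
  qed
  then have "(\<Prod>n \<leftarrow> zs. gcd 4 n) = 2 ^ num_even zs * 2 ^ length (filter (\<lambda>n. 4 dvd n) zs)"
    by (induction zs) auto
  moreover show "num_even zs = 5"
  proof -
    have "(2 :: nat) ^ num_even zs = 2 ^ 5" using tor[of 2] unfolding prod_list_gcd_2 by simp
    then show ?thesis by (simp only: power_inject_exp)
  qed
  ultimately have "(2 :: nat) ^ length (filter (\<lambda>n. 4 dvd n) zs) = 2 ^ 5" using tor[of 4] by simp
  then show "length (filter (\<lambda>n. 4 dvd n) zs) = 5" by (simp only: power_inject_exp)
qed

text \<open>An entry equal to 2 is even without being divisible by 4, so the two counts, both 5 for
  (Z/4)^5, would differ.\<close>

lemma not_iso_five_copies_of_Zmod4:
  assumes "0 \<notin> set zs" "2 \<in> set zs \<or> num_even zs < 5"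
  shows "\<not> cyclic_product zs \<cong> cyclic_product [4, 4, 4, 4, 4]"
proof
  assume "cyclic_product zs \<cong> cyclic_product [4, 4, 4, 4, 4]"
  note num = num_factors_of_iso_five_copies_of_Zmod4[OF this assms(1)]
  have "length (filter (\<lambda>n. 4 dvd n) zs) < num_even zs" if "2 \<in> set zs"
  proof -
    have "filter (\<lambda>n. 4 dvd n) zs = filter (\<lambda>n. 4 dvd n) (filter even zs)"
      by (auto intro!: filter_cong dest: dvd_trans[of 2 4])
    moreover have "length (filter (\<lambda>n. 4 dvd n) (filter even zs)) < length (filter even zs)"
      by (rule length_filter_less[of 2]) (use that in auto)
    ultimately show ?thesis by simp
  qed
  then show False using num assms(2) by auto
qed

theorem corollary14:
  shows "(let \<A>\<^sub>1 = rank1_list; \<A>\<^sub>2 = rank2_list; \<A>\<^sub>3' = \<A>\<^sub>1 \<times>\<^sub>c \<A>\<^sub>2 in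
         ((\<A>\<^sub>1 \<bullet>\<^sub>c \<A>\<^sub>3') \<union> (\<A>\<^sub>2 \<bullet>\<^sub>c \<A>\<^sub>2)) - ((\<A>\<^sub>1 \<times>\<^sub>c \<A>\<^sub>3') \<union> (\<A>\<^sub>2 \<times>\<^sub>c \<A>\<^sub>2))
           = {iso_class (Zmod_power 4 5)})
    \<and> (cremona_abelian 1 = rank1_list \<and> cremona_abelian 2 = rank2_list \<longrightarrow>
       (let \<A>\<^sub>1 = cremona_abelian 1; \<A>\<^sub>2 = cremona_abelian 2; \<A>\<^sub>3' = \<A>\<^sub>1 \<times>\<^sub>c \<A>\<^sub>2 in
         ((\<A>\<^sub>1 \<bullet>\<^sub>c \<A>\<^sub>3') \<union> (\<A>\<^sub>2 \<bullet>\<^sub>c \<A>\<^sub>2)) - ((\<A>\<^sub>1 \<times>\<^sub>c \<A>\<^sub>3') \<union> (\<A>\<^sub>2 \<times>\<^sub>c \<A>\<^sub>2))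
           = {iso_class (Zmod_power 4 5)}))"
proof -
  \<comment> \<open>\<open>F12\<close> lists the orders for A_3', while \<open>F112\<close> and
    \<open>F22\<close> do so for the two products to be removed.\<close>
  define F12 where "F12 = {xs @ ys |xs ys. xs \<in> factors1 \<and> ys \<in> factors2}"
  define F112 where "F112 = {xs @ ys |xs ys. xs \<in> factors1 \<and> ys \<in> F12}"
  define F22 where "F22 = {xs @ ys |xs ys. xs \<in> factors2 \<and> ys \<in> factors2}"
  let ?c = cyclic_class and ?Z = "cyclic_product [4, 4, 4, 4, 4]"
  have F12: "0 \<notin> set zs" if "zs \<in> F12" for zs
    using that factors1_pos factors2_pos by (auto simp: F12_def)
  have t12: "(?c ` factors1) \<times>\<^sub>c (?c ` factors2) = ?c ` F12"
    unfolding F12_def by (rule class_times_cyclic[OF factors1_pos factors2_pos])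
  have t112: "(?c ` factors1) \<times>\<^sub>c (?c ` F12) = ?c ` F112"
    unfolding F112_def by (rule class_times_cyclic[OF factors1_pos F12])
  have t22: "(?c ` factors2) \<times>\<^sub>c (?c ` factors2) = ?c ` F22"
    unfolding F22_def by (rule class_times_cyclic[OF factors2_pos factors2_pos])
  have Z: "Zmod_power 4 5 = ?Z" by (simp add: Zmod_power_eq numeral_eq_Suc)
  have sym: "cyclic_product xs \<cong> N" if "group N" "N \<cong> cyclic_product xs" for N :: "nat monoid" and xs
    by (rule group.iso_sym[OF that])
  have classify: "iso_class G \<in> ?c ` F22 \<union> {?c [4, 4, 4, 4, 4]}"
    if "(\<exists>xs \<in> factors2. \<exists>ys \<in> factors2. cyclic_product (xs @ ys) \<cong> G) \<or> ?Z \<cong> G" "group G" for G :: "nat monoid"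
    using that iso_class_cong[OF _ group_cyclic_product that(2)] unfolding F22_def by blast
  have sub1: "(?c ` factors1) \<bullet>\<^sub>c (?c ` F12) \<subseteq> ?c ` F22 \<union> {?c [4, 4, 4, 4, 4]}"
  proof
    fix c assume "c \<in> (?c ` factors1) \<bullet>\<^sub>c (?c ` F12)"
    then obtain G H K :: "nat monoid" and f g where c: "c = iso_class G" and G: "comm_group G" "finite (carrier G)"
      and HK: "H \<in> \<Union>(?c ` factors1)" "K \<in> \<Union>(?c ` F12)" and ses: "short_exact_sequence K G H f g"
      unfolding class_ext_def by blast
    interpret finite_abelian_extension H G K g f by (rule short_exact_sequence_imp_extension[OF G ses])
    obtain hs where hs: "hs \<in> factors1" "group H" "H \<cong> cyclic_product hs"
      using HK(1) unfolding mem_Union_cyclic_class by blast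
    obtain xs ys where ks: "xs \<in> factors1" "ys \<in> factors2" "group K" "K \<cong> cyclic_product (xs @ ys)"
      using HK(2) unfolding mem_Union_cyclic_class F12_def by blast
    show "c \<in> ?c ` F22 \<union> {?c [4, 4, 4, 4, 4]}" unfolding c
      by (rule classify[OF iso_product_factors2_of_factors12[OF hs(1) sym[OF hs(2,3)] ks(1,2) sym[OF ks(3,4)]] G.group_axioms])
  qed
  have sub2: "(?c ` factors2) \<bullet>\<^sub>c (?c ` factors2) \<subseteq> ?c ` F22 \<union> {?c [4, 4, 4, 4, 4]}"
  proof
    fix c assume "c \<in> (?c ` factors2) \<bullet>\<^sub>c (?c ` factors2)"
    then obtain G H K :: "nat monoid" and f g where c: "c = iso_class G" and G: "comm_group G" "finite (carrier G)"
      and HK: "H \<in> \<Union>(?c ` factors2)" "K \<in> \<Union>(?c ` factors2)" and ses: "short_exact_sequence K G H f g"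
      unfolding class_ext_def by blast
    interpret finite_abelian_extension H G K g f by (rule short_exact_sequence_imp_extension[OF G ses])
    obtain hs where hs: "hs \<in> factors2" "group H" "H \<cong> cyclic_product hs"
      using HK(1) unfolding mem_Union_cyclic_class by blast
    obtain ks where ks: "ks \<in> factors2" "group K" "K \<cong> cyclic_product ks"
      using HK(2) unfolding mem_Union_cyclic_class by blast
    show "c \<in> ?c ` F22 \<union> {?c [4, 4, 4, 4, 4]}" unfolding c
      by (rule classify[OF iso_product_factors2[OF hs(1) sym[OF hs(2,3)] ks(1) sym[OF ks(2,3)]] G.group_axioms])
  qed
  have mem: "?c [4, 4, 4, 4, 4] \<in> (?c ` factors2) \<bullet>\<^sub>c (?c ` factors2)"
  proof (rule class_ext_nat_copies[OF five_copies_of_Zmod4_extension])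
    show "cyclic_product [2, 4, 4] \<cong> cyclic_product [4, 4, 2]"
      by (rule cyclic_product_mset_iso) (simp_all add: add_mset_commute)
  qed (auto simp: factors2_def is_iso_refl)
  have notin: "?c zs \<noteq> ?c [4, 4, 4, 4, 4]" if zs: "0 \<notin> set zs" "2 \<in> set zs \<or> num_even zs < 5" for zs
  proof
    assume eq: "?c zs = ?c [4, 4, 4, 4, 4]"
    obtain N :: "nat monoid" where N: "group N" "N \<cong> cyclic_product zs"
      using nat_copy_cyclic_product[OF zs(1)] by blast
    then have "N \<in> ?c [4, 4, 4, 4, 4]" unfolding eq[symmetric] by (simp add: iso_class_def)
    then have "N \<cong> ?Z" by (simp add: iso_class_def)
    then have "cyclic_product zs \<cong> ?Z" using is_iso_trans[OF sym[OF N]] by blast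
    then show False using not_iso_five_copies_of_Zmod4[OF zs] by contradiction
  qed
  \<comment> \<open>Without an entry 2, the concatenations in \<open>F22\<close> and
    \<open>F112\<close> have at most 2 + 2 and 1 + 1 + 2 even entries, one short of the five in
    (Z/4)^5.\<close>
  have n1: "2 \<in> set xs \<or> num_even xs \<le> 1" if "xs \<in> factors1" for xs
    using that length_filter_le[of even xs] unfolding factors1_def by fastforce
  have n2: "2 \<in> set xs \<or> num_even xs \<le> 2" if "xs \<in> factors2" for xs
    using that length_filter_le[of even xs] unfolding factors2_def by fastforce
  have F22: "?c zs \<noteq> ?c [4, 4, 4, 4, 4]" if zs: "zs \<in> F22" for zs
  proof -
    obtain xs ys where z: "zs = xs @ ys" "xs \<in> factors2" "ys \<in> factors2" using zs by (auto simp: F22_def)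
    have "2 \<in> set zs \<or> num_even zs < 5" using n2[OF z(2)] n2[OF z(3)] z(1) by auto
    then show ?thesis using notin factors2_pos z by auto
  qed
  have F112: "?c zs \<noteq> ?c [4, 4, 4, 4, 4]" if zs: "zs \<in> F112" for zs
  proof -
    obtain xs ys ws where z: "zs = xs @ ys @ ws" "xs \<in> factors1" "ys \<in> factors1" "ws \<in> factors2"
      using zs by (auto simp: F112_def F12_def)
    have "2 \<in> set zs \<or> num_even zs < 5" using n1[OF z(2)] n1[OF z(3)] n2[OF z(4)] z(1) by auto
    then show ?thesis using notin factors1_pos factors2_pos z by auto
  qed
  have main: "(((?c ` factors1) \<bullet>\<^sub>c (?c ` F12)) \<union> ((?c ` factors2) \<bullet>\<^sub>c (?c ` factors2))) - (?c ` F112 \<union> ?c ` F22)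
      = {?c [4, 4, 4, 4, 4]}"
    using sub1 sub2 mem F22 F112 by blast
  show ?thesis
    unfolding Let_def using main by (simp add: rank1_list_eq rank2_list_eq t12 t112 t22 Z)
qed

end
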